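(* Let $H$ and $A$ be two self-adjoint (possibly unbounded) operators in a complex Hilbert space $\mathscr{H}$. Let $\mathcal{I}$ be a bounded, open interval of $\mathbb{R}$ and assume that $H\in\mathcal{C}^1_{\mathcal{I}}(A)$. Assume that there is some $\varepsilon_0>0$ such that, for any $\varepsilon\in(0;\varepsilon_0]$, there exist a real-valued bounded Borel function $\varphi$ on $\mathbb{R}$ and a constant $c_1>0$ for which the strict, weighted Mourre estimate $$E_{\mathcal{I}}(H)\,[H,i\varphi(A)]\,E_{\mathcal{I}}(H)\ \geq\ c_1\,E_{\mathcal{I}}(H)\,\langle A\rangle^{-1-\varepsilon}\,E_{\mathcal{I}}(H)$$ holds true. Then, for any $s>1/2$ and for any closed sub-interval $\mathcal{I}'$ of $\mathcal{I}$, $$\sup_{\mathrm{Re}\, z\in\mathcal{I}',\ \mathrm{Im}\, z\neq 0}\bigl\|\langle A\rangle^{-s}(H-z)^{-1}\langle A\rangle^{-s}\bigr\|<\infty .$$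
   Context: Scalar products are linear in the second variable. $\langle t\rangle=(1+|t|^2)^{1/2}$. $E_{\mathcal{I}}(H)$ is the spectral projection of $H$ on $\mathcal{I}$. A bounded operator $T$ is in $\mathcal{C}^1(A)$ if, for all $f\in\mathscr{H}$, the map $\mathbb{R}\ni t\mapsto e^{itA}Te^{-itA}f\in\mathscr{H}$ is of class $\mathcal{C}^1$. One writes $H\in\mathcal{C}^1_{\mathcal{I}}(A)$ if $\chi(H)\in\mathcal{C}^1(A)$ for all $\chi\in\mathcal{C}_c^\infty(\mathcal{I})$. For a bounded self-adjoint $B$, $[H,iB]$ is the form on $\mathcal{D}(H)\times\mathcal{D}(H)$ given by $\langle f,[H,iB]g\rangle=\langle Hf,iBg\rangle-\langle Bf,iHg\rangle$; since $\mathcal{I}$ is bounded, $E_{\mathcal{I}}(H)[H,iB]E_{\mathcal{I}}(H)$ is a bounded form on $\mathscr{H}\times\mathscr{H}$, and the inequality is in the sense of forms. A closed sub-interval $\mathcal{I}'$ of $\mathcal{I}$ means an interval that is a closed subset of $\mathbb{R}$ and is contained in $\mathcal{I}$. *)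

theory Defs
  imports "HOL-Analysis.Analysis"
begin

section \<open>Complex Hilbert spaces\<close>

text \<open>The inner product is linear in the second variable.  Completeness and definiteness of
  the norm are inherited from \<^class>\<open>banach\<close>; the real scalar multiplication is the
  restriction of the complex one.\<close>

class chilbert_space = banach +
  fixes scaleC :: "complex \<Rightarrow> 'a \<Rightarrow> 'a" (infixr "*\<^sub>C" 75)
    and cinner :: "'a \<Rightarrow> 'a \<Rightarrow> complex"
  assumes scaleC_add_right: "c *\<^sub>C (x + y) = c *\<^sub>C x + c *\<^sub>C y"
    and scaleC_add_left: "(c + d) *\<^sub>C x = c *\<^sub>C x + d *\<^sub>C x"
    and scaleC_scaleC: "c *\<^sub>C d *\<^sub>C x = (c * d) *\<^sub>C x"
    and scaleR_eq_scaleC: "r *\<^sub>R x = complex_of_real r *\<^sub>C x"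
    and cinner_commute: "cinner x y = cnj (cinner y x)"
    and cinner_add_right: "cinner x (y + z) = cinner x y + cinner x z"
    and cinner_scaleC_right: "cinner x (c *\<^sub>C y) = c * cinner x y"
    and cinner_self: "cinner x x = complex_of_real ((norm x)\<^sup>2)"

instantiation complex :: chilbert_space
begin

definition scaleC_complex :: "complex \<Rightarrow> complex \<Rightarrow> complex" where
  "scaleC_complex c x = c * x"

definition cinner_complex :: "complex \<Rightarrow> complex \<Rightarrow> complex" where
  "cinner_complex x y = cnj x * y"

instance
proof
  fix x :: complex
  show "cinner x x = complex_of_real ((norm x)\<^sup>2)"
    unfolding cinner_complex_def by (metis complex_norm_square mult.commute)
qed (auto simp: scaleC_complex_def cinner_complex_def algebra_simps scaleR_conv_of_real)

end

definition bounded_clinear :: "('a::chilbert_space \<Rightarrow> 'a) \<Rightarrow> bool" where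
  "bounded_clinear T \<longleftrightarrow> bounded_linear T \<and> (\<forall>c x. T (c *\<^sub>C x) = c *\<^sub>C T x)"

definition csubspace :: "'a::chilbert_space set \<Rightarrow> bool" where
  "csubspace S \<longleftrightarrow> 0 \<in> S \<and> (\<forall>x\<in>S. \<forall>y\<in>S. x + y \<in> S) \<and> (\<forall>c. \<forall>x\<in>S. c *\<^sub>C x \<in> S)"


section \<open>Unbounded operators\<close>

text \<open>A possibly unbounded operator is a partial function \<open>T\<close>, with domain \<^term>\<open>dom T\<close>
  and values \<^term>\<open>op_app T f\<close> for \<^term>\<open>f \<in> dom T\<close>.\<close>

definition op_app :: "('a \<rightharpoonup> 'a) \<Rightarrow> 'a \<Rightarrow> 'a" where
  "op_app T f = the (T f)"

definition linear_operator :: "('a::chilbert_space \<rightharpoonup> 'a) \<Rightarrow> bool" where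
  "linear_operator T \<longleftrightarrow> csubspace (dom T) \<and>
     (\<forall>f\<in>dom T. \<forall>g\<in>dom T. op_app T (f + g) = op_app T f + op_app T g) \<and>
     (\<forall>c. \<forall>f\<in>dom T. op_app T (c *\<^sub>C f) = c *\<^sub>C op_app T f)"

definition densely_defined :: "('a::chilbert_space \<rightharpoonup> 'a) \<Rightarrow> bool" where
  "densely_defined T \<longleftrightarrow> closure (dom T) = UNIV"

text \<open>The vector \<open>h\<close> below is unique when \<open>T\<close> is densely defined.\<close>

definition op_adjoint :: "('a::chilbert_space \<rightharpoonup> 'a) \<Rightarrow> ('a \<rightharpoonup> 'a)" where
  "op_adjoint T g =
     (if \<exists>h. \<forall>f\<in>dom T. cinner g (op_app T f) = cinner h f
      then Some (THE h. \<forall>f\<in>dom T. cinner g (op_app T f) = cinner h f)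
      else None)"

definition selfadjoint :: "('a::chilbert_space \<rightharpoonup> 'a) \<Rightarrow> bool" where
  "selfadjoint T \<longleftrightarrow> linear_operator T \<and> densely_defined T \<and> op_adjoint T = T"

text \<open>\<open>(T - z)\<^sup>-\<^sup>1\<close>, for \<open>z\<close> in the resolvent set of \<open>T\<close>.\<close>

definition resolvent :: "('a::chilbert_space \<rightharpoonup> 'a) \<Rightarrow> complex \<Rightarrow> 'a \<Rightarrow> 'a" where
  "resolvent T z f = (THE g. g \<in> dom T \<and> op_app T g - z *\<^sub>C g = f)"


section \<open>Spectral measure and Borel functional calculus\<close>

definition orthogonal_projection :: "('a::chilbert_space \<Rightarrow> 'a) \<Rightarrow> bool" where
  "orthogonal_projection P \<longleftrightarrow> bounded_clinear P \<and> P \<circ> P = P \<and>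
     (\<forall>f g. cinner f (P g) = cinner (P f) g)"

definition projection_valued_measure :: "(real set \<Rightarrow> 'a::chilbert_space \<Rightarrow> 'a) \<Rightarrow> bool" where
  "projection_valued_measure E \<longleftrightarrow>
     (\<forall>S\<in>sets borel. orthogonal_projection (E S)) \<and>
     E {} = (\<lambda>_. 0) \<and> E UNIV = id \<and>
     (\<forall>S\<in>sets borel. \<forall>S'\<in>sets borel. E (S \<inter> S') = E S \<circ> E S') \<and>
     (\<forall>S :: nat \<Rightarrow> real set. range S \<subseteq> sets borel \<longrightarrow> disjoint_family S \<longrightarrow>
        (\<forall>f. (\<lambda>n. E (S n) f) sums E (\<Union>n. S n) f))"

text \<open>The finite Borel measure \<open>S \<mapsto> \<langle>f, E(S) f\<rangle>\<close> on the real line.\<close>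

definition scalar_measure :: "(real set \<Rightarrow> 'a::chilbert_space \<Rightarrow> 'a) \<Rightarrow> 'a \<Rightarrow> real measure" where
  "scalar_measure E f = measure_of UNIV (sets borel) (\<lambda>S. ennreal (Re (cinner f (E S f))))"

text \<open>\<open>T = \<integral> x dE(x)\<close>, including the equality of domains.\<close>

definition spectral_measure_of ::
    "('a::chilbert_space \<rightharpoonup> 'a) \<Rightarrow> (real set \<Rightarrow> 'a \<Rightarrow> 'a) \<Rightarrow> bool" where
  "spectral_measure_of T E \<longleftrightarrow> projection_valued_measure E \<and>
     dom T = {f. integrable (scalar_measure E f) (\<lambda>x. x\<^sup>2)} \<and>
     (\<forall>f\<in>dom T. cinner f (op_app T f) = complex_of_real (LINT x|scalar_measure E f. x))"

text \<open>For self-adjoint \<open>T\<close>, the spectral theorem gives existence of the spectral measure and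
  its uniqueness on Borel sets; its values on other sets are irrelevant, whence the choice.\<close>

definition spectral_projection :: "('a::chilbert_space \<rightharpoonup> 'a) \<Rightarrow> real set \<Rightarrow> 'a \<Rightarrow> 'a" where
  "spectral_projection T = (SOME E. spectral_measure_of T E)"

text \<open>\<open>u(T) = \<integral> u dE\<^sub>T\<close> for a bounded Borel function \<open>u\<close>.  By polarization a bounded operator is
  determined by its quadratic form.\<close>

definition borel_calculus ::
    "('a::chilbert_space \<rightharpoonup> 'a) \<Rightarrow> (real \<Rightarrow> complex) \<Rightarrow> 'a \<Rightarrow> 'a" where
  "borel_calculus T u = (THE B. bounded_clinear B \<and>
     (\<forall>f. cinner f (B f) = (LINT x|scalar_measure (spectral_projection T) f. u x)))"

definition unitary_group :: "('a::chilbert_space \<rightharpoonup> 'a) \<Rightarrow> real \<Rightarrow> 'a \<Rightarrow> 'a" where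
  "unitary_group A t = borel_calculus A (\<lambda>x. exp (\<i> * complex_of_real (t * x)))"

definition japanese_bracket :: "real \<Rightarrow> real" where
  "japanese_bracket t = (1 + \<bar>t\<bar>\<^sup>2) powr (1/2)"

text \<open>\<open>\<langle>A\<rangle>\<^sup>r\<close>; only used for \<open>r \<le> 0\<close>, where the function is bounded.\<close>

definition bracket_power :: "('a::chilbert_space \<rightharpoonup> 'a) \<Rightarrow> real \<Rightarrow> 'a \<Rightarrow> 'a" where
  "bracket_power A r = borel_calculus A (\<lambda>x. complex_of_real (japanese_bracket x powr r))"


section \<open>Regularity with respect to a self-adjoint operator\<close>

definition smooth :: "(real \<Rightarrow> complex) \<Rightarrow> bool" where
  "smooth u \<longleftrightarrow>
     (\<forall>n x. ((\<lambda>v t. vector_derivative v (at t)) ^^ n) u differentiable (at x))"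

definition test_functions :: "real set \<Rightarrow> (real \<Rightarrow> complex) set" where
  "test_functions I = {u. smooth u \<and> compact (closure {x. u x \<noteq> 0}) \<and> closure {x. u x \<noteq> 0} \<subseteq> I}"

definition class_C1 :: "('a::chilbert_space \<rightharpoonup> 'a) \<Rightarrow> ('a \<Rightarrow> 'a) set" where
  "class_C1 A = {T. bounded_clinear T \<and>
     (\<forall>f. (\<lambda>t. unitary_group A t (T (unitary_group A (-t) f))) C1_differentiable_on UNIV)}"

definition class_C1_loc :: "('a::chilbert_space \<rightharpoonup> 'a) \<Rightarrow> real set \<Rightarrow> ('a \<rightharpoonup> 'a) set" where
  "class_C1_loc A I = {H. \<forall>u\<in>test_functions I. borel_calculus H u \<in> class_C1 A}"


section \<open>Commutators and the order on forms\<close>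

text \<open>The form \<open>[H, iB]\<close> on \<open>dom H \<times> dom H\<close>.\<close>

definition commutator_form ::
    "('a::chilbert_space \<rightharpoonup> 'a) \<Rightarrow> ('a \<Rightarrow> 'a) \<Rightarrow> 'a \<Rightarrow> 'a \<Rightarrow> complex" where
  "commutator_form H B f g =
     cinner (op_app H f) (\<i> *\<^sub>C B g) - cinner (B f) (\<i> *\<^sub>C op_app H g)"

text \<open>\<open>P q P\<close>, for a self-adjoint bounded \<open>P\<close> and a form \<open>q\<close> defined on the range of \<open>P\<close>.\<close>

definition sandwich_form ::
    "('a \<Rightarrow> 'a) \<Rightarrow> ('a \<Rightarrow> 'a \<Rightarrow> complex) \<Rightarrow> 'a \<Rightarrow> 'a \<Rightarrow> complex" where
  "sandwich_form P q f g = q (P f) (P g)"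

definition operator_form ::
    "('a::chilbert_space \<Rightarrow> 'a) \<Rightarrow> 'a \<Rightarrow> 'a \<Rightarrow> complex" where
  "operator_form B f g = cinner f (B g)"

definition form_le ::
    "('a \<Rightarrow> 'a \<Rightarrow> complex) \<Rightarrow> ('a \<Rightarrow> 'a \<Rightarrow> complex) \<Rightarrow> bool" where
  "form_le q r \<longleftrightarrow> (\<forall>f. r f f - q f f \<in> \<real>\<^sub>\<ge>\<^sub>0)"

definition weighted_mourre_estimate ::
    "('a::chilbert_space \<rightharpoonup> 'a) \<Rightarrow> ('a \<rightharpoonup> 'a) \<Rightarrow> real set \<Rightarrow> (real \<Rightarrow> real) \<Rightarrow> real \<Rightarrow> real \<Rightarrow> bool" where
  "weighted_mourre_estimate H A I \<phi> c \<epsilon> \<longleftrightarrow>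
     form_le
       (\<lambda>f g. complex_of_real c *
          sandwich_form (spectral_projection H I) (operator_form (bracket_power A (-1-\<epsilon>))) f g)
       (sandwich_form (spectral_projection H I)
          (commutator_form H (borel_calculus A (\<lambda>x. complex_of_real (\<phi> x)))))"

end

theory Submission
  imports
    Defs
    "HOL-Probability.Probability"
    "HOL-Computational_Algebra.Polynomial"
begin

text \<open>Let \<open>1/2 < s < 1\<close>, let \<open>B = \<phi>(A)\<close> belong to \<open>\<epsilon> = 2s - 1\<close> in the Mourre estimate, and let \<open>\<psi>\<close> be a
  bump function supported in \<open>I\<close> and positive on \<open>I'\<close>.  Put \<open>g = \<psi>(H) \<langle>A\<rangle>\<^sup>-\<^sup>s h\<close> and
  \<open>f = (H - z)\<^sup>-\<^sup>1 g\<close>.  As \<open>\<psi>(H)\<close> is of class \<open>C\<^sup>1(A)\<close>, it acts boundedly on the domain of \<open>\<langle>A\<rangle>\<^sup>s\<close>, so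
  that \<open>g = \<langle>A\<rangle>\<^sup>-\<^sup>s k\<close> with \<open>\<parallel>k\<parallel> \<le> C \<parallel>h\<parallel>\<close>.  The Mourre estimate at \<open>f\<close> and the virial identity give
  \<open>c \<parallel>\<langle>A\<rangle>\<^sup>-\<^sup>s f\<parallel>\<^sup>2 \<le> 2 Im z \<langle>f, B f\<rangle> - 2 Im \<langle>g, B f\<rangle> \<le> 4 \<parallel>B\<parallel> \<parallel>k\<parallel> \<parallel>\<langle>A\<rangle>\<^sup>-\<^sup>s f\<parallel>\<close>, because \<open>B\<close> commutes with
  \<open>\<langle>A\<rangle>\<^sup>-\<^sup>s\<close> and \<open>\<bar>Im z\<bar> \<parallel>f\<parallel>\<^sup>2 = \<bar>Im \<langle>f, g\<rangle>\<bar>\<close>.  The remaining part of the resolvent is harmless: with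
  \<open>\<kappa> = Re z\<close>, the function \<open>(1 - \<psi>(x)/\<psi>(\<kappa>)) / (x - z)\<close> is bounded because \<open>\<psi>\<close> is Lipschitz.

  The spectral theorem for unbounded operators is obtained from the Cayley transform \<open>U\<close>: the moment
  problem for \<open>\<langle>f, U\<^sup>n f\<rangle>\<close> is solved by a weak limit of measures with Fejer densities, and the mean ergodic
  theorem shows that the solution has no atom at \<open>1\<close>.\<close>

section \<open>Hilbert space geometry\<close>

text \<open>The spectral measure in the definitions is a choice (\<open>SOME\<close>) and the
  calculus a definite description (\<open>THE\<close>), so the hypotheses on \<open>H\<close> and
  \<open>A\<close> stay opaque until a spectral measure is known to exist; hence the spectral
  theorem. The choice \<epsilon> = 2s - 1 makes -1 - \<epsilon> = -2s, so the right side of the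
  Mourre estimate at \<open>f\<close> is exactly c times the squared norm of <A>^-s f. The estimate
  speaks only of the range of E_I(H), which forces the cut-off \<psi>(H); but the cut-off then
  stands between the resolvent and the weight and has to be passed through <A>^-s. This is where
  C^1(A) enters. A C^1 orbit gives a Lipschitz bound in t, and such a bound controls <A>^s for s <
  1. The restriction is harmless: \<epsilon> may be small, so s may be taken close to 1/2, and the
  weight for a larger exponent is that for a smaller one times a contraction. As \<open>I\<close> is
  bounded, \<open>I'\<close> is compact, so that \<psi> has a positive lower bound on it.\<close>

lemma scaleC_one [simp]: "1 *\<^sub>C x = (x :: 'a::chilbert_space)"
  using scaleR_eq_scaleC[of 1 x] by simp

lemma minus_eq_scaleC: "- x = (-1) *\<^sub>C (x :: 'a::chilbert_space)"
  using scaleR_eq_scaleC[of "-1" x] by simp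

lemma cinner_add_left:
  "cinner (x + y) z = cinner x z + cinner y (z :: 'a::chilbert_space)"
  by (metis cinner_add_right cinner_commute complex_cnj_add)

lemma cinner_scaleC_left [simp]:
  "cinner (c *\<^sub>C x) y = cnj c * cinner x (y :: 'a::chilbert_space)"
  by (metis cinner_commute cinner_scaleC_right complex_cnj_mult)

declare cinner_scaleC_right [simp]

lemma Re_cinner_self [simp]: "Re (cinner x x) = (norm (x :: 'a::chilbert_space))\<^sup>2"
  by (simp add: cinner_self)

lemma Re_cinner_commute: "Re (cinner x y) = Re (cinner y (x :: 'a::chilbert_space))"
  by (subst cinner_commute) simp

text \<open>The class postulates homogeneity of the norm for real scalars only; for complex ones it
  is forced by \<open>cinner_self\<close>.\<close>

lemma norm_scaleC [simp]: "norm (c *\<^sub>C x) = cmod c * norm (x :: 'a::chilbert_space)"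
proof -
  have "complex_of_real ((norm (c *\<^sub>C x))\<^sup>2) = complex_of_real ((cmod c * norm x)\<^sup>2)"
    unfolding power_mult_distrib of_real_mult complex_norm_square cinner_self[symmetric] by simp
  then have "(norm (c *\<^sub>C x))\<^sup>2 = (cmod c * norm x)\<^sup>2"
    using of_real_eq_iff by blast
  then show ?thesis
    by (simp add: power2_eq_iff_nonneg)
qed

lemma norm_add_square:
  "(norm (x + y))\<^sup>2 = (norm x)\<^sup>2 + (norm y)\<^sup>2 + 2 * Re (cinner x (y :: 'a::chilbert_space))"
  using Re_cinner_commute[of y x]
  by (simp flip: Re_cinner_self add: cinner_add_left cinner_add_right)

text \<open>The usual order is reversed: the triangle inequality comes with the Banach space, and
  squaring it yields the real Cauchy-Schwarz inequality.\<close>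

lemma Re_cinner_le: "Re (cinner x y) \<le> norm x * norm (y :: 'a::chilbert_space)"
proof -
  have "(norm (x + y))\<^sup>2 \<le> (norm x + norm y)\<^sup>2"
    by (intro power_mono norm_triangle_ineq norm_ge_zero)
  then show ?thesis
    unfolding norm_add_square by (simp add: power2_sum)
qed

lemma cinner_Cauchy_Schwarz: "cmod (cinner x y) \<le> norm x * norm (y :: 'a::chilbert_space)"
proof (cases "cinner x y = 0")
  case False
  \<comment> \<open>The phase that rotates the inner product onto its modulus, which reduces the
    claim to the real part.\<close>
  define c where "c = cnj (cinner x y) / of_real (cmod (cinner x y))"
  have c: "cmod c = 1"
    using False by (simp add: c_def norm_divide)
  have "c * cinner x y = of_real (cmod (cinner x y))"
    using False complex_norm_square[of "cinner x y"]
    by (simp add: c_def field_simps power2_eq_square)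
  then have "cmod (cinner x y) = Re (cinner x (c *\<^sub>C y))"
    by simp
  also have "\<dots> \<le> norm x * norm (c *\<^sub>C y)"
    by (rule Re_cinner_le)
  finally show ?thesis
    using c by simp
qed simp

lemma bounded_bilinear_cinner:
  "bounded_bilinear (cinner :: 'a::chilbert_space \<Rightarrow> 'a \<Rightarrow> complex)"
proof
  show "\<exists>K. \<forall>(a::'a) b. cmod (cinner a b) \<le> norm a * norm b * K"
    by (intro exI[of _ 1]) (simp add: cinner_Cauchy_Schwarz)
qed (auto simp: cinner_add_left cinner_add_right scaleR_eq_scaleC[where 'a = 'a] scaleR_conv_of_real)

lemma bounded_bilinear_scaleC:
  "bounded_bilinear (scaleC :: complex \<Rightarrow> 'a::chilbert_space \<Rightarrow> 'a)"
proof
  show "\<exists>K. \<forall>a (b::'a). norm (a *\<^sub>C b) \<le> norm a * norm b * K"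
    by (intro exI[of _ 1]) simp
qed (auto simp: scaleC_add_left scaleC_add_right scaleR_eq_scaleC[where 'a = 'a] scaleC_scaleC
    scaleR_conv_of_real mult.commute)

interpretation cinner: bounded_bilinear "cinner :: 'a::chilbert_space \<Rightarrow> 'a \<Rightarrow> complex"
  by (rule bounded_bilinear_cinner)

interpretation scaleC: bounded_bilinear "scaleC :: complex \<Rightarrow> 'a::chilbert_space \<Rightarrow> 'a"
  by (rule bounded_bilinear_scaleC)

declare cinner.zero_left [simp] cinner.zero_right [simp] scaleC.zero_left [simp] scaleC.zero_right [simp]

lemmas cinner_simps = cinner_add_left cinner_add_right cinner.diff_left cinner.diff_right
  cinner.minus_left cinner.minus_right

lemma cinner_ext:
  fixes x y :: "'a::chilbert_space"
  assumes "\<And>f. cinner f x = cinner f y"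
  shows "x = y"
proof -
  have "cinner (x - y) (x - y) = 0"
    using assms by (simp add: cinner.diff_right)
  then show ?thesis
    by (simp add: cinner_self)
qed

lemma cinner_ext_dense:
  fixes x y :: "'a::chilbert_space"
  assumes "closure S = UNIV" and "\<And>f. f \<in> S \<Longrightarrow> cinner f x = cinner f y"
  shows "x = y"
proof (rule cinner_ext)
  fix f :: 'a
  obtain h where h: "\<And>n. h n \<in> S" "h \<longlonglongrightarrow> f"
    using assms(1) closure_sequential[of f S] by auto
  have "(\<lambda>n. cinner (h n) x) \<longlonglongrightarrow> cinner f x" "(\<lambda>n. cinner (h n) y) \<longlonglongrightarrow> cinner f y"
    by (intro cinner.tendsto h tendsto_const)+
  then show "cinner f x = cinner f y"
    using assms(2)[OF h(1)] LIMSEQ_unique by simp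
qed

text \<open>The representing vector minimizes \<open>\<parallel>x\<parallel>\<^sup>2 - 2 Re \<phi>(x)\<close> on \<open>S\<close>.\<close>

lemma Riesz_representation_on:
  fixes \<phi> :: "'a::chilbert_space \<Rightarrow> complex"
  assumes S: "csubspace S" "closed S" and \<phi>: "bounded_linear \<phi>" "\<And>c x. \<phi> (c *\<^sub>C x) = c * \<phi> x"
  shows "\<exists>h\<in>S. \<forall>f\<in>S. \<phi> f = cinner h f"
proof -
  interpret \<phi>: bounded_linear \<phi> by fact
  define J where "J x = (norm x)\<^sup>2 - 2 * Re (\<phi> x)" for x
  have S0: "0 \<in> S" and Sadd: "\<And>x y. x \<in> S \<Longrightarrow> y \<in> S \<Longrightarrow> x + y \<in> S"
    and Sscale: "\<And>c x. x \<in> S \<Longrightarrow> c *\<^sub>C x \<in> S"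
    using S by (auto simp: csubspace_def)
  have SscaleR: "r *\<^sub>R x \<in> S" if "x \<in> S" for r x
    using Sscale[OF that] by (simp add: scaleR_eq_scaleC)
  obtain K where K: "\<And>x. norm (\<phi> x) \<le> norm x * K"
    using \<phi>.bounded by blast
  \<comment> \<open>Completing the square: J x is at least (norm x - K)^2 - K^2.\<close>
  have J_lower: "- K\<^sup>2 \<le> J x" for x
  proof -
    have "Re (\<phi> x) \<le> norm x * K"
      using complex_Re_le_cmod K order_trans by blast
    moreover have "0 \<le> (norm x - K)\<^sup>2" by simp
    ultimately show ?thesis by (simp add: J_def power2_diff)
  qed
  define d where "d = Inf (J ` S)"
  have bdd: "bdd_below (J ` S)"
    using J_lower by (auto simp: bdd_below_def)
  have d_le: "d \<le> J x" if "x \<in> S" for x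
    unfolding d_def using bdd that by (intro cInf_lower) auto
  have "\<exists>x\<in>S. J x < d + 1 / real (Suc n)" for n
    using cInf_lessD[of "J ` S" "d + 1 / real (Suc n)"] S0 unfolding d_def by fastforce
  then obtain x where x: "\<And>n. x n \<in> S" "\<And>n. J (x n) < d + 1 / real (Suc n)"
    by metis
  \<comment> \<open>The parallelogram law for \<open>J\<close>: the linear term is additive, so only
    the quadratic term leaves a remainder. It makes minimizing sequences Cauchy.\<close>
  have mid: "J a + J b = 2 * J ((1/2) *\<^sub>R (a + b)) + (norm (a - b))\<^sup>2 / 2" for a b
  proof -
    have "(norm ((1/2) *\<^sub>R (a + b)))\<^sup>2 = (norm (a + b))\<^sup>2 / 4"
      unfolding norm_scaleR power_mult_distrib by (simp add: power_divide)
    moreover have "Re (\<phi> ((1/2) *\<^sub>R (a + b))) = (Re (\<phi> a) + Re (\<phi> b)) / 2"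
      unfolding \<phi>.scaleR \<phi>.add by simp
    moreover have "(norm (a - b))\<^sup>2 = (norm a)\<^sup>2 + (norm b)\<^sup>2 - 2 * Re (cinner a b)"
      using norm_add_square[of a "- b"] by (simp add: cinner.minus_right)
    ultimately show ?thesis
      using norm_add_square[of a b] unfolding J_def by argo
  qed
  have diff: "(norm (a - b))\<^sup>2 \<le> 2 * (J a - d) + 2 * (J b - d)" if "a \<in> S" "b \<in> S" for a b
    using mid[of a b] d_le[of "(1/2) *\<^sub>R (a + b)"] SscaleR[OF Sadd[OF that]] by simp
  have "Cauchy x"
  proof (rule CauchyI)
    fix e :: real assume "e > 0"
    then obtain N where N: "inverse (real (Suc N)) < e\<^sup>2 / 4"
      using reals_Archimedean[of "e\<^sup>2 / 4"] by auto
    have "norm (x m - x n) < e" if "m \<ge> N" "n \<ge> N" for m n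
    proof -
      have "1 / real (Suc k) \<le> inverse (real (Suc N))" if "k \<ge> N" for k
        using that by (simp add: field_simps)
      from this[OF that(1)] this[OF that(2)]
      have "(norm (x m - x n))\<^sup>2 < e\<^sup>2"
        using diff[OF x(1)[of m] x(1)[of n]] x(2)[of m] x(2)[of n] N by simp
      then show ?thesis
        using \<open>e > 0\<close> by (simp add: power_less_imp_less_base)
    qed
    then show "\<exists>M. \<forall>m\<ge>M. \<forall>n\<ge>M. norm (x m - x n) < e"
      by blast
  qed
  then obtain h where h: "x \<longlonglongrightarrow> h"
    using Cauchy_convergent_iff convergent_def by metis
  have hS: "h \<in> S"
    using S(2) h x(1) closed_sequentially by blast
  have "(\<lambda>n. J (x n)) \<longlonglongrightarrow> J h"
    unfolding J_def by (intro tendsto_intros h \<phi>.tendsto)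
  moreover have "(\<lambda>n. d + 1 / real (Suc n)) \<longlonglongrightarrow> d + 0"
    using LIMSEQ_inverse_real_of_nat by (intro tendsto_intros) (simp add: inverse_eq_divide)
  ultimately have Jh: "J h \<le> d"
    using x(2) by (intro LIMSEQ_le[where X = "\<lambda>n. J (x n)"]) (auto intro: less_imp_le)
  \<comment> \<open>First-order condition at the minimizer \<open>h\<close>. Comparing with h + t f
    and dividing by t > 0 would give 2a \<le> t (norm f)^2 for all t > 0; the value t = a / ((norm
    f)^2 + 1) contradicts a > 0.\<close>
  have key: "Re (\<phi> f) \<le> Re (cinner h f)" if f: "f \<in> S" for f
  proof (rule ccontr)
    define a where "a = Re (\<phi> f) - Re (cinner h f)"
    assume "\<not> Re (\<phi> f) \<le> Re (cinner h f)"
    then have a: "a > 0" by (simp add: a_def)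
    have "0 \<le> t * (norm f)\<^sup>2 - 2 * a" if t: "t > 0" for t
    proof -
      have "J h \<le> J (h + t *\<^sub>R f)"
        using Jh d_le[OF Sadd[OF hS SscaleR[OF f]]] by (rule order_trans)
      then have "0 \<le> t * (t * (norm f)\<^sup>2 - 2 * a)"
        using norm_add_square[of h "t *\<^sub>R f"]
        by (simp add: J_def \<phi>.add \<phi>.scaleR a_def cinner.scaleR_right power_mult_distrib
            algebra_simps power2_eq_square)
      then show ?thesis
        using t by (simp add: zero_le_mult_iff)
    qed
    from this[of "a / ((norm f)\<^sup>2 + 1)"] a have "2 * a \<le> a * (norm f)\<^sup>2 / ((norm f)\<^sup>2 + 1)"
      by (auto simp: add_nonneg_pos)
    also have "\<dots> \<le> a * 1"
      unfolding times_divide_eq_right[symmetric] using a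
      by (intro mult_left_mono) (auto simp: divide_le_eq_1 add_nonneg_pos)
    finally show False using a by simp
  qed
  \<comment> \<open>Passing to -f reverses the inequality; passing to i f afterwards recovers the
    imaginary part.\<close>
  have Re_eq: "Re (\<phi> f) = Re (cinner h f)" if f: "f \<in> S" for f
    using key[OF f] key[OF Sscale[OF f, of "-1"]] by (simp add: \<phi>)
  have "\<phi> f = cinner h f" if f: "f \<in> S" for f
    using Re_eq[OF f] Re_eq[OF Sscale[OF f, of \<i>]] by (simp add: \<phi> complex_eq_iff)
  then show ?thesis
    using hS by blast
qed

lemma Riesz_representation:
  fixes \<phi> :: "'a::chilbert_space \<Rightarrow> complex"
  assumes "bounded_linear \<phi>" "\<And>c x. \<phi> (c *\<^sub>C x) = c * \<phi> x"
  shows "\<exists>h. \<forall>f. \<phi> f = cinner h f"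
  using Riesz_representation_on[of UNIV \<phi>] assms by (auto simp: csubspace_def)

text \<open>The vector representing the functional \<open>cinner g\<close> on \<open>S\<close> is
  the orthogonal projection of \<open>g\<close>.\<close>

lemma orthogonal_decomposition:
  fixes g :: "'a::chilbert_space"
  assumes "csubspace S" "closed S"
  shows "\<exists>h\<in>S. \<forall>f\<in>S. cinner (g - h) f = 0"
  using Riesz_representation_on[OF assms, of "cinner g"]
  by (auto simp: cinner.diff_left cinner.bounded_linear_right)

section \<open>Bounded operators and their quadratic forms\<close>

lemma bounded_clinear_bounded_linear: "bounded_clinear B \<Longrightarrow> bounded_linear B"
  by (simp add: bounded_clinear_def)

lemma bounded_clinear_scaleC: "bounded_clinear B \<Longrightarrow> B (c *\<^sub>C x) = c *\<^sub>C B x"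
  by (simp add: bounded_clinear_def)

lemma bounded_clinear_add: "bounded_clinear B \<Longrightarrow> B (x + y) = B x + B y"
  by (simp add: bounded_clinear_def linear_simps)

lemma bounded_clinear_diff: "bounded_clinear B \<Longrightarrow> B (x - y) = B x - B y"
  by (simp add: bounded_clinear_def linear_simps)

lemma bounded_clinear_compose:
  "bounded_clinear B \<Longrightarrow> bounded_clinear C \<Longrightarrow> bounded_clinear (\<lambda>x. B (C x))"
  by (simp add: bounded_clinear_def bounded_linear_compose)

lemma bounded_clinear_plus:
  "bounded_clinear B \<Longrightarrow> bounded_clinear C \<Longrightarrow> bounded_clinear (\<lambda>x. B x + C x)"
  by (simp add: bounded_clinear_def bounded_linear_add scaleC_add_right)

lemma bounded_clinear_scaleC_op:
  "bounded_clinear B \<Longrightarrow> bounded_clinear (\<lambda>x. c *\<^sub>C B x)"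
  using bounded_linear_compose[OF scaleC.bounded_linear_right, of B c]
  by (simp add: bounded_clinear_def scaleC_scaleC mult.commute)

lemma bounded_clinearI:
  assumes "\<And>x y. B (x + y) = B x + B y" "\<And>c x. B (c *\<^sub>C x) = c *\<^sub>C B x"
    and "\<And>x. norm (B x) \<le> norm x * K"
  shows "bounded_clinear (B :: 'a::chilbert_space \<Rightarrow> 'a)"
  unfolding bounded_clinear_def
  using assms by (auto simp: scaleR_eq_scaleC intro!: bounded_linear_intro[where K = K])

definition quadratic_polarization :: "('a::chilbert_space \<Rightarrow> complex) \<Rightarrow> 'a \<Rightarrow> 'a \<Rightarrow> complex" where
  "quadratic_polarization q f g =
     (q (f + g) - q (f - g) - \<i> * q (f + \<i> *\<^sub>C g) + \<i> * q (f - \<i> *\<^sub>C g)) / 4"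

text \<open>Stated on a subspace \<open>D\<close> so that it also serves unbounded operators, which
  are linear only on their domain.\<close>

lemma polarization_on:
  assumes D: "csubspace D" and fg: "f \<in> D" "g \<in> D"
    and add: "\<And>x y. x \<in> D \<Longrightarrow> y \<in> D \<Longrightarrow> B (x + y) = B x + B y"
    and scale: "\<And>c x. x \<in> D \<Longrightarrow> B (c *\<^sub>C x) = c *\<^sub>C B x"
  shows "cinner f (B g) = quadratic_polarization (\<lambda>f. cinner f (B f)) f g"
proof -
  have D': "c *\<^sub>C x \<in> D" if "x \<in> D" for c x
    using D that by (simp add: csubspace_def)
  have m: "B (- x) = - B x" "- x \<in> D" if "x \<in> D" for x
    using scale[OF that, of "-1"] D'[OF that, of "-1"] by (simp_all add: minus_eq_scaleC[symmetric])
  have diff: "B (x - y) = B x - B y" if "x \<in> D" "y \<in> D" for x y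
    using add[of x "- y"] that by (simp add: m)
  define a b c d where "a = cinner f (B f)" "b = cinner f (B g)" "c = cinner g (B f)" "d = cinner g (B g)"
  note abcd = this
  have "cinner (f + g) (B (f + g)) = a + b + c + d" "cinner (f - g) (B (f - g)) = a - b - c + d"
    "cinner (f + \<i> *\<^sub>C g) (B (f + \<i> *\<^sub>C g)) = a + \<i> * b - \<i> * c + d"
    "cinner (f - \<i> *\<^sub>C g) (B (f - \<i> *\<^sub>C g)) = a - \<i> * b + \<i> * c + d"
    using fg by (simp_all add: abcd add diff scale D' cinner_simps distrib_left right_diff_distrib mult.assoc[symmetric])
  then show ?thesis
    unfolding quadratic_polarization_def abcd(2)[symmetric]
    by (simp add: right_diff_distrib distrib_left mult.assoc[symmetric])
qed

lemma polarization:
  "bounded_clinear B \<Longrightarrow> cinner f (B g) = quadratic_polarization (\<lambda>f. cinner f (B f)) f g"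
  by (rule polarization_on[of UNIV])
    (auto simp: csubspace_def bounded_clinear_add bounded_clinear_scaleC)

lemma quadratic_form_eqD:
  assumes "bounded_clinear B" "bounded_clinear C" "\<And>f. cinner f (B f) = cinner f (C f)"
  shows "B = C"
proof
  fix g
  have "cinner f (B g) = cinner f (C g)" for f
    using polarization[OF assms(1), of f g] polarization[OF assms(2), of f g]
    by (simp only: assms(3))
  then show "B g = C g"
    by (rule cinner_ext)
qed

text \<open>Polarization at unit vectors has four terms whose vectors have norm at most 2, divided
  by 4, whence the factor 4. The crude constant suffices to construct operators;
  \<open>norm_calculus_le\<close> later gives the sharp bound for the calculus.\<close>

lemma quadratic_form_bound:
  assumes B: "bounded_clinear (B :: 'a::chilbert_space \<Rightarrow> 'a)" and q: "\<And>f. cmod (cinner f (B f)) \<le> C * (norm f)\<^sup>2"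
  shows "cmod (cinner f (B g)) \<le> 4 * C * norm f * norm g"
proof (cases "f = 0 \<or> g = 0")
  case False
  have unit: "cmod (cinner f (B g)) \<le> 4 * C" if "norm f = 1" "norm g = 1" for f g :: 'a
  proof -
    have C: "C \<ge> 0"
      using order_trans[OF norm_ge_zero q[of f]] that by simp
    have q': "cmod (cinner h (B h)) \<le> C * 2\<^sup>2" if "norm h \<le> 2" for h
      using q[of h] mult_left_mono[OF power_mono[OF that norm_ge_zero, of 2] C] by linarith
    have bounds: "norm (f + g) \<le> 2" "norm (f - g) \<le> 2"
      "norm (f + \<i> *\<^sub>C g) \<le> 2" "norm (f - \<i> *\<^sub>C g) \<le> 2"
      using norm_triangle_ineq[of f g] norm_triangle_ineq4[of f g]
        norm_triangle_ineq[of f "\<i> *\<^sub>C g"] norm_triangle_ineq4[of f "\<i> *\<^sub>C g"] that by auto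
    let ?q = "\<lambda>h. cinner h (B h)"
    have "cmod (?q (f + g) - ?q (f - g) - \<i> * ?q (f + \<i> *\<^sub>C g) + \<i> * ?q (f - \<i> *\<^sub>C g))
      \<le> cmod (?q (f + g)) + cmod (?q (f - g)) + cmod (\<i> * ?q (f + \<i> *\<^sub>C g))
         + cmod (\<i> * ?q (f - \<i> *\<^sub>C g))"
      using norm_triangle_ineq[of "?q (f + g) - ?q (f - g) - \<i> * ?q (f + \<i> *\<^sub>C g)" "\<i> * ?q (f - \<i> *\<^sub>C g)"]
        norm_triangle_ineq4[of "?q (f + g) - ?q (f - g)" "\<i> * ?q (f + \<i> *\<^sub>C g)"]
        norm_triangle_ineq4[of "?q (f + g)" "?q (f - g)"] by linarith
    also have "\<dots> \<le> C * 2\<^sup>2 + C * 2\<^sup>2 + C * 2\<^sup>2 + C * 2\<^sup>2"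
      unfolding norm_mult norm_ii mult_1 using bounds by (intro add_mono q')
    finally show ?thesis
      unfolding polarization[OF B, of f g] quadratic_polarization_def by (simp add: norm_divide)
  qed
  define f' g' where "f' = complex_of_real (1 / norm f) *\<^sub>C f" "g' = complex_of_real (1 / norm g) *\<^sub>C g"
  have "cmod (cinner f' (B g')) \<le> 4 * C"
    using False by (intro unit) (auto simp: f'_g'_def norm_divide)
  moreover have "cmod (cinner f' (B g')) = cmod (cinner f (B g)) / (norm f * norm g)"
    by (simp add: f'_g'_def bounded_clinear_scaleC[OF B] norm_mult norm_divide)
  ultimately show ?thesis
    using False by (simp add: field_simps)
qed (auto simp: linear_simps bounded_clinear_bounded_linear[OF B])

text \<open>Riesz is applied to the conjugate of the form in its first variable, which is linear
  there because the form is conjugate-linear.\<close>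

lemma bounded_sesquilinear_representation:
  fixes b :: "'a::chilbert_space \<Rightarrow> 'a \<Rightarrow> complex"
  assumes "\<And>f g h. b f (g + h) = b f g + b f h" "\<And>f g h. b (f + g) h = b f h + b g h"
    and "\<And>c f g. b f (c *\<^sub>C g) = c * b f g" "\<And>c f g. b (c *\<^sub>C f) g = cnj c * b f g"
    and bound: "\<And>f g. cmod (b f g) \<le> K * norm f * norm g"
  shows "\<exists>B. bounded_clinear B \<and> (\<forall>f g. cinner f (B g) = b f g)"
proof -
  have "\<exists>h. \<forall>f. cnj (b f g) = cinner h f" for g
  proof (rule Riesz_representation)
    show "bounded_linear (\<lambda>f. cnj (b f g))"
    proof (rule bounded_linear_intro[where K = "K * norm g"])
      fix r x
      show "cnj (b (r *\<^sub>R x) g) = r *\<^sub>R cnj (b x g)"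
        by (simp add: scaleR_eq_scaleC[where 'a = 'a] assms scaleR_conv_of_real)
      show "norm (cnj (b x g)) \<le> norm x * (K * norm g)"
        using bound[of x g] by (simp add: mult_ac)
    qed (simp add: assms)
  qed (simp add: assms)
  then obtain B where B: "\<And>f g. cnj (b f g) = cinner (B g) f"
    by metis
  have B: "cinner f (B g) = b f g" for f g
    using B[of f g] by (metis cinner_commute complex_cnj_cnj)
  have "bounded_clinear B"
  proof (rule bounded_clinearI)
    fix x y c
    show "B (x + y) = B x + B y"
      by (rule cinner_ext) (simp add: cinner_add_right B assms)
    show "B (c *\<^sub>C x) = c *\<^sub>C B x"
      by (rule cinner_ext) (simp add: B assms)
    have "(norm (B x))\<^sup>2 \<le> norm (B x) * (norm x * K)"
      using bound[of "B x" x] cinner_self[of "B x"] by (simp add: B norm_power mult_ac)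
    \<comment> \<open>The sign of \<open>K\<close> is not a hypothesis; it is read off from the
      bound at (x, x) when x is not 0.\<close>
    moreover have "0 \<le> norm x * K"
    proof (cases "x = 0")
      case False
      have "0 \<le> K * norm x * norm x"
        using bound[of x x] norm_ge_zero[of "b x x"] by linarith
      then show ?thesis
        using False by (simp add: zero_le_mult_iff)
    qed simp
    ultimately show "norm (B x) \<le> norm x * K"
      by (cases "norm (B x) = 0") (auto simp: power2_eq_square)
  qed
  with B show ?thesis by blast
qed

section \<open>Classes of functions closed under bounded pointwise limits\<close>

definition bounded_borel :: "(real \<Rightarrow> complex) set" where
  "bounded_borel = {u. u \<in> borel_measurable borel \<and> bounded (range u)}"

definition limit_closed :: "(real \<Rightarrow> complex) set \<Rightarrow> bool" where
  "limit_closed F \<longleftrightarrow>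
     (\<forall>u\<in>F. \<forall>v\<in>F. (\<lambda>x. u x + v x) \<in> F) \<and>
     (\<forall>u\<in>F. \<forall>c. (\<lambda>x. c * u x) \<in> F) \<and>
     (\<forall>U u C. (\<forall>n. U n \<in> F) \<longrightarrow> (\<forall>n x. cmod (U n x) \<le> C) \<longrightarrow> (\<forall>x. (\<lambda>n. U n x) \<longlonglongrightarrow> u x) \<longrightarrow> u \<in> F)"

text \<open>A monotone-class principle as a predicate: a property that is linear and stable under
  bounded pointwise limits holds for all bounded Borel functions once it holds on \<open>G\<close>.
  Two sets \<open>G\<close> occur: monomials in the Cayley function, to build a spectral measure,
  and indicators, to exploit a given one.\<close>

definition generating :: "(real \<Rightarrow> complex) set \<Rightarrow> bool" where
  "generating G \<longleftrightarrow> (\<forall>F. limit_closed F \<longrightarrow> G \<subseteq> F \<longrightarrow> bounded_borel \<subseteq> F)"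

lemma limit_closedI:
  assumes "\<And>u v. u \<in> F \<Longrightarrow> v \<in> F \<Longrightarrow> (\<lambda>x. u x + v x) \<in> F"
    and "\<And>u c. u \<in> F \<Longrightarrow> (\<lambda>x. c * u x) \<in> F"
    and "\<And>U u C. (\<And>n. U n \<in> F) \<Longrightarrow> (\<And>n x. cmod (U n x) \<le> C) \<Longrightarrow> (\<And>x. (\<lambda>n. U n x) \<longlonglongrightarrow> u x) \<Longrightarrow> u \<in> F"
  shows "limit_closed F"
  unfolding limit_closed_def using assms by blast

lemma limit_closed_add: "limit_closed F \<Longrightarrow> u \<in> F \<Longrightarrow> v \<in> F \<Longrightarrow> (\<lambda>x. u x + v x) \<in> F"
  and limit_closed_scale: "limit_closed F \<Longrightarrow> u \<in> F \<Longrightarrow> (\<lambda>x. c * u x) \<in> F"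
  unfolding limit_closed_def by blast+

lemma limit_closed_lim:
  "limit_closed F \<Longrightarrow> (\<And>n. U n \<in> F) \<Longrightarrow> (\<And>n x. cmod (U n x) \<le> C) \<Longrightarrow>
     (\<And>x. (\<lambda>n. U n x) \<longlonglongrightarrow> u x) \<Longrightarrow> u \<in> F"
  unfolding limit_closed_def by blast

lemma limit_closed_sum:
  assumes F: "limit_closed F" and "finite J" "J \<noteq> {}" "\<And>j. j \<in> J \<Longrightarrow> u j \<in> F"
  shows "(\<lambda>x. \<Sum>j\<in>J. u j x) \<in> F"
  using assms(2-) by (induction rule: finite_ne_induct) (simp_all add: limit_closed_add[OF F])

lemma bounded_borel_measurable: "u \<in> bounded_borel \<Longrightarrow> u \<in> borel_measurable borel"
  by (simp add: bounded_borel_def)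

lemma bounded_borelI:
  assumes "u \<in> borel_measurable borel" "\<And>x. cmod (u x) \<le> C"
  shows "u \<in> bounded_borel"
  unfolding bounded_borel_def bounded_iff using assms by blast

lemma bounded_borelE:
  assumes "u \<in> bounded_borel"
  obtains C where "C > 0" "\<And>x. cmod (u x) \<le> C"
  using assms unfolding bounded_borel_def bounded_pos by auto

lemma bounded_borel_add:
  assumes "u \<in> bounded_borel" "v \<in> bounded_borel"
  shows "(\<lambda>x. u x + v x) \<in> bounded_borel"
proof -
  obtain C D where "\<And>x. cmod (u x) \<le> C" "\<And>x. cmod (v x) \<le> D"
    using bounded_borelE[OF assms(1)] bounded_borelE[OF assms(2)] by metis
  then show ?thesis
    using assms by (intro bounded_borelI[where C = "C + D"] norm_triangle_mono)
      (auto simp: bounded_borel_def)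
qed

lemma bounded_borel_mult:
  assumes "u \<in> bounded_borel" "v \<in> bounded_borel"
  shows "(\<lambda>x. u x * v x) \<in> bounded_borel"
proof -
  obtain C D where CD: "C > 0" "\<And>x. cmod (u x) \<le> C" "\<And>x. cmod (v x) \<le> D"
    using bounded_borelE[OF assms(1)] bounded_borelE[OF assms(2)] by metis
  show ?thesis
    using assms CD by (intro bounded_borelI[where C = "C * D"])
      (auto simp: bounded_borel_def norm_mult intro!: mult_mono)
qed

lemma bounded_borel_const: "(\<lambda>x. c) \<in> bounded_borel"
  by (intro bounded_borelI[where C = "cmod c"]) auto

lemma bounded_borel_scale: "u \<in> bounded_borel \<Longrightarrow> (\<lambda>x. c * u x) \<in> bounded_borel"
  by (intro bounded_borel_mult bounded_borel_const)

lemma measurable_cnj [measurable (raw)]: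
  "u \<in> borel_measurable M \<Longrightarrow> (\<lambda>x. cnj (u x)) \<in> borel_measurable M"
  by (rule measurable_compose[OF _ borel_measurable_continuous_onI])
    (auto intro: continuous_intros)

lemma bounded_borel_cnj: "u \<in> bounded_borel \<Longrightarrow> (\<lambda>x. cnj (u x)) \<in> bounded_borel"
  by (auto simp: bounded_borel_def bounded_iff intro: measurable_cnj)

lemma bounded_borel_indicator: "S \<in> sets borel \<Longrightarrow> indicator S \<in> bounded_borel"
  by (intro bounded_borelI[where C = 1]) (auto simp: indicator_def)

lemma limit_closed_bounded_borel: "limit_closed bounded_borel"
proof (rule limit_closedI)
  fix U :: "nat \<Rightarrow> real \<Rightarrow> complex" and u C
  assume U: "\<And>n. U n \<in> bounded_borel" "\<And>n x. cmod (U n x) \<le> C" "\<And>x. (\<lambda>n. U n x) \<longlonglongrightarrow> u x"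
  show "u \<in> bounded_borel"
  proof (rule bounded_borelI)
    show "u \<in> borel_measurable borel"
      by (rule borel_measurable_LIMSEQ_metric[OF bounded_borel_measurable[OF U(1)] U(3)])
    show "cmod (u x) \<le> C" for x
      by (rule Lim_bounded[OF tendsto_norm[OF U(3)], where M = 0]) (simp add: U(2))
  qed
qed (assumption | rule bounded_borel_add bounded_borel_scale)+

text \<open>Simple functions converge to \<open>u\<close> with modulus at most twice that of
  \<open>u\<close>, so the limit is a bounded one.\<close>

lemma generating_indicators: "generating ((\<lambda>S. indicator S) ` sets borel)"
  unfolding generating_def
proof (intro allI impI subsetI)
  fix F :: "(real \<Rightarrow> complex) set" and u
  assume F: "limit_closed F" and G: "(\<lambda>S. indicator S) ` sets borel \<subseteq> F" and u: "u \<in> bounded_borel"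
  have G: "indicator S \<in> F" if "S \<in> sets borel" for S
    using G that by blast
  have meas: "u \<in> borel_measurable borel"
    using u by (rule bounded_borel_measurable)
  obtain C where C: "\<And>x. cmod (u x) \<le> C"
    using bounded_borelE[OF u] by blast
  from borel_measurable_implies_sequence_metric[OF meas, of 0]
  obtain s where s: "\<And>i. simple_function borel (s i)" "\<And>x. (\<lambda>i. s i x) \<longlonglongrightarrow> u x"
      "\<And>i x. cmod (s i x) \<le> 2 * cmod (u x)"
    by auto
  have "s i \<in> F" for i
  proof -
    have fin: "finite (range (s i))"
      using s(1)[of i] by (simp add: simple_function_def)
    have "(\<lambda>x. \<Sum>c\<in>range (s i). c * indicator (s i -` {c}) x) \<in> F"
    proof (intro limit_closed_sum[OF F fin] limit_closed_scale[OF F] G)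
      fix c
      show "s i -` {c} \<in> sets borel"
        using measurable_sets[OF borel_measurable_simple_function[OF s(1)[of i]], of "{c}"] by simp
    qed auto
    also have "(\<lambda>x. \<Sum>c\<in>range (s i). c * indicator (s i -` {c}) x) = s i"
      using fin by (auto simp: fun_eq_iff indicator_def if_distrib[of "\<lambda>x. _ * x"] sum.delta cong: if_cong)
    finally show ?thesis .
  qed
  then show "u \<in> F"
  proof (rule limit_closed_lim[OF F, where C = "2 * C" and U = s])
    show "cmod (s n x) \<le> 2 * C" for n x
      using s(3)[of n x] C[of x] by linarith
  qed (use s(2) in auto)
qed

section \<open>The Cayley function and trigonometric polynomials in it\<close>

definition cayley :: "real \<Rightarrow> complex" where
  "cayley x = (of_real x - \<i>) / (of_real x + \<i>)"

text \<open>On the unit circle without 1 the quotient is already real; the real part only fixes the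
  type. At 1 division by zero yields the value 0, so 1 has no preimage there and measures
  transported by this map must not charge it.\<close>

definition cayley_inverse :: "complex \<Rightarrow> real" where
  "cayley_inverse z = Re (\<i> * (1 + z) / (1 - z))"

lemma real_plus_i_nonzero [simp]:
  "complex_of_real x + \<i> \<noteq> 0" "\<i> + complex_of_real x \<noteq> 0" "complex_of_real x - \<i> \<noteq> 0"
  by (auto simp: complex_eq_iff)

lemma norm_cayley [simp]: "cmod (cayley x) = 1"
proof -
  have "cmod (of_real x - \<i>) = cmod (of_real x + \<i>)"
    by (simp add: cmod_def)
  then show ?thesis
    by (simp add: cayley_def norm_divide)
qed

lemma cayley_inverse_cayley [simp]: "cayley_inverse (cayley x) = x"
proof -
  have "1 + cayley x = 2 * of_real x / (of_real x + \<i>)" "1 - cayley x = 2 * \<i> / (of_real x + \<i>)"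
    by (simp_all add: cayley_def divide_simps)
  then have "\<i> * (1 + cayley x) / (1 - cayley x) = of_real x"
    by simp
  then show ?thesis
    by (simp add: cayley_inverse_def)
qed

lemma cayley_cayley_inverse:
  assumes "cmod z = 1" "z \<noteq> 1"
  shows "cayley (cayley_inverse z) = z"
proof -
  define y where "y = \<i> * (1 + z) / (1 - z)"
  have "z * cnj z = 1"
    using assms(1) by (simp add: complex_norm_square[symmetric])
  moreover have z0: "z \<noteq> 0" using assms(1) by auto
  ultimately have "cnj z = 1 / z"
    by (simp add: eq_divide_eq mult.commute)
  then have "cnj y = - \<i> * (1 + 1 / z) / (1 - 1 / z)"
    by (simp add: y_def)
  also have "\<dots> = y"
    using z0 assms(2) by (simp add: y_def divide_simps) (simp add: algebra_simps)
  finally have "y \<in> \<real>"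
    by (simp add: Reals_cnj_iff)
  then have y: "of_real (cayley_inverse z) = y"
    by (simp add: cayley_inverse_def y_def[symmetric])
  have "y - \<i> = 2 * \<i> * z / (1 - z)" "y + \<i> = 2 * \<i> / (1 - z)"
    using assms(2) by (simp_all add: y_def field_simps)
  then show ?thesis
    using assms(2) by (simp add: cayley_def y)
qed

lemma measurable_cayley [measurable]: "cayley \<in> borel_measurable borel"
  unfolding cayley_def[abs_def] by measurable

lemma measurable_cayley_inverse [measurable]: "cayley_inverse \<in> borel_measurable borel"
  unfolding cayley_inverse_def[abs_def] by measurable

text \<open>Monomials are closed under products, and the one with exponents (n, m) corresponds to
  the n-th power of the Cayley transform times the m-th power of its inverse; this starts the
  calculus.\<close>

definition cayley_monomials :: "(real \<Rightarrow> complex) set" where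
  "cayley_monomials = (\<lambda>(n, m) x. cayley x ^ n * cnj (cayley x) ^ m) ` UNIV"

inductive_set cayley_polynomials :: "(real \<Rightarrow> complex) set" where
  monomial: "u \<in> cayley_monomials \<Longrightarrow> u \<in> cayley_polynomials"
| add: "u \<in> cayley_polynomials \<Longrightarrow> v \<in> cayley_polynomials \<Longrightarrow> (\<lambda>x. u x + v x) \<in> cayley_polynomials"
| scale: "u \<in> cayley_polynomials \<Longrightarrow> (\<lambda>x. c * u x) \<in> cayley_polynomials"

lemma cayley_polynomials_mult_cayley:
  assumes "u \<in> cayley_polynomials"
  shows "(\<lambda>x. cayley x * u x) \<in> cayley_polynomials" "(\<lambda>x. cnj (cayley x) * u x) \<in> cayley_polynomials"
  using assms
proof (induction)
  case (monomial u)
  then obtain n m where u: "u = (\<lambda>x. cayley x ^ n * cnj (cayley x) ^ m)"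
    by (auto simp: cayley_monomials_def)
  case 1
  have "(\<lambda>x. cayley x ^ Suc n * cnj (cayley x) ^ m) \<in> cayley_polynomials"
    by (intro cayley_polynomials.monomial)
      (auto simp: cayley_monomials_def intro!: image_eqI[of _ _ "(Suc n, m)"])
  then show ?case by (simp add: u mult_ac)
  case 2
  have "(\<lambda>x. cayley x ^ n * cnj (cayley x) ^ Suc m) \<in> cayley_polynomials"
    by (intro cayley_polynomials.monomial)
      (auto simp: cayley_monomials_def intro!: image_eqI[of _ _ "(n, Suc m)"])
  then show ?case by (simp add: u mult_ac)
next
  case (add u v)
  show "(\<lambda>x. cayley x * (u x + v x)) \<in> cayley_polynomials"
    "(\<lambda>x. cnj (cayley x) * (u x + v x)) \<in> cayley_polynomials"
    unfolding distrib_left by (rule cayley_polynomials.add; fact)+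
next
  case (scale u c)
  show "(\<lambda>x. cayley x * (c * u x)) \<in> cayley_polynomials"
    "(\<lambda>x. cnj (cayley x) * (c * u x)) \<in> cayley_polynomials"
    unfolding mult.left_commute[where a = c] by (rule cayley_polynomials.scale; fact)+
qed

text \<open>Stone-Weierstrass supplies real polynomials in the plane, built from real-linear
  functionals, and each such functional is a combination of z and its conjugate. The extra factor
  \<open>u\<close> makes the induction pass through products.\<close>

lemma cayley_polynomials_real_polynomial:
  assumes "real_polynomial_function p" "u \<in> cayley_polynomials"
  shows "(\<lambda>x. of_real (p (cayley x)) * u x) \<in> cayley_polynomials"
  using assms
proof (induction arbitrary: u)
  case (linear p)
  note u = linear(2)
  interpret bounded_linear p by fact
  define a b where "a = of_real (p 1) / 2 - \<i> * of_real (p \<i>) / 2"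
    and "b = of_real (p 1) / 2 + \<i> * of_real (p \<i>) / 2"
  have p: "of_real (p z) = a * z + b * cnj z" for z
  proof -
    have "z = Re z *\<^sub>R 1 + Im z *\<^sub>R \<i>"
      by (simp add: complex_eq_iff)
    then have "p z = Re z * p 1 + Im z * p \<i>"
      using add[of "Re z *\<^sub>R 1" "Im z *\<^sub>R \<i>"] by (simp add: scaleR del: complex_scaleR)
    then show ?thesis
      by (simp add: a_def b_def complex_eq_iff algebra_simps)
  qed
  show ?case
    unfolding p distrib_right mult.assoc
    using u by (intro cayley_polynomials.add cayley_polynomials.scale cayley_polynomials_mult_cayley)
next
  case (const c)
  then show ?case by (rule cayley_polynomials.scale)
next
  case (add p q)
  then show ?case
    by (simp add: distrib_right cayley_polynomials.add)
next
  case (mult p q)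
  then show ?case
    by (simp add: mult.assoc)
qed

lemma generating_cayley_monomials: "generating cayley_monomials"
  unfolding generating_def
proof (intro allI impI)
  fix F :: "(real \<Rightarrow> complex) set"
  assume F: "limit_closed F" and G: "cayley_monomials \<subseteq> F"
  have poly: "u \<in> F" if "u \<in> cayley_polynomials" for u
    using that by induction (use G limit_closed_add[OF F] limit_closed_scale[OF F] in blast)+
  have one: "(\<lambda>x. 1) \<in> cayley_polynomials"
    by (intro cayley_polynomials.monomial)
      (auto simp: cayley_monomials_def intro!: image_eqI[of _ _ "(0, 0)"])
  have cont: "(\<lambda>x. of_real (g (cayley x))) \<in> F" if g: "continuous_on (sphere 0 1) g" for g :: "complex \<Rightarrow> real"
  proof -
    have "\<exists>p. real_polynomial_function p \<and> (\<forall>z\<in>sphere 0 1. \<bar>g z - p z\<bar> < 1 / real (Suc n))" for n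
      using Stone_Weierstrass_real_polynomial_function[OF compact_sphere g, of "1 / real (Suc n)"]
      by (metis of_nat_0_less_iff zero_less_Suc zero_less_divide_1_iff)
    then obtain p where p: "\<And>n. real_polynomial_function (p n)"
        "\<And>n z. cmod z = 1 \<Longrightarrow> \<bar>g z - p n z\<bar> < 1 / real (Suc n)"
      by (metis mem_sphere_0)
    obtain C where C: "\<And>z. cmod z = 1 \<Longrightarrow> \<bar>g z\<bar> \<le> C"
      using compact_imp_bounded[OF compact_continuous_image[OF g compact_sphere]]
      unfolding bounded_iff by (metis image_eqI mem_sphere_0 real_norm_def)
    show ?thesis
    proof (rule limit_closed_lim[OF F, where C = "C + 1"])
      show "(\<lambda>x. of_real (p n (cayley x))) \<in> F" for n
        using cayley_polynomials_real_polynomial[OF p(1) one, of n] by (intro poly) simp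
      show "cmod (of_real (p n (cayley x))) \<le> C + 1" for n x
      proof -
        have "1 / real (Suc n) \<le> 1" by simp
        then show ?thesis
          using p(2)[of "cayley x" n] C[of "cayley x"]
          by (simp only: norm_of_real norm_cayley) linarith
      qed
      show "(\<lambda>n. complex_of_real (p n (cayley x))) \<longlonglongrightarrow> of_real (g (cayley x))" for x
      proof (rule tendsto_of_real, rule LIMSEQ_I)
        fix r :: real assume "r > 0"
        then obtain N where N: "inverse (real (Suc N)) < r"
          using reals_Archimedean by blast
        have "norm (p n (cayley x) - g (cayley x)) < r" if "n \<ge> N" for n
        proof -
          have "1 / real (Suc n) \<le> inverse (real (Suc N))"
            using that by (simp add: field_simps)
          then show ?thesis
            using p(2)[of "cayley x" n] N by simp
        qed
        then show "\<exists>N. \<forall>n\<ge>N. norm (p n (cayley x) - g (cayley x)) < r" by blast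
      qed
    qed
  qed
  have const1: "(\<lambda>x. 1) \<in> F"
    using one by (rule poly)
  have open_ind: "(\<lambda>x. indicator S (cayley x)) \<in> F" if S: "open S" for S
  \<comment> \<open>The whole plane is treated apart, since \<open>infdist\<close> to the empty
    complement is 0 by convention and the approximating functions would vanish.\<close>
  proof (cases "S = UNIV")
    case False
    then have ne: "- S \<noteq> {}" by auto
    show ?thesis
    proof (rule limit_closed_lim[OF F, where C = 1])
      let ?g = "\<lambda>n z. min 1 (real n * infdist z (- S))"
      show "(\<lambda>x. of_real (?g n (cayley x))) \<in> F" for n
        by (intro cont continuous_intros)
      show "cmod (complex_of_real (?g n (cayley x))) \<le> 1" for n x
        by (simp add: infdist_nonneg)
      show "(\<lambda>n. complex_of_real (?g n (cayley x))) \<longlonglongrightarrow> indicator S (cayley x)" for x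
      proof (cases "cayley x \<in> S")
        case True
        then have pos: "infdist (cayley x) (- S) > 0"
          using S ne in_closed_iff_infdist_zero[of "- S" "cayley x"] infdist_nonneg[of "cayley x" "- S"]
          by force
        obtain N where N: "1 \<le> real N * infdist (cayley x) (- S)"
          using reals_Archimedean3[OF pos] less_imp_le by blast
        have "?g n (cayley x) = 1" if "n \<ge> N" for n
        proof -
          have "real N * infdist (cayley x) (- S) \<le> real n * infdist (cayley x) (- S)"
            using that pos by (intro mult_right_mono) auto
          then show ?thesis using N by simp
        qed
        then have "(\<lambda>n. complex_of_real (?g n (cayley x))) \<longlonglongrightarrow> 1"
          by (intro tendsto_eventually) (auto simp: eventually_sequentially intro!: exI[of _ N])
        then show ?thesis using True by simp
      qed simp
    qed
  qed (use const1 in simp)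
  have pull: "(\<lambda>x. indicator S (cayley x)) \<in> F" if S: "S \<in> sets (borel :: complex measure)" for S
  proof -
    have "Int_stable {S :: complex set. open S}" "{S :: complex set. open S} \<subseteq> Pow UNIV"
      "S \<in> sigma_sets UNIV {S :: complex set. open S}"
      using S by (auto simp: Int_stable_def borel_def)
    then show ?thesis
    proof (induction rule: sigma_sets_induct_disjoint)
      case (basic A)
      then show ?case using open_ind by auto
    next
      case empty
      then show ?case using open_ind[of "{}"] by simp
    next
      case (compl A)
      have "(\<lambda>x. 1 + (-1) * indicator A (cayley x)) \<in> F"
        by (intro limit_closed_add[OF F] limit_closed_scale[OF F] const1 compl)
      also have "(\<lambda>x. 1 + (-1) * indicator A (cayley x)) = (\<lambda>x. indicator (UNIV - A) (cayley x) :: complex)"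
        by (auto simp: indicator_def)
      finally show ?case .
    next
      case (union A)
      show ?case
      proof (rule limit_closed_lim[OF F, where C = 1])
        show "(\<lambda>x. \<Sum>i\<in>{..n}. indicator (A i) (cayley x)) \<in> F" for n
          by (intro limit_closed_sum[OF F] union) auto
        have disj: "disjoint_family_on A {..n}" for n
          using union(1) by (auto simp: disjoint_family_on_def)
        have eq: "(\<Sum>i\<in>{..n}. indicator (A i) z) = (indicator (\<Union>i\<le>n. A i) z :: complex)" for n z
          by (rule indicator_UN_disjoint[OF finite_atMost disj, symmetric])
        show "cmod (\<Sum>i\<in>{..n}. indicator (A i) (cayley x)) \<le> 1" for n x
          unfolding eq by (simp add: indicator_def)
        show "(\<lambda>n. \<Sum>i\<in>{..n}. indicator (A i) (cayley x)) \<longlonglongrightarrow> (indicator (\<Union>(range A)) (cayley x) :: complex)" for x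
          unfolding eq using LIMSEQ_Suc[OF LIMSEQ_indicator_UN[of A "cayley x"]]
          by (simp add: lessThan_Suc_atMost)
      qed
    qed
  qed
  have "indicator S \<in> F" if S: "S \<in> sets borel" for S
  proof -
    have "cayley_inverse -` S \<in> sets borel"
      using measurable_sets[OF measurable_cayley_inverse S] by simp
    from pull[OF this] show ?thesis
      by (simp add: indicator_def[abs_def])
  qed
  then show "bounded_borel \<subseteq> F"
    using generating_indicators F unfolding generating_def by blast
qed

section \<open>Functional calculus of a family of scalar spectral measures\<close>

definition represents ::
    "('a::chilbert_space \<Rightarrow> real measure) \<Rightarrow> (real \<Rightarrow> complex) \<Rightarrow> ('a \<Rightarrow> 'a) \<Rightarrow> bool" where
  "represents \<mu> u B \<longleftrightarrow> bounded_clinear B \<and> (\<forall>f. cinner f (B f) = (LINT x|\<mu> f. u x))"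

text \<open>Covers two situations at once: measures obtained from moments, where operators are known
  only for monomials, and the scalar measures of a projection-valued measure, where they are known
  for indicators. Multiplicativity is assumed on \<open>G\<close> alone and propagates; the mass
  axiom makes the constant 1 represent the identity.\<close>

locale spectral_family =
  fixes \<mu> :: "'a::chilbert_space \<Rightarrow> real measure" and G :: "(real \<Rightarrow> complex) set"
  assumes sets_family [measurable_cong, simp]: "sets (\<mu> f) = sets borel"
    and mass: "emeasure (\<mu> f) UNIV = ennreal ((norm f)\<^sup>2)"
    and generating: "generating G" and G_bounded: "G \<subseteq> bounded_borel"
    and represents_ex_G: "u \<in> G \<Longrightarrow> \<exists>B. represents \<mu> u B"
    and represents_mult_G: "u \<in> G \<Longrightarrow> v \<in> G \<Longrightarrow> represents \<mu> u B \<Longrightarrow> represents \<mu> v C \<Longrightarrow>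
      represents \<mu> (\<lambda>x. u x * v x) (\<lambda>f. B (C f))"
begin

lemma space_family [simp]: "space (\<mu> f) = UNIV"
  using sets_eq_imp_space_eq[OF sets_family] by simp

sublocale finite_measure "\<mu> f" for f
  by standard (simp add: mass)

lemma measure_family: "measure (\<mu> f) UNIV = (norm f)\<^sup>2"
  by (simp add: measure_def mass)

lemma measurable_family [simp]: "u \<in> borel_measurable (\<mu> f) \<longleftrightarrow> u \<in> borel_measurable borel"
  by (simp add: measurable_cong_sets[OF sets_family refl])

lemma integrable_bounded_borel:
  assumes "u \<in> bounded_borel"
  shows "integrable (\<mu> f) u"
proof -
  obtain C where "\<And>x. cmod (u x) \<le> C"
    using bounded_borelE[OF assms] by blast
  then show ?thesis
    using bounded_borel_measurable[OF assms] by (intro integrable_const_bound[of _ C]) auto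
qed

lemma integral_family_bound:
  assumes "u \<in> bounded_borel" "\<And>x. cmod (u x) \<le> C"
  shows "cmod (LINT x|\<mu> f. u x) \<le> C * (norm f)\<^sup>2"
proof -
  have "cmod (LINT x|\<mu> f. u x) \<le> (LINT x|\<mu> f. cmod (u x))"
    by (rule integral_norm_bound)
  also have "\<dots> \<le> (LINT x|\<mu> f. C)"
    using assms by (intro integral_mono integrable_norm integrable_bounded_borel) auto
  finally show ?thesis
    by (simp add: measure_family mult.commute)
qed

lemma tendsto_integral_family:
  fixes U :: "nat \<Rightarrow> real \<Rightarrow> 'b::{banach, second_countable_topology}"
  assumes "\<And>n. U n \<in> borel_measurable borel" "\<And>n x. norm (U n x) \<le> C" "\<And>x. (\<lambda>n. U n x) \<longlonglongrightarrow> u x"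
  shows "(\<lambda>n. LINT x|\<mu> f. U n x) \<longlonglongrightarrow> (LINT x|\<mu> f. u x)"
  using assms borel_measurable_LIMSEQ_metric[OF assms(1,3)]
  by (intro integral_dominated_convergence[where w = "\<lambda>_. C"]) auto

lemma represents_unique: "represents \<mu> u B \<Longrightarrow> represents \<mu> u C \<Longrightarrow> B = C"
  by (rule quadratic_form_eqD) (auto simp: represents_def)

lemma represents_add:
  assumes "u \<in> bounded_borel" "v \<in> bounded_borel" "represents \<mu> u B" "represents \<mu> v C"
  shows "represents \<mu> (\<lambda>x. u x + v x) (\<lambda>f. B f + C f)"
  using assms by (simp add: represents_def bounded_clinear_plus cinner_add_right integrable_bounded_borel)

lemma represents_scale:
  assumes "represents \<mu> u B"
  shows "represents \<mu> (\<lambda>x. c * u x) (\<lambda>f. c *\<^sub>C B f)"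
  using assms by (simp add: represents_def bounded_clinear_scaleC_op)

lemma represents_bound:
  assumes "represents \<mu> u B" "u \<in> bounded_borel" "\<And>x. cmod (u x) \<le> C"
  shows "cmod (cinner f (B g)) \<le> 4 * C * norm f * norm g"
  using assms integral_family_bound[OF assms(2,3)]
  by (intro quadratic_form_bound) (auto simp: represents_def)

text \<open>The weak limit is available before any operator for \<open>u\<close> is known:
  polarization reduces it to quadratic forms, where dominated convergence applies.\<close>

lemma represents_tendsto:
  assumes U: "\<And>n. U n \<in> bounded_borel" "\<And>n x. cmod (U n x) \<le> C" "\<And>x. (\<lambda>n. U n x) \<longlonglongrightarrow> u x"
    and B: "\<And>n. represents \<mu> (U n) (B n)"
  shows "(\<lambda>n. cinner f (B n g)) \<longlonglongrightarrow> quadratic_polarization (\<lambda>f. LINT x|\<mu> f. u x) f g"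
proof -
  have B': "bounded_clinear (B n)" "cinner f (B n f) = (LINT x|\<mu> f. U n x)" for n f
    using B by (auto simp: represents_def)
  have lim: "(\<lambda>n. LINT x|\<mu> f. U n x) \<longlonglongrightarrow> (LINT x|\<mu> f. u x)" for f
    by (rule tendsto_integral_family[OF bounded_borel_measurable[OF U(1)] U(2,3)])
  show ?thesis
    unfolding polarization[OF B'(1), where f = f and g = g] quadratic_polarization_def B'(2)
    by (intro tendsto_intros lim) simp
qed

text \<open>The functions with an operator form a limit-closed set: a bounded pointwise limit has a
  limiting sesquilinear form, whose bound is inherited from the uniform bound on the sequence, and
  such a form comes from an operator.\<close>

lemma represents_ex:
  assumes "u \<in> bounded_borel"
  shows "\<exists>B. represents \<mu> u B"
proof -
  let ?F = "{u \<in> bounded_borel. \<exists>B. represents \<mu> u B}"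
  have "limit_closed ?F"
  proof (rule limit_closedI)
    fix U :: "nat \<Rightarrow> real \<Rightarrow> complex" and u C
    assume U: "\<And>n. U n \<in> ?F" "\<And>n x. cmod (U n x) \<le> C" "\<And>x. (\<lambda>n. U n x) \<longlonglongrightarrow> u x"
    then obtain B where B: "\<And>n. represents \<mu> (U n) (B n)"
      by simp metis
    have Ub: "U n \<in> bounded_borel" for n
      using U(1)[of n] by simp
    have u: "u \<in> bounded_borel"
      by (rule limit_closed_lim[OF limit_closed_bounded_borel Ub U(2,3)])
    define b where "b = quadratic_polarization (\<lambda>f. LINT x|\<mu> f. u x)"
    have lim: "(\<lambda>n. cinner f (B n g)) \<longlonglongrightarrow> b f g" for f g
      unfolding b_def by (rule represents_tendsto[OF Ub U(2,3) B])
    have Bn: "bounded_clinear (B n)" for n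
      using B by (simp add: represents_def)
    have "\<exists>B. bounded_clinear B \<and> (\<forall>f g. cinner f (B g) = b f g)"
    proof (rule bounded_sesquilinear_representation)
      fix f g h :: 'a and c :: complex
      show "b f (g + h) = b f g + b f h"
        by (rule LIMSEQ_unique[OF lim]) (simp add: bounded_clinear_add[OF Bn] cinner_add_right tendsto_add lim)
      show "b (f + g) h = b f h + b g h"
        by (rule LIMSEQ_unique[OF lim]) (simp add: cinner_add_left tendsto_add lim)
      show "b f (c *\<^sub>C g) = c * b f g"
        by (rule LIMSEQ_unique[OF lim]) (simp add: bounded_clinear_scaleC[OF Bn] tendsto_mult_left lim)
      show "b (c *\<^sub>C f) g = cnj c * b f g"
        by (rule LIMSEQ_unique[OF lim]) (simp add: tendsto_mult_left lim)
      show "cmod (b f g) \<le> (4 * C) * norm f * norm g"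
        by (rule Lim_bounded[OF tendsto_norm[OF lim], where M = 0])
          (simp add: represents_bound[OF B Ub U(2)])
    qed
    then obtain B' where B': "bounded_clinear B'" "\<And>f g. cinner f (B' g) = b f g"
      by blast
    have "cinner f (B' f) = (LINT x|\<mu> f. u x)" for f
    proof (rule LIMSEQ_unique)
      show "(\<lambda>n. cinner f (B n f)) \<longlonglongrightarrow> cinner f (B' f)"
        unfolding B' by (rule lim)
      show "(\<lambda>n. cinner f (B n f)) \<longlonglongrightarrow> (LINT x|\<mu> f. u x)"
        using tendsto_integral_family[OF bounded_borel_measurable[OF Ub] U(2,3), of f] B
        by (simp add: represents_def)
    qed
    then show "u \<in> ?F"
      using u B'(1) by (auto simp: represents_def)
  next
    fix u v assume "u \<in> ?F" "v \<in> ?F"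
    then show "(\<lambda>x. u x + v x) \<in> ?F"
      using bounded_borel_add[of u v] represents_add[of u v] by blast
  next
    fix u c assume "u \<in> ?F"
    then show "(\<lambda>x. c * u x) \<in> ?F"
      using bounded_borel_scale[of u c] represents_scale[of u _ c] by blast
  qed
  then have "bounded_borel \<subseteq> ?F"
    using generating G_bounded represents_ex_G unfolding generating_def by blast
  then show ?thesis
    using assms by blast
qed

section \<open>The bounded calculus: algebra, norms, convergence\<close>

definition calculus :: "(real \<Rightarrow> complex) \<Rightarrow> 'a \<Rightarrow> 'a" where
  "calculus u = (THE B. represents \<mu> u B)"

lemma calculus_eqI: "represents \<mu> u B \<Longrightarrow> calculus u = B"
  unfolding calculus_def by (rule the_equality) (auto intro: represents_unique)

lemma represents_calculus: "u \<in> bounded_borel \<Longrightarrow> represents \<mu> u (calculus u)"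
  using represents_ex calculus_eqI by metis

lemma bounded_clinear_calculus: "u \<in> bounded_borel \<Longrightarrow> bounded_clinear (calculus u)"
  using represents_calculus by (auto simp: represents_def)

lemma cinner_calculus: "u \<in> bounded_borel \<Longrightarrow> cinner f (calculus u f) = (LINT x|\<mu> f. u x)"
  using represents_calculus by (auto simp: represents_def)

lemma calculus_add:
  "u \<in> bounded_borel \<Longrightarrow> v \<in> bounded_borel \<Longrightarrow>
    calculus (\<lambda>x. u x + v x) = (\<lambda>f. calculus u f + calculus v f)"
  by (intro calculus_eqI represents_add represents_calculus)

lemma calculus_scale:
  "u \<in> bounded_borel \<Longrightarrow> calculus (\<lambda>x. c * u x) = (\<lambda>f. c *\<^sub>C calculus u f)"
  by (intro calculus_eqI represents_scale represents_calculus)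

lemma calculus_diff:
  assumes "u \<in> bounded_borel" "v \<in> bounded_borel"
  shows "calculus (\<lambda>x. u x - v x) f = calculus u f - calculus v f"
  using calculus_add[OF assms(1) bounded_borel_scale[OF assms(2), of "-1"]]
    calculus_scale[OF assms(2), of "-1"] by (simp add: fun_eq_iff minus_eq_scaleC[symmetric])

lemma calculus_one: "calculus (\<lambda>_. 1) = (\<lambda>f. f)"
  by (rule calculus_eqI)
    (auto simp: represents_def cinner_self measure_family bounded_clinear_def bounded_linear_ident scaleR_conv_of_real)

lemma calculus_const: "calculus (\<lambda>_. c) = (\<lambda>f. c *\<^sub>C f)"
  using calculus_scale[OF bounded_borel_const[of 1], of c] by (simp add: calculus_one)

lemma calculus_weak_tendsto:
  assumes U: "\<And>n. U n \<in> bounded_borel" "\<And>n x. cmod (U n x) \<le> C" "\<And>x. (\<lambda>n. U n x) \<longlonglongrightarrow> u x"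
  shows "(\<lambda>n. cinner f (calculus (U n) g)) \<longlonglongrightarrow> cinner f (calculus u g)"
proof -
  have u: "u \<in> bounded_borel"
    by (rule limit_closed_lim[OF limit_closed_bounded_borel U])
  show ?thesis
    using represents_tendsto[OF U represents_calculus[OF U(1)], of f g]
    unfolding polarization[OF bounded_clinear_calculus[OF u], of f g] cinner_calculus[OF u] .
qed

text \<open>Both sides agree on the diagonal, where conjugating the inner product conjugates the
  integrand; polarization gives the rest.\<close>

lemma calculus_adjoint:
  assumes "u \<in> bounded_borel"
  shows "cinner (calculus u f) g = cinner f (calculus (\<lambda>x. cnj (u x)) g)"
proof -
  have q: "cinner (calculus u h) h = cinner h (calculus (\<lambda>x. cnj (u x)) h)" for h
    by (subst cinner_commute) (simp add: cinner_calculus assms bounded_borel_cnj)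
  have "cinner (calculus u f) g = quadratic_polarization (\<lambda>h. cinner (calculus u h) h) f g"
  proof -
    define a b c d where "a = cinner (calculus u f) f" "b = cinner (calculus u f) g"
      "c = cinner (calculus u g) f" "d = cinner (calculus u g) g"
    note abcd = this
    note lin = bounded_clinear_add[OF bounded_clinear_calculus[OF assms]]
      bounded_clinear_diff[OF bounded_clinear_calculus[OF assms]]
      bounded_clinear_scaleC[OF bounded_clinear_calculus[OF assms]]
    have "cinner (calculus u (f + g)) (f + g) = a + b + c + d"
      "cinner (calculus u (f - g)) (f - g) = a - b - c + d"
      "cinner (calculus u (f + \<i> *\<^sub>C g)) (f + \<i> *\<^sub>C g) = a + \<i> * b - \<i> * c + d"
      "cinner (calculus u (f - \<i> *\<^sub>C g)) (f - \<i> *\<^sub>C g) = a - \<i> * b + \<i> * c + d"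
      by (simp_all add: abcd lin cinner_simps distrib_left right_diff_distrib mult.assoc[symmetric])
    then show ?thesis
      unfolding quadratic_polarization_def abcd(2)[symmetric]
      by (simp add: right_diff_distrib distrib_left mult.assoc[symmetric])
  qed
  also have "\<dots> = cinner f (calculus (\<lambda>x. cnj (u x)) g)"
    unfolding q using polarization[OF bounded_clinear_calculus[OF bounded_borel_cnj[OF assms]], of f g] by simp
  finally show ?thesis .
qed

text \<open>The limit argument runs in one factor at a time: first \<open>u\<close> varies with
  \<open>v\<close> in \<open>G\<close>, then \<open>v\<close> varies with \<open>u\<close> an
  arbitrary bounded Borel function.\<close>

lemma calculus_mult:
  assumes "u \<in> bounded_borel" "v \<in> bounded_borel"
  shows "calculus (\<lambda>x. u x * v x) f = calculus u (calculus v f)"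
proof -
  define F where "F v = {u \<in> bounded_borel. \<forall>f g. cinner f (calculus (\<lambda>x. u x * v x) g) = cinner f (calculus u (calculus v g))}" for v
  define F' where "F' u = {v \<in> bounded_borel. \<forall>f g. cinner f (calculus (\<lambda>x. u x * v x) g) = cinner f (calculus u (calculus v g))}" for u
  have closed: "limit_closed (F v)" if v: "v \<in> bounded_borel" for v
  proof (rule limit_closedI)
    fix u w assume uw: "u \<in> F v" "w \<in> F v"
    then have b: "u \<in> bounded_borel" "w \<in> bounded_borel"
      by (simp_all add: F_def)
    show "(\<lambda>x. u x + w x) \<in> F v"
      using uw bounded_borel_add[OF b]
      by (simp add: F_def distrib_right calculus_add[OF b] cinner_add_right
          calculus_add[OF bounded_borel_mult[OF b(1) v] bounded_borel_mult[OF b(2) v]])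
  next
    fix u c assume u: "u \<in> F v"
    then have b: "u \<in> bounded_borel"
      by (simp add: F_def)
    show "(\<lambda>x. c * u x) \<in> F v"
      using u bounded_borel_scale[OF b, of c]
      by (simp add: F_def mult.assoc calculus_scale[OF b] calculus_scale[OF bounded_borel_mult[OF b v]])
  next
    fix U :: "nat \<Rightarrow> real \<Rightarrow> complex" and u C
    assume U: "\<And>n. U n \<in> F v" "\<And>n x. cmod (U n x) \<le> C" "\<And>x. (\<lambda>n. U n x) \<longlonglongrightarrow> u x"
    have Ub: "U n \<in> bounded_borel" for n
      using U(1)[of n] by (simp add: F_def)
    obtain D where D: "\<And>x. cmod (v x) \<le> D" "D > 0"
      using bounded_borelE[OF v] by blast
    have "cinner f (calculus (\<lambda>x. u x * v x) g) = cinner f (calculus u (calculus v g))" for f g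
    proof (rule LIMSEQ_unique)
      show "(\<lambda>n. cinner f (calculus (U n) (calculus v g))) \<longlonglongrightarrow> cinner f (calculus u (calculus v g))"
        by (rule calculus_weak_tendsto[OF Ub U(2,3)])
      have "(\<lambda>n. cinner f (calculus (\<lambda>x. U n x * v x) g)) \<longlonglongrightarrow> cinner f (calculus (\<lambda>x. u x * v x) g)"
      proof (rule calculus_weak_tendsto)
        show "cmod (U n x * v x) \<le> C * D" for n x
          using U(2)[of n x] D order_trans[OF norm_ge_zero U(2)[of n x]]
          unfolding norm_mult by (intro mult_mono) auto
      qed (rule bounded_borel_mult[OF Ub v] tendsto_mult_right[OF U(3)])+
      then show "(\<lambda>n. cinner f (calculus (U n) (calculus v g))) \<longlonglongrightarrow> cinner f (calculus (\<lambda>x. u x * v x) g)"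
        using U(1) by (simp add: F_def)
    qed
    then show "u \<in> F v"
      using limit_closed_lim[OF limit_closed_bounded_borel Ub U(2,3)] by (simp add: F_def)
  qed
  have closed': "limit_closed (F' u)" if u: "u \<in> bounded_borel" for u
  proof (rule limit_closedI)
    note lin = bounded_clinear_add[OF bounded_clinear_calculus[OF u]]
      bounded_clinear_scaleC[OF bounded_clinear_calculus[OF u]]
    {
      fix v w assume vw: "v \<in> F' u" "w \<in> F' u"
      then have b: "v \<in> bounded_borel" "w \<in> bounded_borel"
        by (simp_all add: F'_def)
      show "(\<lambda>x. v x + w x) \<in> F' u"
        using vw bounded_borel_add[OF b]
        by (simp add: F'_def lin distrib_left calculus_add[OF b] cinner_add_right
            calculus_add[OF bounded_borel_mult[OF u b(1)] bounded_borel_mult[OF u b(2)]])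
    next
      fix v c assume v: "v \<in> F' u"
      then have b: "v \<in> bounded_borel"
        by (simp add: F'_def)
      have "(\<lambda>x. u x * (c * v x)) = (\<lambda>x. c * (u x * v x))"
        by (simp add: mult.left_commute)
      then show "(\<lambda>x. c * v x) \<in> F' u"
        using v bounded_borel_scale[OF b, of c]
        by (simp add: F'_def lin calculus_scale[OF b] calculus_scale[OF bounded_borel_mult[OF u b]])
    }
    fix U :: "nat \<Rightarrow> real \<Rightarrow> complex" and v C
    assume U: "\<And>n. U n \<in> F' u" "\<And>n x. cmod (U n x) \<le> C" "\<And>x. (\<lambda>n. U n x) \<longlonglongrightarrow> v x"
    have Ub: "U n \<in> bounded_borel" for n
      using U(1)[of n] by (simp add: F'_def)
    obtain D where D: "\<And>x. cmod (u x) \<le> D" "D > 0"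
      using bounded_borelE[OF u] by blast
    \<comment> \<open>Moving the left factor to the other side of the inner product leaves a weak
      limit of the inner operators alone.\<close>
    note adj = calculus_adjoint[OF bounded_borel_cnj[OF u], simplified, symmetric]
    have "cinner f (calculus (\<lambda>x. u x * v x) g) = cinner f (calculus u (calculus v g))" for f g
    proof (rule LIMSEQ_unique)
      show "(\<lambda>n. cinner f (calculus u (calculus (U n) g))) \<longlonglongrightarrow> cinner f (calculus u (calculus v g))"
        unfolding adj by (rule calculus_weak_tendsto[OF Ub U(2,3)])
      have "(\<lambda>n. cinner f (calculus (\<lambda>x. u x * U n x) g)) \<longlonglongrightarrow> cinner f (calculus (\<lambda>x. u x * v x) g)"
      proof (rule calculus_weak_tendsto)
        show "cmod (u x * U n x) \<le> D * C" for n x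
          using U(2)[of n x] D order_trans[OF norm_ge_zero U(2)[of n x]]
          unfolding norm_mult by (intro mult_mono) auto
      qed (rule bounded_borel_mult[OF u Ub] tendsto_mult_left[OF U(3)])+
      then show "(\<lambda>n. cinner f (calculus u (calculus (U n) g))) \<longlonglongrightarrow> cinner f (calculus (\<lambda>x. u x * v x) g)"
        using U(1) by (simp add: F'_def)
    qed
    then show "v \<in> F' u"
      using limit_closed_lim[OF limit_closed_bounded_borel Ub U(2,3)] by (simp add: F'_def)
  qed
  have G: "u \<in> bounded_borel" if "u \<in> G" for u
    using G_bounded that by blast
  have base: "calculus (\<lambda>x. u x * v x) = (\<lambda>f. calculus u (calculus v f))" if "u \<in> G" "v \<in> G" for u v
    using that by (intro calculus_eqI represents_mult_G represents_calculus G)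
  have step: "u \<in> F v" if "u \<in> bounded_borel" "v \<in> G" for u v
  proof -
    have "G \<subseteq> F v"
      using base[OF _ that(2)] G by (simp add: F_def subset_iff)
    then show ?thesis
      using closed[OF G[OF that(2)]] generating that(1) unfolding generating_def by blast
  qed
  have "G \<subseteq> F' u"
    using step[OF assms(1)] G by (simp add: F_def F'_def subset_iff)
  then have "v \<in> F' u"
    using closed'[OF assms(1)] generating assms(2) unfolding generating_def by blast
  then show ?thesis
    by (auto simp: F'_def intro: cinner_ext[of "calculus (\<lambda>x. u x * v x) f"])
qed

lemma calculus_commute:
  assumes "u \<in> bounded_borel" "v \<in> bounded_borel"
  shows "calculus u (calculus v f) = calculus v (calculus u f)"
proof -
  have "(\<lambda>x. u x * v x) = (\<lambda>x. v x * u x)"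
    by (simp add: mult.commute)
  then show ?thesis
    using calculus_mult[OF assms, of f] calculus_mult[OF assms(2,1), of f] by (simp only:)
qed

lemma cinner_calculus_self:
  assumes u: "u \<in> bounded_borel"
  shows "cinner (calculus u f) (calculus u f) = (LINT x|\<mu> f. cnj (u x) * u x)"
  unfolding calculus_adjoint[OF u] calculus_mult[OF bounded_borel_cnj[OF u] u, symmetric]
  by (rule cinner_calculus[OF bounded_borel_mult[OF bounded_borel_cnj[OF u] u]])

lemma norm_calculus:
  assumes u: "u \<in> bounded_borel"
  shows "(norm (calculus u f))\<^sup>2 = (LINT x|\<mu> f. (cmod (u x))\<^sup>2)"
proof -
  have sq: "cnj z * z = complex_of_real ((cmod z)\<^sup>2)" for z
    by (subst mult.commute) (rule complex_norm_square[symmetric])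
  have "complex_of_real ((norm (calculus u f))\<^sup>2) = (LINT x|\<mu> f. complex_of_real ((cmod (u x))\<^sup>2))"
    using cinner_calculus_self[OF u, of f] unfolding cinner_self sq .
  also have "\<dots> = complex_of_real (LINT x|\<mu> f. (cmod (u x))\<^sup>2)"
    by (rule integral_complex_of_real)
  finally show ?thesis
    by (rule of_real_eq_iff[THEN iffD1])
qed

text \<open>Multiplicativity turns the squared norm into the integral of |u|^2, which removes the
  factor 4 of \<open>represents_bound\<close>.\<close>

lemma norm_calculus_le:
  assumes u: "u \<in> bounded_borel" and C: "\<And>x. cmod (u x) \<le> C"
  shows "norm (calculus u f) \<le> C * norm f"
proof -
  have C0: "C \<ge> 0"
    by (rule order_trans[OF norm_ge_zero C[of 0]])
  have "(norm (calculus u f))\<^sup>2 = cmod (LINT x|\<mu> f. cnj (u x) * u x)"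
    unfolding cinner_calculus_self[OF u, symmetric] cinner_self norm_of_real by simp
  also have "\<dots> \<le> C\<^sup>2 * (norm f)\<^sup>2"
  proof (rule integral_family_bound)
    show "cmod (cnj (u x) * u x) \<le> C\<^sup>2" for x
      unfolding norm_mult complex_mod_cnj power2_eq_square by (intro mult_mono C C0 norm_ge_zero)
  qed (intro bounded_borel_mult bounded_borel_cnj u)
  finally have "(norm (calculus u f))\<^sup>2 \<le> (C * norm f)\<^sup>2"
    by (simp only: power_mult_distrib)
  then show ?thesis
    by (rule power2_le_imp_le) (simp add: C0)
qed

text \<open>Convergence in norm and not merely weakly, because \<open>norm_calculus\<close> makes
  the distance an L^2 norm of U n - u.\<close>

lemma calculus_tendsto:
  assumes U: "\<And>n. U n \<in> bounded_borel" "\<And>n x. cmod (U n x) \<le> C" "\<And>x. (\<lambda>n. U n x) \<longlonglongrightarrow> u x"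
  shows "(\<lambda>n. calculus (U n) f) \<longlonglongrightarrow> calculus u f"
proof -
  have u: "u \<in> bounded_borel"
    by (rule limit_closed_lim[OF limit_closed_bounded_borel U])
  have C: "cmod (u x) \<le> C" for x
    by (rule Lim_bounded[OF tendsto_norm[OF U(3)], where M = 0]) (simp add: U(2))
  have diff: "(\<lambda>x. U n x - u x) \<in> bounded_borel" for n
    using bounded_borel_add[OF U(1)[of n] bounded_borel_scale[OF u, of "-1"]] by simp
  have "(\<lambda>n. LINT x|\<mu> f. (cmod (U n x - u x))\<^sup>2) \<longlonglongrightarrow> (LINT x|\<mu> f. (cmod (0 :: complex))\<^sup>2)"
  proof (rule tendsto_integral_family)
    show "norm ((cmod (U n x - u x))\<^sup>2) \<le> (C + C)\<^sup>2" for n x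
      unfolding real_norm_def abs_power2
      using norm_triangle_ineq4[of "U n x" "u x"] U(2)[of n x] C[of x]
      by (intro power_mono norm_ge_zero) linarith
    show "(\<lambda>n. (cmod (U n x - u x))\<^sup>2) \<longlonglongrightarrow> (cmod (0 :: complex))\<^sup>2" for x
      by (rule tendsto_power[OF tendsto_norm[OF LIM_zero[OF U(3)]]])
  qed (use bounded_borel_measurable[OF diff] in simp)
  then have "(\<lambda>n. (norm (calculus (U n) f - calculus u f))\<^sup>2) \<longlonglongrightarrow> 0"
    unfolding norm_calculus[OF diff, symmetric] calculus_diff[OF U(1) u] by simp
  from tendsto_real_sqrt[OF this] have "(\<lambda>n. calculus (U n) f - calculus u f) \<longlonglongrightarrow> 0"
    by (simp add: tendsto_norm_zero_iff)
  then show ?thesis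
    by (rule LIM_zero_cancel)
qed

lemma measure_indicator:
  assumes "S \<in> sets borel"
  shows "measure (\<mu> f) S = Re (cinner f (calculus (indicator S) f))"
proof -
  have "(LINT x|\<mu> f. complex_of_real (indicator S x)) = complex_of_real (measure (\<mu> f) S)"
    using assms by (subst integral_complex_of_real) simp
  then show ?thesis
    using assms by (simp add: cinner_calculus bounded_borel_indicator of_real_indicator)
qed

text \<open>This converts questions about vectors u(T) f, such as membership in a domain or
  finiteness of a weighted norm, into integrability with respect to the measure of
  \<open>f\<close>.\<close>

lemma family_calculus:
  assumes u: "u \<in> bounded_borel"
  shows "\<mu> (calculus u f) = density (\<mu> f) (\<lambda>x. ennreal ((cmod (u x))\<^sup>2))"
proof (rule measure_eqI)
  have um [measurable]: "u \<in> borel_measurable borel"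
    using u by (rule bounded_borel_measurable)
  fix S assume "S \<in> sets (\<mu> (calculus u f))"
  then have S [measurable]: "S \<in> sets borel" by simp
  let ?w = "\<lambda>x. cnj (u x) * (indicator S x * u x)"
  have w: "?w \<in> bounded_borel"
    using u S by (intro bounded_borel_mult bounded_borel_cnj bounded_borel_indicator)
  have eq: "?w x = complex_of_real ((cmod (u x))\<^sup>2 * indicator S x)" for x
    unfolding of_real_mult complex_norm_square by (simp add: of_real_indicator mult_ac)
  have "cinner (calculus u f) (calculus (indicator S) (calculus u f)) = cinner f (calculus ?w f)"
    using u S by (simp add: calculus_adjoint calculus_mult bounded_borel_mult bounded_borel_cnj bounded_borel_indicator)
  also have "\<dots> = complex_of_real (LINT x|\<mu> f. (cmod (u x))\<^sup>2 * indicator S x)"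
    unfolding cinner_calculus[OF w] unfolding eq by (rule integral_complex_of_real)
  finally have "measure (\<mu> (calculus u f)) S = (LINT x|\<mu> f. (cmod (u x))\<^sup>2 * indicator S x)"
    using S by (simp add: measure_indicator)
  moreover have "integrable (\<mu> f) (\<lambda>x. (cmod (u x))\<^sup>2 * indicator S x)"
    using integrable_Re[OF integrable_bounded_borel[OF w, of f]] unfolding eq by simp
  ultimately have "emeasure (\<mu> (calculus u f)) S = (\<integral>\<^sup>+x. ennreal ((cmod (u x))\<^sup>2 * indicator S x) \<partial>\<mu> f)"
    by (simp add: emeasure_eq_measure nn_integral_eq_integral)
  also have "\<dots> = (\<integral>\<^sup>+x. ennreal ((cmod (u x))\<^sup>2) * indicator S x \<partial>\<mu> f)"
    by (intro nn_integral_cong) (simp add: indicator_def)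
  finally show "emeasure (\<mu> (calculus u f)) S = emeasure (density (\<mu> f) (\<lambda>x. ennreal ((cmod (u x))\<^sup>2))) S"
    by (simp add: emeasure_density)
qed simp

text \<open>The vector \<open>k\<close> is the limit of the cut-off vectors \<open>v\<^sub>n(T) g\<close> with \<open>v\<^sub>n = 1/u\<close> on
  \<open>{\<bar>u\<bar> \<ge> 1/(n+1)}\<close> and \<open>0\<close> elsewhere.\<close>

lemma calculus_surjective:
  assumes u: "u \<in> bounded_borel" "\<And>x. u x \<noteq> 0"
    and int: "integrable (\<mu> g) (\<lambda>x. 1 / (cmod (u x))\<^sup>2)"
  shows "\<exists>k. calculus u k = g \<and> (norm k)\<^sup>2 = (LINT x|\<mu> g. 1 / (cmod (u x))\<^sup>2)"
proof -
  have um [measurable]: "u \<in> borel_measurable borel"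
    using u(1) by (rule bounded_borel_measurable)
  define S where "S n = {x. 1 / real (Suc n) \<le> cmod (u x)}" for n
  have S [measurable]: "S n \<in> sets borel" for n
    unfolding S_def by measurable
  have S_mono: "S m \<subseteq> S n" if "m \<le> n" for m n
  proof -
    have "1 / real (Suc n) \<le> 1 / real (Suc m)"
      using that by (simp add: field_simps)
    then show ?thesis by (auto simp: S_def)
  qed
  have S_ev: "\<exists>N. \<forall>n\<ge>N. x \<in> S n" for x
  proof -
    obtain N where "inverse (real (Suc N)) < cmod (u x)"
      using reals_Archimedean[of "cmod (u x)"] u(2) by auto
    then have "x \<in> S N"
      by (simp add: S_def inverse_eq_divide)
    then show ?thesis
      using S_mono by blast
  qed
  define v where "v n x = indicator (S n) x / u x" for n x
  have v: "v n \<in> bounded_borel" for n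
  proof (rule bounded_borelI)
    show "v n \<in> borel_measurable borel"
      unfolding v_def[abs_def] by measurable
    show "cmod (v n x) \<le> real (Suc n)" for x
      using u(2)[of x] by (auto simp: v_def S_def indicator_def norm_divide divide_simps mult.commute)
  qed
  define k where "k n = calculus (v n) g" for n
  define a where "a n = (LINT x|\<mu> g. indicator (S n) x / (cmod (u x))\<^sup>2)" for n
  have a_int: "integrable (\<mu> g) (\<lambda>x. indicator (S n) x / (cmod (u x))\<^sup>2)" for n
    by (rule Bochner_Integration.integrable_bound[OF int]) (auto simp: indicator_def)
  have a_lim: "a \<longlonglongrightarrow> (LINT x|\<mu> g. 1 / (cmod (u x))\<^sup>2)"
    unfolding a_def
  proof (rule integral_dominated_convergence[OF _ _ int])
    show "AE x in \<mu> g. (\<lambda>n. indicator (S n) x / (cmod (u x))\<^sup>2) \<longlonglongrightarrow> 1 / (cmod (u x))\<^sup>2"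
    proof (rule AE_I2)
      fix x
      obtain N where "\<And>n. n \<ge> N \<Longrightarrow> x \<in> S n"
        using S_ev by blast
      then show "(\<lambda>n. indicator (S n) x / (cmod (u x))\<^sup>2) \<longlonglongrightarrow> 1 / (cmod (u x))\<^sup>2"
        by (intro tendsto_eventually) (auto simp: eventually_sequentially intro!: exI[of _ N])
    qed
  qed (auto simp: indicator_def)
  \<comment> \<open>The sets \<open>S n\<close> increase, so for m \<le> n the function v n - v m is
    1/u on the difference of the two sets and 0 elsewhere; the squared distance is the increment of
    the convergent sequence \<open>a\<close>.\<close>
  have diff: "(norm (k n - k m))\<^sup>2 = \<bar>a n - a m\<bar>" for n m
  proof -
    have *: "(norm (k n - k m))\<^sup>2 = \<bar>a n - a m\<bar>" if "m \<le> n" for n m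
    proof -
      have d: "(\<lambda>x. v n x - v m x) \<in> bounded_borel"
        using bounded_borel_add[OF v[of n] bounded_borel_scale[OF v[of m], of "-1"]] by simp
      have "(norm (k n - k m))\<^sup>2 = (LINT x|\<mu> g. (cmod (v n x - v m x))\<^sup>2)"
        using norm_calculus[OF d, of g] by (simp add: k_def calculus_diff v)
      also have "\<dots> = (LINT x|\<mu> g. indicator (S n) x / (cmod (u x))\<^sup>2 - indicator (S m) x / (cmod (u x))\<^sup>2)"
        using S_mono[OF that]
        by (intro Bochner_Integration.integral_cong) (auto simp: v_def indicator_def norm_divide power_divide)
      also have "\<dots> = a n - a m"
        by (simp add: a_def a_int)
      finally show ?thesis
        using zero_le_power2[of "norm (k n - k m)"] by linarith
    qed
    show ?thesis
      using *[of n m] *[of m n] by (cases "m \<le> n") (auto simp: norm_minus_commute abs_minus_commute)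
  qed
  have "Cauchy k"
  proof (rule CauchyI)
    fix e :: real assume "e > 0"
    then have "e\<^sup>2 > 0" by simp
    from CauchyD[OF LIMSEQ_imp_Cauchy[OF a_lim] this]
    obtain M where M: "\<And>m n. m \<ge> M \<Longrightarrow> n \<ge> M \<Longrightarrow> norm (a m - a n) < e\<^sup>2" by blast
    have "norm (k m - k n) < e" if "m \<ge> M" "n \<ge> M" for m n
      using M[OF that] \<open>e > 0\<close> diff[of m n] by (intro power_less_imp_less_base[of _ 2 e]) auto
    then show "\<exists>M. \<forall>m\<ge>M. \<forall>n\<ge>M. norm (k m - k n) < e" by blast
  qed
  then obtain k' where k': "k \<longlonglongrightarrow> k'"
    using Cauchy_convergent_iff convergent_def by metis
  have "calculus u k' = g"
  proof (rule LIMSEQ_unique)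
    show "(\<lambda>n. calculus u (k n)) \<longlonglongrightarrow> calculus u k'"
      using bounded_linear.tendsto[OF bounded_clinear_bounded_linear[OF bounded_clinear_calculus[OF u(1)]] k'] .
    have "calculus u (k n) = calculus (indicator (S n)) g" for n
    proof -
      have "calculus u (k n) = calculus (\<lambda>x. u x * v n x) g"
        by (simp add: k_def calculus_mult u v)
      also have "(\<lambda>x. u x * v n x) = indicator (S n)"
        using u(2) by (simp add: v_def)
      finally show ?thesis .
    qed
    moreover have "(\<lambda>n. calculus (indicator (S n)) g) \<longlonglongrightarrow> calculus (\<lambda>_. 1) g"
    proof (rule calculus_tendsto)
      show "(\<lambda>n. indicator (S n) x :: complex) \<longlonglongrightarrow> 1" for x
      proof -
        obtain N where "\<And>n. n \<ge> N \<Longrightarrow> x \<in> S n"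
          using S_ev by blast
        then show ?thesis
          by (intro tendsto_eventually) (auto simp: eventually_sequentially intro!: exI[of _ N])
      qed
    qed (auto simp: indicator_def intro: bounded_borel_indicator)
    ultimately show "(\<lambda>n. calculus u (k n)) \<longlonglongrightarrow> g"
      by (simp add: calculus_one)
  qed
  moreover have "(norm k')\<^sup>2 = (LINT x|\<mu> g. 1 / (cmod (u x))\<^sup>2)"
  proof (rule LIMSEQ_unique[OF _ a_lim])
    have "(norm (k n))\<^sup>2 = a n" for n
      unfolding k_def norm_calculus[OF v] a_def
      by (intro Bochner_Integration.integral_cong) (auto simp: v_def indicator_def norm_divide power_divide)
    moreover have "(\<lambda>n. (norm (k n))\<^sup>2) \<longlonglongrightarrow> (norm k')\<^sup>2"
      by (intro tendsto_intros k')
    ultimately show "a \<longlonglongrightarrow> (norm k')\<^sup>2" by simp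
  qed
  ultimately show ?thesis by blast
qed

end

section \<open>The trigonometric moment problem for an isometry\<close>

lemma continuous_on_iexp: "continuous_on A (\<lambda>\<theta>. iexp (c * \<theta>))"
  by (intro continuous_intros)

lemma integral_iexp_period:
  "(LINT \<theta>|lborel. indicator {0..2 * pi} \<theta> *\<^sub>R iexp (of_int m * \<theta>)) = (if m = 0 then 2 * pi else 0)"
proof (cases "m = 0")
  case True
  then show ?thesis
    using integral_FTC_atLeastAtMost[of 0 "2 * pi" "\<lambda>x. complex_of_real x" "\<lambda>_. 1"]
    by (simp add: has_vector_derivative_def scaleR_conv_of_real
        bounded_linear_imp_has_derivative[OF bounded_linear_of_real])
next
  case False
  let ?F = "\<lambda>z. exp (\<i> * of_int m * z) / (\<i> * of_int m)"
  have "(LINT \<theta>|lborel. indicator {0..2 * pi} \<theta> *\<^sub>R iexp (of_int m * \<theta>))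
    = ?F (of_real (2 * pi)) - ?F (of_real 0)"
  proof (rule integral_FTC_atLeastAtMost)
    fix x :: real
    have "(?F has_field_derivative exp (\<i> * of_int m * of_real x)) (at (of_real x))"
      using False by (auto intro!: derivative_eq_intros)
    then have "((\<lambda>x. ?F (of_real x)) has_vector_derivative exp (\<i> * of_int m * of_real x))
        (at x within {0..2 * pi})"
      by (rule has_vector_derivative_real_field)
    then show "((\<lambda>x. ?F (of_real x)) has_vector_derivative iexp (of_int m * x)) (at x within {0..2 * pi})"
      by (simp add: mult.assoc)
  qed (auto simp: comp_def intro!: continuous_intros)
  also have "exp (\<i> * of_int m * complex_of_real (2 * pi)) = 1"
    using exp_integer_2pi[of "of_int m"] by (simp add: mult_ac)
  finally show ?thesis
    using False by simp
qed

text \<open>The measures with Fejer densities \<open>\<parallel>\<Sum>k<N. exp (-i k \<theta>) v k\<parallel>\<^sup>2 / (2 \<pi> N)\<close> on \<open>[0, 2\<pi>]\<close> have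
  the moments \<open>(1 - n/N) c n\<close>; a weak limit solves the moment problem.\<close>

lemma stationary_sequence_moments:
  fixes v :: "nat \<Rightarrow> 'a::chilbert_space"
  assumes stat: "\<And>j n. cinner (v j) (v (n + j)) = c n" and c0: "c 0 = 1"
  shows "\<exists>M. real_distribution M \<and> (\<forall>n. (LINT \<theta>|M. iexp (real n * \<theta>)) = c n)"
proof -
  define S where "S N \<theta> = (\<Sum>k<N. iexp (- real k * \<theta>) *\<^sub>C v k)" for N \<theta>
  define D where "D N \<theta> = (norm (S N \<theta>))\<^sup>2 / (2 * pi * real N)" for N \<theta>
  have contS: "continuous_on A (S N)" for A N
    unfolding S_def[abs_def] by (intro continuous_intros scaleC.continuous_on continuous_on_iexp)
  then have contD: "continuous_on A (D N)" for A N
    unfolding D_def[abs_def] divide_inverse by (intro continuous_intros)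
  have D_nonneg: "0 \<le> D N \<theta>" for N \<theta>
    by (simp add: D_def)
  have D_meas [measurable]: "D N \<in> borel_measurable borel" for N
    by (rule borel_measurable_continuous_onI[OF contD])
  have expand: "complex_of_real ((norm (S N \<theta>))\<^sup>2)
      = (\<Sum>j<N. \<Sum>k<N. cinner (v j) (v k) * iexp (of_int (int j - int k) * \<theta>))" for N \<theta>
  proof -
    have "iexp (of_int (int j - int k) * \<theta>) = cnj (iexp (- real j * \<theta>)) * iexp (- real k * \<theta>)" for j k
      by (simp add: exp_cnj exp_add[symmetric] algebra_simps)
    then show ?thesis
      unfolding cinner_self[symmetric] S_def unfolding cinner.sum_left unfolding cinner.sum_right
      by (simp add: mult_ac)
  qed
  define w where "w n N \<theta> = D N \<theta> *\<^sub>R iexp (real n * \<theta>)" for n N \<theta>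
  have w_int: "integrable lborel (\<lambda>\<theta>. indicator {0..2 * pi} \<theta> *\<^sub>R w n N \<theta>)" for n N
    unfolding w_def by (intro borel_integrable_compact continuous_intros contD continuous_on_iexp) auto
  \<comment> \<open>Integration over a period keeps only the pairs with k = n + j, and N - n of them
    have both indices below N. The subtraction is truncated, so the moment is 0 for n \<ge>
    N.\<close>
  have moment: "(LINT \<theta>|lborel. indicator {0..2 * pi} \<theta> *\<^sub>R w n N \<theta>) = real (N - n) / real N * c n"
    if N: "N > 0" for n N
  proof -
    define J where "J m \<theta> = indicator {0..2 * pi} \<theta> *\<^sub>R iexp (of_int m * \<theta>)" for m \<theta>
    have J_int: "integrable lborel (J m)" for m
      unfolding J_def by (intro borel_integrable_compact continuous_on_iexp) auto
    have w: "w n N \<theta> = (\<Sum>j<N. \<Sum>k<N. (cinner (v j) (v k) / (2 * pi * real N)) *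
        iexp (of_int (int n + int j - int k) * \<theta>))" for \<theta>
    proof -
      have "w n N \<theta> = complex_of_real ((norm (S N \<theta>))\<^sup>2) * iexp (real n * \<theta>) / (2 * pi * real N)"
        by (simp add: w_def D_def scaleR_conv_of_real)
      also have "\<dots> = (\<Sum>j<N. \<Sum>k<N. (cinner (v j) (v k) / (2 * pi * real N)) *
          (iexp (of_int (int j - int k) * \<theta>) * iexp (real n * \<theta>)))"
        unfolding expand sum_distrib_right sum_divide_distrib by (simp add: mult_ac)
      also have "\<dots> = (\<Sum>j<N. \<Sum>k<N. (cinner (v j) (v k) / (2 * pi * real N)) *
        iexp (of_int (int n + int j - int k) * \<theta>))"
        by (intro sum.cong refl arg_cong2[where f = "(*)"]) (simp add: exp_add[symmetric] algebra_simps)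
      finally show ?thesis .
    qed
    have "(LINT \<theta>|lborel. indicator {0..2 * pi} \<theta> *\<^sub>R w n N \<theta>)
      = (LINT \<theta>|lborel. (\<Sum>j<N. \<Sum>k<N. (cinner (v j) (v k) / (2 * pi * real N)) * J (int n + int j - int k) \<theta>))"
      unfolding w J_def by (intro Bochner_Integration.integral_cong refl) (simp add: scaleR_sum_right)
    also have "\<dots> = (\<Sum>j<N. \<Sum>k<N. (cinner (v j) (v k) / (2 * pi * real N)) *
        (LINT \<theta>|lborel. J (int n + int j - int k) \<theta>))"
      by (simp add: Bochner_Integration.integral_sum J_int)
    also have "\<dots> = (\<Sum>j<N. \<Sum>k<N. if k = n + j then c n / real N else 0)"
      unfolding J_def integral_iexp_period using N by (intro sum.cong refl) (auto simp: stat)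
    also have "\<dots> = (\<Sum>j<N. if n + j < N then c n / real N else 0)"
      by (intro sum.cong refl) (simp add: sum.delta)
    also have "\<dots> = (\<Sum>j\<in>{j\<in>{..<N}. n + j < N}. c n / real N)"
      by (rule sum.inter_filter[symmetric]) simp
    also have "{j\<in>{..<N}. n + j < N} = {..<N - n}"
      by auto
    finally show ?thesis
      by simp
  qed
  \<comment> \<open>The index is shifted because D 0 vanishes identically and would not give a
    probability measure.\<close>
  define M where "M N = density lborel (\<lambda>\<theta>. ennreal (indicator {0..2 * pi} \<theta> * D (Suc N) \<theta>))" for N
  have M_integral: "(LINT \<theta>|M N. iexp (real n * \<theta>)) = real (Suc N - n) / real (Suc N) * c n" for n N
  proof -
    have "(LINT \<theta>|M N. iexp (real n * \<theta>)) = (LINT \<theta>|lborel. (indicator {0..2 * pi} \<theta> * D (Suc N) \<theta>) *\<^sub>R iexp (real n * \<theta>))"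
      unfolding M_def using D_nonneg by (intro integral_density) auto
    then show ?thesis
      using moment[of "Suc N" n] by (simp add: w_def del: of_nat_Suc)
  qed
  have mass: "(\<integral>\<^sup>+\<theta>. ennreal (indicator {0..2 * pi} \<theta> * D (Suc N) \<theta>) \<partial>lborel) = 1" for N
  proof -
    have r: "indicator {0..2 * pi} \<theta> *\<^sub>R w 0 (Suc N) \<theta> = complex_of_real (indicator {0..2 * pi} \<theta> * D (Suc N) \<theta>)" for \<theta>
      by (simp add: w_def scaleR_conv_of_real)
    have int: "integrable lborel (\<lambda>\<theta>. indicator {0..2 * pi} \<theta> * D (Suc N) \<theta>)"
      using integrable_Re[OF w_int[of 0 "Suc N"]] unfolding r by simp
    have "complex_of_real (LINT \<theta>|lborel. indicator {0..2 * pi} \<theta> * D (Suc N) \<theta>) = 1"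
      using moment[of "Suc N" 0] unfolding r integral_complex_of_real by (simp add: c0)
    then have "(LINT \<theta>|lborel. indicator {0..2 * pi} \<theta> * D (Suc N) \<theta>) = 1"
      using of_real_eq_1_iff by blast
    then show ?thesis
      using nn_integral_eq_integral[OF int] D_nonneg by simp
  qed
  have em: "emeasure (M N) A = 1" if "A \<in> sets borel" "{0..2 * pi} \<subseteq> A" for A N
  proof -
    have "emeasure (M N) A = (\<integral>\<^sup>+\<theta>. ennreal (indicator {0..2 * pi} \<theta> * D (Suc N) \<theta>) * indicator A \<theta> \<partial>lborel)"
      unfolding M_def using that(1) by (subst emeasure_density) auto
    also have "\<dots> = (\<integral>\<^sup>+\<theta>. ennreal (indicator {0..2 * pi} \<theta> * D (Suc N) \<theta>) \<partial>lborel)"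
      using that(2) by (intro nn_integral_cong) (auto simp: indicator_def)
    finally show ?thesis
      by (simp add: mass)
  qed
  have M_dist: "real_distribution (M N)" for N
  proof -
    have "prob_space (M N)"
      using em[of UNIV N] by (intro prob_spaceI) (simp add: M_def)
    then show ?thesis
      by (simp add: real_distribution_def real_distribution_axioms_def M_def)
  qed
  have "tight M"
    unfolding tight_def
  proof (intro conjI allI impI M_dist)
    fix \<epsilon> :: real assume "\<epsilon> > 0"
    \<comment> \<open>\<open>tight\<close> uses intervals open on the left, so the left end has to
      lie strictly below 0.\<close>
    moreover have "{0..2 * pi} \<subseteq> {-1<..8}"
      using pi_less_4 by auto
    then have "measure (M N) {-1<..8} = 1" for N
      using em[of "{-1<..8}" N] by (simp add: measure_def)
    ultimately show "\<exists>a b. a < b \<and> (\<forall>n. 1 - \<epsilon> < measure (M n) {a<..b})"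
      by (intro exI[of _ "-1"] exI[of _ 8]) auto
  qed
  then obtain r L where r: "strict_mono (r :: nat \<Rightarrow> nat)" and L: "real_distribution L"
      and conv: "weak_conv_m (M \<circ> id \<circ> r) L"
    using tight_imp_convergent_subsubsequence[of M id] strict_mono_id by blast
  have "(LINT \<theta>|L. iexp (real n * \<theta>)) = c n" for n
  proof (rule LIMSEQ_unique)
    show "(\<lambda>k. LINT \<theta>|(M \<circ> id \<circ> r) k. iexp (real n * \<theta>)) \<longlonglongrightarrow> (LINT \<theta>|L. iexp (real n * \<theta>))"
      using M_dist L conv
      by (intro weak_conv_imp_integral_bdd_continuous_conv[where B = 1]) (auto simp: comp_def intro!: continuous_intros)
    have "(\<lambda>N. real (Suc N - n) / real (Suc N)) \<longlonglongrightarrow> 1"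
      by real_asymp
    then have "(\<lambda>N. complex_of_real (real (Suc N - n) / real (Suc N)) * c n) \<longlonglongrightarrow> of_real 1 * c n"
      by (intro tendsto_intros)
    from LIMSEQ_subseq_LIMSEQ[OF this r]
    show "(\<lambda>k. LINT \<theta>|(M \<circ> id \<circ> r) k. iexp (real n * \<theta>)) \<longlonglongrightarrow> c n"
      unfolding comp_def id_apply M_integral by simp
  qed
  with L show ?thesis by blast
qed

section \<open>Self-adjoint operators and the Cayley transform\<close>

lemma selfadjoint_linear: "selfadjoint T \<Longrightarrow> linear_operator T"
  and selfadjoint_dense: "selfadjoint T \<Longrightarrow> closure (dom T) = UNIV"
  by (auto simp: selfadjoint_def densely_defined_def)

lemma linear_operator_add:
  "linear_operator T \<Longrightarrow> f \<in> dom T \<Longrightarrow> g \<in> dom T \<Longrightarrow>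
    f + g \<in> dom T \<and> op_app T (f + g) = op_app T f + op_app T g"
  unfolding linear_operator_def csubspace_def by blast

lemma linear_operator_scaleC:
  "linear_operator T \<Longrightarrow> f \<in> dom T \<Longrightarrow> c *\<^sub>C f \<in> dom T \<and> op_app T (c *\<^sub>C f) = c *\<^sub>C op_app T f"
  unfolding linear_operator_def csubspace_def by blast

lemma linear_operator_diff:
  assumes "linear_operator T" "f \<in> dom T" "g \<in> dom T"
  shows "f - g \<in> dom T \<and> op_app T (f - g) = op_app T f - op_app T g"
  using linear_operator_add[OF assms(1,2), of "- g"] linear_operator_scaleC[OF assms(1,3), of "-1"]
  by (simp add: minus_eq_scaleC[symmetric])

lemma op_adjoint_eq_Some:
  assumes "densely_defined T"
  shows "op_adjoint T g = Some h \<longleftrightarrow> (\<forall>f\<in>dom T. cinner g (op_app T f) = cinner h f)"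
proof -
  have uniq: "h = h'" if "\<forall>f\<in>dom T. cinner g (op_app T f) = cinner h f"
      "\<forall>f\<in>dom T. cinner g (op_app T f) = cinner h' f" for h h'
  proof (rule cinner_ext_dense)
    show "closure (dom T) = UNIV"
      using assms by (simp add: densely_defined_def)
    show "cinner f h = cinner f h'" if "f \<in> dom T" for f
      unfolding cinner_commute[of f h] cinner_commute[of f h']
      using that \<open>\<forall>f\<in>dom T. cinner g (op_app T f) = cinner h f\<close>
        \<open>\<forall>f\<in>dom T. cinner g (op_app T f) = cinner h' f\<close> by simp
  qed
  show ?thesis
  proof
    assume h: "\<forall>f\<in>dom T. cinner g (op_app T f) = cinner h f"
    then have "(THE h. \<forall>f\<in>dom T. cinner g (op_app T f) = cinner h f) = h"
      by (rule the_equality) (rule uniq[OF _ h])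
    with h show "op_adjoint T g = Some h"
      by (auto simp: op_adjoint_def)
  next
    assume *: "op_adjoint T g = Some h"
    then have ex: "\<exists>h. \<forall>f\<in>dom T. cinner g (op_app T f) = cinner h f"
      unfolding op_adjoint_def by (auto split: if_splits)
    then obtain h' where h': "\<forall>f\<in>dom T. cinner g (op_app T f) = cinner h' f"
      by blast
    have "h = (THE h. \<forall>f\<in>dom T. cinner g (op_app T f) = cinner h f)"
      using * ex by (simp add: op_adjoint_def)
    also have "\<dots> = h'"
      by (rule the_equality, rule h', rule uniq[OF _ h'])
    finally show "\<forall>f\<in>dom T. cinner g (op_app T f) = cinner h f"
      using h' by simp
  qed
qed

text \<open>Serves as a membership test: a vector lies in the domain as soon as it satisfies the
  weak equation, which passes to limits.\<close>

lemma selfadjoint_iff: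
  assumes "selfadjoint T"
  shows "g \<in> dom T \<and> op_app T g = h \<longleftrightarrow> (\<forall>f\<in>dom T. cinner g (op_app T f) = cinner h f)"
  using op_adjoint_eq_Some[of T g h] assms by (auto simp: selfadjoint_def op_app_def)

lemma selfadjoint_symmetric:
  assumes "selfadjoint T" "g \<in> dom T" "f \<in> dom T"
  shows "cinner g (op_app T f) = cinner (op_app T g) f"
  using selfadjoint_iff[OF assms(1), of g "op_app T g"] assms by blast

text \<open>The cross term is twice the real part of \<sigma> times the real number <Tf, f>, hence
  0.\<close>

lemma norm_selfadjoint_plus_i:
  assumes T: "selfadjoint T" "f \<in> dom T" and \<sigma>: "\<sigma> = \<i> \<or> \<sigma> = - \<i>"
  shows "(norm (op_app T f + \<sigma> *\<^sub>C f))\<^sup>2 = (norm (op_app T f))\<^sup>2 + (norm f)\<^sup>2"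
proof -
  have "cnj (cinner (op_app T f) f) = cinner (op_app T f) f"
    using selfadjoint_symmetric[OF T(1,2,2)] cinner_commute[of f "op_app T f"] by simp
  then have "Im (cinner (op_app T f) f) = 0"
    by (simp add: complex_eq_iff)
  then show ?thesis
    using \<sigma> by (auto simp: norm_add_square norm_scaleC)
qed

lemma selfadjoint_plus_i_surj:
  assumes T: "selfadjoint T" and \<sigma>: "\<sigma> = \<i> \<or> \<sigma> = - \<i>"
  shows "\<exists>f\<in>dom T. op_app T f + \<sigma> *\<^sub>C f = y"
proof -
  note lin = selfadjoint_linear[OF T]
  define R where "R = (\<lambda>f. op_app T f + \<sigma> *\<^sub>C f) ` dom T"
  have zero: "0 \<in> dom T"
    using lin by (simp add: linear_operator_def csubspace_def)
  have R: "csubspace R"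
    unfolding csubspace_def
  proof (intro conjI ballI allI)
    have "op_app T 0 + \<sigma> *\<^sub>C 0 = 0"
      using linear_operator_scaleC[OF lin zero, of 0] by simp
    then show "0 \<in> R"
      unfolding R_def using zero by (intro image_eqI[of _ _ 0]) auto
    fix x y assume "x \<in> R" "y \<in> R"
    then obtain f g where f: "f \<in> dom T" "x = op_app T f + \<sigma> *\<^sub>C f" and g: "g \<in> dom T" "y = op_app T g + \<sigma> *\<^sub>C g"
      by (auto simp: R_def)
    show "x + y \<in> R"
      unfolding R_def using linear_operator_add[OF lin f(1) g(1)]
      by (intro image_eqI[of _ _ "f + g"]) (auto simp: f g scaleC_add_right)
    show "c *\<^sub>C x \<in> R" for c
      unfolding R_def using linear_operator_scaleC[OF lin f(1), of c]
      by (intro image_eqI[of _ _ "c *\<^sub>C f"]) (auto simp: f scaleC_add_right scaleC_scaleC mult.commute)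
  qed
  \<comment> \<open>Differences of preimages are dominated by differences of images, so preimages of
    a convergent sequence converge; the limit is in the domain because the adjoint equation passes
    to the limit.\<close>
  have "closed R"
    unfolding closed_sequential_limits
  proof (intro allI impI, elim conjE)
    fix x l assume "\<forall>n. x n \<in> R" and x: "x \<longlonglongrightarrow> l"
    then have "\<forall>n. \<exists>f\<in>dom T. x n = op_app T f + \<sigma> *\<^sub>C f"
      unfolding R_def image_iff by blast
    then obtain f where f: "\<And>n. f n \<in> dom T" "\<And>n. x n = op_app T (f n) + \<sigma> *\<^sub>C f n"
      by metis
    have le: "norm (f m - f n) \<le> norm (x m - x n)" for m n
    proof (rule power2_le_imp_le)
      have "x m - x n = op_app T (f m - f n) + \<sigma> *\<^sub>C (f m - f n)"
        using linear_operator_diff[OF lin f(1)[of m] f(1)[of n]] by (simp add: f scaleC.diff_right)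
      then show "(norm (f m - f n))\<^sup>2 \<le> (norm (x m - x n))\<^sup>2"
        using norm_selfadjoint_plus_i[OF T _ \<sigma>, of "f m - f n"] linear_operator_diff[OF lin f(1)[of m] f(1)[of n]]
        by simp
    qed simp
    have "Cauchy f"
    proof (rule CauchyI)
      fix e :: real assume "e > 0"
      from CauchyD[OF LIMSEQ_imp_Cauchy[OF x] this]
      obtain M where M: "\<And>m n. m \<ge> M \<Longrightarrow> n \<ge> M \<Longrightarrow> norm (x m - x n) < e" by blast
      have "norm (f m - f n) < e" if "m \<ge> M" "n \<ge> M" for m n
        by (rule le_less_trans[OF le M[OF that]])
      then show "\<exists>M. \<forall>m\<ge>M. \<forall>n\<ge>M. norm (f m - f n) < e" by blast
    qed
    then obtain g where g: "f \<longlonglongrightarrow> g"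
      using Cauchy_convergent_iff convergent_def by metis
    have Tf: "(\<lambda>n. op_app T (f n)) \<longlonglongrightarrow> l - \<sigma> *\<^sub>C g"
    proof -
      have "(\<lambda>n. x n - \<sigma> *\<^sub>C f n) \<longlonglongrightarrow> l - \<sigma> *\<^sub>C g"
        by (intro tendsto_diff x scaleC.tendsto tendsto_const g)
      then show ?thesis by (simp add: f(2))
    qed
    have "cinner g (op_app T h) = cinner (l - \<sigma> *\<^sub>C g) h" if h: "h \<in> dom T" for h
    proof (rule LIMSEQ_unique)
      show "(\<lambda>n. cinner (f n) (op_app T h)) \<longlonglongrightarrow> cinner g (op_app T h)"
        by (intro cinner.tendsto g tendsto_const)
      show "(\<lambda>n. cinner (f n) (op_app T h)) \<longlonglongrightarrow> cinner (l - \<sigma> *\<^sub>C g) h"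
        unfolding selfadjoint_symmetric[OF T f(1) h] by (intro cinner.tendsto Tf tendsto_const)
    qed
    then have "g \<in> dom T \<and> op_app T g = l - \<sigma> *\<^sub>C g"
      unfolding selfadjoint_iff[OF T] by blast
    then show "l \<in> R"
      unfolding R_def by (intro image_eqI[of _ _ g]) auto
  qed
  then obtain h where h: "h \<in> R" "\<And>r. r \<in> R \<Longrightarrow> cinner (y - h) r = 0"
    using orthogonal_decomposition[OF R, of y] by blast
  \<comment> \<open>Since the conjugate of \<sigma> is -\<sigma>, orthogonality to \<open>R\<close>
    is the adjoint equation saying T (y - h) = \<sigma> (y - h). The norm identity with -\<sigma>
    then forces y = h.\<close>
  have "cinner (y - h) (op_app T f) = cinner (\<sigma> *\<^sub>C (y - h)) f" if "f \<in> dom T" for f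
  proof -
    have "op_app T f + \<sigma> *\<^sub>C f \<in> R"
      using that by (auto simp: R_def)
    from h(2)[OF this] have "cinner (y - h) (op_app T f) = - (\<sigma> * cinner (y - h) f)"
      by (simp add: cinner_add_right add_eq_0_iff2)
    then show ?thesis
      using \<sigma> by auto
  qed
  then have "y - h \<in> dom T \<and> op_app T (y - h) = \<sigma> *\<^sub>C (y - h)"
    unfolding selfadjoint_iff[OF T] by blast
  then have d: "y - h \<in> dom T" "op_app T (y - h) = \<sigma> *\<^sub>C (y - h)"
    by auto
  have "- \<sigma> = \<i> \<or> - \<sigma> = - \<i>"
    using \<sigma> by auto
  from norm_selfadjoint_plus_i[OF T d(1) this]
  have "(norm (y - h))\<^sup>2 \<le> 0"
    unfolding d(2) scaleC_add_left[symmetric] by simp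
  then have "y = h"
    by simp
  with h(1) show ?thesis
    by (auto simp: R_def)
qed

lemma selfadjoint_plus_i_inverse:
  assumes T: "selfadjoint T" and \<sigma>: "\<sigma> = \<i> \<or> \<sigma> = - \<i>"
  obtains R where "bounded_clinear R" "\<And>y. R y \<in> dom T" "\<And>y. op_app T (R y) + \<sigma> *\<^sub>C R y = y"
    "\<And>f. f \<in> dom T \<Longrightarrow> R (op_app T f + \<sigma> *\<^sub>C f) = f"
proof -
  note lin = selfadjoint_linear[OF T]
  obtain R where R: "\<And>y. R y \<in> dom T" "\<And>y. op_app T (R y) + \<sigma> *\<^sub>C R y = y"
    using selfadjoint_plus_i_surj[OF T \<sigma>] by metis
  have inj: "f = g" if "f \<in> dom T" "g \<in> dom T" "op_app T f + \<sigma> *\<^sub>C f = op_app T g + \<sigma> *\<^sub>C g" for f g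
  proof -
    have d: "f - g \<in> dom T" "op_app T (f - g) = op_app T f - op_app T g"
      using linear_operator_diff[OF lin that(1,2)] by auto
    have "op_app T (f - g) + \<sigma> *\<^sub>C (f - g) = 0"
      using that(3) by (simp add: d scaleC.diff_right algebra_simps)
    then have "(norm (f - g))\<^sup>2 \<le> 0"
      using norm_selfadjoint_plus_i[OF T d(1) \<sigma>] by simp
    then show ?thesis by simp
  qed
  have "bounded_clinear R"
  proof (rule bounded_clinearI)
    fix x y c
    show "R (x + y) = R x + R y"
    proof (rule inj)
      have "op_app T (R x + R y) + \<sigma> *\<^sub>C (R x + R y)
        = (op_app T (R x) + \<sigma> *\<^sub>C R x) + (op_app T (R y) + \<sigma> *\<^sub>C R y)"
        using linear_operator_add[OF lin R(1)[of x] R(1)[of y]] by (simp add: scaleC_add_right add_ac)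
      then show "op_app T (R (x + y)) + \<sigma> *\<^sub>C R (x + y) = op_app T (R x + R y) + \<sigma> *\<^sub>C (R x + R y)"
        by (simp only: R(2))
      show "R x + R y \<in> dom T"
        using linear_operator_add[OF lin R(1)[of x] R(1)[of y]] by blast
    qed (rule R(1))
    show "R (c *\<^sub>C x) = c *\<^sub>C R x"
    proof (rule inj)
      have "op_app T (c *\<^sub>C R x) + \<sigma> *\<^sub>C c *\<^sub>C R x = c *\<^sub>C (op_app T (R x) + \<sigma> *\<^sub>C R x)"
        using linear_operator_scaleC[OF lin R(1)[of x], of c]
        by (simp add: scaleC_add_right scaleC_scaleC mult.commute)
      then show "op_app T (R (c *\<^sub>C x)) + \<sigma> *\<^sub>C R (c *\<^sub>C x) = op_app T (c *\<^sub>C R x) + \<sigma> *\<^sub>C c *\<^sub>C R x"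
        by (simp only: R(2))
      show "c *\<^sub>C R x \<in> dom T"
        using linear_operator_scaleC[OF lin R(1)[of x], of c] by blast
    qed (rule R(1))
    have "(norm (R x))\<^sup>2 \<le> (norm x)\<^sup>2"
      using norm_selfadjoint_plus_i[OF T R(1)[of x] \<sigma>] by (simp add: R(2))
    then show "norm (R x) \<le> norm x * 1"
      by (simp add: power2_le_iff_abs_le)
  qed
  moreover have "R (op_app T f + \<sigma> *\<^sub>C f) = f" if "f \<in> dom T" for f
    using inj[OF R(1) that] R(2) by blast
  ultimately show ?thesis
    using that R by blast
qed

section \<open>The spectral theorem\<close>

text \<open>\<open>U\<close> is (T - i)(T + i)^-1 and \<open>V\<close> is (T + i)(T - i)^-1, each
  expressed by one bounded inverse, \<open>R\<close> or \<open>R'\<close>. The isometry property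
  holds because the mixed terms cancel by symmetry of \<open>T\<close>.\<close>

lemma cayley_transform:
  assumes T: "selfadjoint T"
  obtains U V R where "bounded_clinear U" "bounded_clinear V" "\<And>x. U (V x) = x" "\<And>x. V (U x) = x"
    "\<And>x y. cinner (U x) (U y) = cinner x y" "\<And>y. U y = y - (2 * \<i>) *\<^sub>C R y"
    "\<And>y. R y \<in> dom T" "\<And>y. op_app T (R y) = y - \<i> *\<^sub>C R y"
    "\<And>f. f \<in> dom T \<Longrightarrow> R (op_app T f + \<i> *\<^sub>C f) = f"
proof -
  obtain R where R: "bounded_clinear R" "\<And>y. R y \<in> dom T" "\<And>y. op_app T (R y) + \<i> *\<^sub>C R y = y"
    "\<And>f. f \<in> dom T \<Longrightarrow> R (op_app T f + \<i> *\<^sub>C f) = f"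
    using selfadjoint_plus_i_inverse[OF T, of \<i>] by blast
  obtain R' where R': "bounded_clinear R'" "\<And>y. R' y \<in> dom T" "\<And>y. op_app T (R' y) + (- \<i>) *\<^sub>C R' y = y"
    "\<And>f. f \<in> dom T \<Longrightarrow> R' (op_app T f + (- \<i>) *\<^sub>C f) = f"
    using selfadjoint_plus_i_inverse[OF T, of "- \<i>"] by blast
  have TR: "op_app T (R y) = y - \<i> *\<^sub>C R y" for y
    using R(3)[of y] by (simp add: eq_diff_eq)
  have TR': "op_app T (R' y) = y + \<i> *\<^sub>C R' y" for y
    using R'(3)[of y] by (simp add: scaleC.minus_left diff_eq_eq)
  have i2: "(2 * \<i>) *\<^sub>C x = \<i> *\<^sub>C x + \<i> *\<^sub>C x" for x :: 'a
    using scaleC_add_left[of \<i> \<i> x] by simp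
  define U V where "U y = y - (2 * \<i>) *\<^sub>C R y" and "V y = y + (2 * \<i>) *\<^sub>C R' y" for y
  have U: "U y = op_app T (R y) + (- \<i>) *\<^sub>C R y" for y
    by (simp add: U_def TR i2 scaleC.minus_left)
  have V: "V y = op_app T (R' y) + \<i> *\<^sub>C R' y" for y
    by (simp add: V_def TR' i2)
  have VU: "V (U y) = y" for y
  proof -
    have "R' (U y) = R y"
      unfolding U by (rule R'(4)[OF R(2)])
    then show ?thesis
      by (simp add: V_def U_def)
  qed
  have UV: "U (V y) = y" for y
  proof -
    have "R (V y) = R' y"
      unfolding V by (rule R(4)[OF R'(2)])
    then show ?thesis
      by (simp add: V_def U_def)
  qed
  have iso: "cinner (U x) (U y) = cinner x y" for x y
  proof -
    define a b where "a = R x" and "b = R y"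
    have ab: "U x = op_app T a + (- \<i>) *\<^sub>C a" "U y = op_app T b + (- \<i>) *\<^sub>C b"
      "x = op_app T a + \<i> *\<^sub>C a" "y = op_app T b + \<i> *\<^sub>C b" "a \<in> dom T" "b \<in> dom T"
      by (simp_all only: a_def b_def U R)
    have sym: "cinner a (op_app T b) = cinner (op_app T a) b"
      by (rule selfadjoint_symmetric[OF T ab(5,6)])
    have "cinner (U x) (U y) = cinner (op_app T a) (op_app T b) + cinner a b"
      unfolding ab(1,2) by (simp add: cinner_add_left cinner_add_right sym algebra_simps)
    moreover have "cinner x y = cinner (op_app T a) (op_app T b) + cinner a b"
      unfolding ab(3,4) by (simp add: cinner_add_left cinner_add_right sym algebra_simps)
    ultimately show ?thesis by simp
  qed
  have "bounded_clinear U"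
  proof -
    have "bounded_clinear (\<lambda>y. y + (- (2 * \<i>)) *\<^sub>C R y)"
      by (intro bounded_clinear_plus bounded_clinear_scaleC_op R(1))
        (simp add: bounded_clinear_def bounded_linear_ident)
    then show ?thesis
      unfolding U_def[abs_def] by (simp add: scaleC.minus_left)
  qed
  moreover have "bounded_clinear V"
    unfolding V_def[abs_def]
    by (intro bounded_clinear_plus bounded_clinear_scaleC_op R'(1))
      (simp add: bounded_clinear_def bounded_linear_ident)
  ultimately show ?thesis
    using that[of U V R] UV VU iso U_def R TR by blast
qed

lemma bounded_clinear_funpow: "bounded_clinear U \<Longrightarrow> bounded_clinear (U ^^ n)"
  by (induction n) (auto simp: comp_def id_def bounded_clinear_compose bounded_clinear_def bounded_linear_ident bounded_linear_compose)

text \<open>On a coboundary g - U g the sums telescope to something bounded, so the averages vanish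
  in the limit; density and the contractivity of the averages extend this to all vectors.\<close>

lemma mean_ergodic_zero:
  fixes U :: "'a::chilbert_space \<Rightarrow> 'a"
  assumes U: "bounded_clinear U" and iso: "\<And>x. norm (U x) = norm x"
    and D: "closure D = UNIV" "\<And>f. f \<in> D \<Longrightarrow> \<exists>g. f = g - U g"
  shows "(\<lambda>N. (1 / real N) *\<^sub>R (\<Sum>n<N. (U ^^ n) f)) \<longlonglongrightarrow> 0"
proof (rule LIMSEQ_I)
  fix e :: real assume e: "e > 0"
  have pow: "norm ((U ^^ n) x) = norm x" for n x
    by (induction n) (simp_all add: iso)
  note diffn = bounded_clinear_diff[OF bounded_clinear_funpow[OF U]]
  obtain f' where f': "f' \<in> D" "dist f' f < e / 2"
    using D(1) closure_approachable[of f D] e half_gt_zero by (metis UNIV_I)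
  then obtain g where g: "f' = g - U g"
    using D(2) by blast
  have tele: "(\<Sum>n<N. (U ^^ n) f') = g - (U ^^ N) g" for N
    by (induction N) (simp_all add: g diffn funpow_swap1)
  have split: "norm ((1 / real N) *\<^sub>R (\<Sum>n<N. (U ^^ n) f)) \<le> norm (f - f') + 2 * norm g / real N" for N
  proof -
    have "(\<Sum>n<N. (U ^^ n) f) = (\<Sum>n<N. (U ^^ n) (f - f')) + (g - (U ^^ N) g)"
      by (simp add: tele[symmetric] sum.distrib[symmetric] diffn)
    also have "norm \<dots> \<le> norm (\<Sum>n<N. (U ^^ n) (f - f')) + norm (g - (U ^^ N) g)"
      by (rule norm_triangle_ineq)
    also have "norm (\<Sum>n<N. (U ^^ n) (f - f')) \<le> real N * norm (f - f')"
      using sum_norm_le[of "{..<N}" "\<lambda>n. (U ^^ n) (f - f')" "\<lambda>_. norm (f - f')"] by (simp add: pow)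
    also have "norm (g - (U ^^ N) g) \<le> 2 * norm g"
      using norm_triangle_ineq4[of g "(U ^^ N) g"] by (simp add: pow)
    finally show ?thesis
      by (cases "N = 0") (simp_all add: field_simps)
  qed
  have "(\<lambda>N. 2 * norm g / real N) \<longlonglongrightarrow> 0"
    by real_asymp
  from LIMSEQ_D[OF this, of "e / 2"] e
  obtain N0 where N0: "\<And>N. N \<ge> N0 \<Longrightarrow> norm (2 * norm g / real N - 0) < e / 2" by auto
  have "norm ((1 / real N) *\<^sub>R (\<Sum>n<N. (U ^^ n) f) - 0) < e" if "N \<ge> N0" for N
    using split[of N] N0[OF that] f'(2) by (simp add: dist_norm norm_minus_commute)
  then show "\<exists>N0. \<forall>N\<ge>N0. norm ((1 / real N) *\<^sub>R (\<Sum>n<N. (U ^^ n) f) - 0) < e" by blast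
qed

lemma iexp_power: "iexp (real n * \<theta>) = iexp \<theta> ^ n"
  using exp_of_nat_mult[of n "\<i> * complex_of_real \<theta>"] by (simp add: mult_ac)

text \<open>The averages of exp(i n \<theta>) converge boundedly to the indicator of the points
  where exp(i \<theta>) = 1. Their integrals thus converge to the mass of that set, while by
  hypothesis they converge to 0.\<close>

lemma (in real_distribution) AE_iexp_ne_1:
  assumes c: "\<And>n. (LINT \<theta>|M. iexp (real n * \<theta>)) = c n"
    and lim: "(\<lambda>N. (1 / real N) *\<^sub>R (\<Sum>n<N. c n)) \<longlonglongrightarrow> 0"
  shows "AE \<theta> in M. iexp \<theta> \<noteq> 1"
proof -
  define S where "S = {\<theta>. iexp \<theta> = 1}"
  have "closed S"
    unfolding S_def by (intro closed_Collect_eq continuous_intros)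
  then have S [measurable]: "S \<in> sets borel"
    by simp
  define g where "g N \<theta> = (1 / real N) *\<^sub>R (\<Sum>n<N. iexp \<theta> ^ n)" for N \<theta>
  have int: "integrable M (\<lambda>\<theta>. iexp \<theta> ^ n)" for n
    by (rule integrable_const_bound[of _ 1]) (auto simp: norm_power)
  have conv: "(\<lambda>N. LINT \<theta>|M. g N \<theta>) \<longlonglongrightarrow> (LINT \<theta>|M. complex_of_real (indicator S \<theta>))"
  proof (rule integral_dominated_convergence[where w = "\<lambda>_. 1"])
    show "AE \<theta> in M. (\<lambda>N. g N \<theta>) \<longlonglongrightarrow> complex_of_real (indicator S \<theta>)"
    proof (rule AE_I2)
      fix \<theta>
      show "(\<lambda>N. g N \<theta>) \<longlonglongrightarrow> complex_of_real (indicator S \<theta>)"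
      proof (cases "\<theta> \<in> S")
        case True
        then have "g N \<theta> = 1" if "N > 0" for N
          using that by (simp add: g_def S_def scaleR_conv_of_real)
        then have "(\<lambda>N. g N \<theta>) \<longlonglongrightarrow> 1"
          by (intro tendsto_eventually eventually_mono[OF eventually_gt_at_top[of 0]])
        with True show ?thesis by simp
      next
        case False
        then have ne: "iexp \<theta> \<noteq> 1"
          by (simp add: S_def)
        have bound: "norm (g N \<theta>) \<le> (2 / cmod (iexp \<theta> - 1)) / real N" for N
        proof -
          have "norm (iexp \<theta> ^ N - 1) \<le> 2"
            using norm_triangle_ineq4[of "iexp \<theta> ^ N" 1] by (simp add: norm_power)
          then have "norm ((iexp \<theta> ^ N - 1) / (iexp \<theta> - 1)) \<le> 2 / cmod (iexp \<theta> - 1)"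
            unfolding norm_divide by (intro divide_right_mono) auto
          then have "norm ((iexp \<theta> ^ N - 1) / (iexp \<theta> - 1)) / real N \<le> (2 / cmod (iexp \<theta> - 1)) / real N"
            by (intro divide_right_mono) auto
          then show ?thesis
            unfolding g_def geometric_sum[OF ne] by simp
        qed
        have "(\<lambda>N. (2 / cmod (iexp \<theta> - 1)) / real N) \<longlonglongrightarrow> 0"
          by real_asymp
        then have "(\<lambda>N. g N \<theta>) \<longlonglongrightarrow> 0"
          by (rule Lim_null_comparison[rotated]) (use bound in auto)
        with False show ?thesis by simp
      qed
    qed
    show "AE \<theta> in M. norm (g N \<theta>) \<le> 1" for N
    proof (rule AE_I2)
      fix \<theta>
      have "norm (\<Sum>n<N. iexp \<theta> ^ n) \<le> real N"
        using sum_norm_le[of "{..<N}" "\<lambda>n. iexp \<theta> ^ n" "\<lambda>_. 1"] by (simp add: norm_power)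
      then show "norm (g N \<theta>) \<le> 1"
        by (cases "N = 0") (simp_all add: g_def divide_le_eq_1)
    qed
  qed (auto simp: g_def)
  have val: "(LINT \<theta>|M. g N \<theta>) = (1 / real N) *\<^sub>R (\<Sum>n<N. c n)" for N
    unfolding g_def c[symmetric] iexp_power using int by simp
  have "(LINT \<theta>|M. complex_of_real (indicator S \<theta>)) = 0"
    using conv unfolding val by (rule LIMSEQ_unique[OF _ lim])
  then have "measure M S = 0"
    unfolding integral_complex_of_real by simp
  then have "emeasure M S = 0"
    by (simp add: emeasure_eq_measure)
  then show ?thesis
    by (intro AE_I[of _ _ S]) (auto simp: S_def)
qed

text \<open>The solution of the moment problem for the unit vector along \<open>f\<close> is carried
  to the line by \<open>cayley_inverse\<close> and rescaled by (norm f)^2. Absence of mass at 1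
  ensures that \<open>cayley\<close> undoes the transport almost everywhere.\<close>

lemma cayley_moments:
  fixes U :: "'a::chilbert_space \<Rightarrow> 'a"
  assumes U: "bounded_clinear U" "\<And>x y. cinner (U x) (U y) = cinner x y"
    and erg: "\<And>f. (\<lambda>N. (1 / real N) *\<^sub>R (\<Sum>n<N. (U ^^ n) f)) \<longlonglongrightarrow> 0"
  shows "\<exists>\<mu>. sets \<mu> = sets borel \<and> emeasure \<mu> UNIV = ennreal ((norm f)\<^sup>2) \<and>
    (\<forall>n. (LINT x|\<mu>. cayley x ^ n) = cinner f ((U ^^ n) f))"
proof (cases "f = 0")
  case True
  have "(LINT x|null_measure borel. cayley x ^ n) = 0" for n
    by (intro integral_eq_zero_AE AE_I[of _ _ UNIV]) auto
  with True show ?thesis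
    by (intro exI[of _ "null_measure borel"]) simp
next
  case False
  define e where "e = (1 / norm f) *\<^sub>R f"
  have e: "norm e = 1" "f = norm f *\<^sub>R e"
    using False by (simp_all add: e_def)
  note scale = bounded_clinear_bounded_linear[OF bounded_clinear_funpow[OF U(1)], THEN bounded_linear.linear, THEN linear_scale]
  define c where "c n = cinner e ((U ^^ n) e)" for n
  have "cinner ((U ^^ j) e) ((U ^^ (n + j)) e) = c n" for j n
    by (induction j) (simp_all add: c_def U(2))
  moreover have "c 0 = 1"
    by (simp add: c_def cinner_self e)
  ultimately obtain M where M: "real_distribution M" and mom: "\<And>n. (LINT \<theta>|M. iexp (real n * \<theta>)) = c n"
    using stationary_sequence_moments[of "\<lambda>n. (U ^^ n) e" c] by blast
  interpret M: real_distribution M by fact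
  have "(\<lambda>N. cinner e ((1 / real N) *\<^sub>R (\<Sum>n<N. (U ^^ n) e))) \<longlonglongrightarrow> cinner e 0"
    by (intro cinner.tendsto tendsto_const erg)
  then have "(\<lambda>N. (1 / real N) *\<^sub>R (\<Sum>n<N. c n)) \<longlonglongrightarrow> 0"
    by (simp add: cinner.scaleR_right cinner.sum_right c_def)
  from M.AE_iexp_ne_1[OF mom this] have ne: "AE \<theta> in M. iexp \<theta> \<noteq> 1" .
  define h where "h \<theta> = cayley_inverse (iexp \<theta>)" for \<theta>
  have h_meas [measurable]: "h \<in> borel_measurable borel"
    unfolding h_def[abs_def] by measurable
  define \<nu> where "\<nu> = distr M borel h"
  interpret \<nu>: prob_space \<nu>
    unfolding \<nu>_def by (rule M.prob_space_distr) simp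
  define \<mu> where "\<mu> = density \<nu> (\<lambda>_. ennreal ((norm f)\<^sup>2))"
  have "(LINT x|\<mu>. cayley x ^ n) = cinner f ((U ^^ n) f)" for n
  proof -
    have "(LINT x|\<mu>. cayley x ^ n) = (norm f)\<^sup>2 *\<^sub>R (LINT x|\<nu>. cayley x ^ n)"
      unfolding \<mu>_def by (subst integral_density) (auto simp: \<nu>_def)
    also have "(LINT x|\<nu>. cayley x ^ n) = (LINT \<theta>|M. cayley (h \<theta>) ^ n)"
      unfolding \<nu>_def by (rule integral_distr) auto
    also have "\<dots> = (LINT \<theta>|M. iexp (real n * \<theta>))"
      unfolding iexp_power
    proof (rule integral_cong_AE)
      show "AE \<theta> in M. cayley (h \<theta>) ^ n = iexp \<theta> ^ n"
        using ne by eventually_elim (simp add: h_def cayley_cayley_inverse)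
    qed auto
    also have "(norm f)\<^sup>2 *\<^sub>R (LINT \<theta>|M. iexp (real n * \<theta>)) = cinner (norm f *\<^sub>R e) ((U ^^ n) (norm f *\<^sub>R e))"
      unfolding mom c_def scale cinner.scaleR_left cinner.scaleR_right by (simp add: power2_eq_square)
    finally show ?thesis
      using e(2) by simp
  qed
  moreover have "emeasure \<mu> UNIV = ennreal ((norm f)\<^sup>2)"
    unfolding \<mu>_def using \<nu>.emeasure_space_1 by (subst emeasure_density) (auto simp: \<nu>_def)
  moreover have "sets \<mu> = sets borel"
    by (simp add: \<mu>_def \<nu>_def)
  ultimately show ?thesis
    by blast
qed

section \<open>From a calculus back to a projection-valued measure\<close>

context spectral_family
begin

lemma calculus_sum_indicator:
  fixes S :: "nat \<Rightarrow> real set"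
  assumes S: "range S \<subseteq> sets borel" "disjoint_family S"
  shows "(\<Sum>i<n. calculus (indicator (S i)) f) = calculus (indicator (\<Union>i<n. S i)) f"
proof (induction n)
  case 0
  have "calculus (\<lambda>_. 0) f = 0"
    using calculus_const[of 0] by simp
  then show ?case by simp
next
  case (Suc n)
  have Sm: "S i \<in> sets borel" for i
    using S(1) by blast
  have "S i \<inter> S n = {}" if "i < n" for i
    using disjoint_family_onD[OF S(2), of i n] that by simp
  then have "(\<lambda>x. indicator (\<Union>i<n. S i) x + indicator (S n) x) = (indicator (\<Union>i<Suc n. S i) :: real \<Rightarrow> complex)"
    by (fastforce simp: fun_eq_iff indicator_def lessThan_Suc)
  then have "calculus (indicator (\<Union>i<Suc n. S i)) f = calculus (indicator (\<Union>i<n. S i)) f + calculus (indicator (S n)) f"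
    using calculus_add[of "indicator (\<Union>i<n. S i)" "indicator (S n)"] Sm
    by (simp add: bounded_borel_indicator sets.finite_UN fun_eq_iff)
  then show ?case
    using Suc by simp
qed

lemma projection_valued_measure_calculus:
  "projection_valued_measure (\<lambda>S. calculus (indicator S))"
  unfolding projection_valued_measure_def
proof (intro conjI ballI allI impI)
  fix S :: "real set" assume S: "S \<in> sets borel"
  have b: "indicator S \<in> bounded_borel"
    using S by (rule bounded_borel_indicator)
  have "calculus (indicator S) (calculus (indicator S) f) = calculus (indicator S) f" for f
    unfolding calculus_mult[OF b b, symmetric] by (simp add: indicator_inter_arith[symmetric])
  moreover have "(\<lambda>x. cnj (indicator S x)) = (indicator S :: real \<Rightarrow> complex)"
    by (auto simp: fun_eq_iff indicator_def)
  then have "cinner f (calculus (indicator S) g) = cinner (calculus (indicator S) f) g" for f g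
    unfolding calculus_adjoint[OF b] by simp
  ultimately show "orthogonal_projection (calculus (indicator S))"
    unfolding orthogonal_projection_def using bounded_clinear_calculus[OF b] by (simp add: comp_def)
  fix S' :: "real set" assume S': "S' \<in> sets borel"
  show "calculus (indicator (S \<inter> S')) = calculus (indicator S) \<circ> calculus (indicator S')"
    using calculus_mult[OF b bounded_borel_indicator[OF S']]
    by (simp add: fun_eq_iff indicator_inter_arith[abs_def])
next
  show "calculus (indicator {}) = (\<lambda>_. 0)"
    using calculus_const[of 0] by (simp add: indicator_def[abs_def])
  show "calculus (indicator UNIV) = id"
    using calculus_one by (simp add: indicator_def[abs_def] id_def)
  fix S :: "nat \<Rightarrow> real set" and f
  assume S: "range S \<subseteq> sets borel" "disjoint_family S"
  show "(\<lambda>n. calculus (indicator (S n)) f) sums calculus (indicator (\<Union>n. S n)) f"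
    unfolding sums_def calculus_sum_indicator[OF S]
  proof (rule calculus_tendsto)
    show "indicator (\<Union>i<n. S i) \<in> bounded_borel" for n
      using S(1) by (intro bounded_borel_indicator sets.finite_UN) auto
    show "cmod (indicator (\<Union>i<n. S i) x) \<le> 1" for n x
      by (simp add: indicator_def)
  qed (rule LIMSEQ_indicator_UN)
qed

lemma scalar_measure_calculus: "scalar_measure (\<lambda>S. calculus (indicator S)) f = \<mu> f"
proof -
  have "scalar_measure (\<lambda>S. calculus (indicator S)) f = measure_of UNIV (sets borel) (emeasure (\<mu> f))"
    unfolding scalar_measure_def
  proof (rule measure_of_eq)
    fix S assume "S \<in> sigma_sets UNIV (sets (borel :: real measure))"
    then have "S \<in> sets borel"
      using sets.sigma_sets_eq[of "borel :: real measure"] by simp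
    then show "ennreal (Re (cinner f (calculus (indicator S) f))) = emeasure (\<mu> f) S"
      by (simp add: measure_indicator[symmetric] emeasure_eq_measure)
  qed simp
  then show ?thesis
    using measure_of_of_measure[of "\<mu> f"] by simp
qed

end

theorem spectral_theorem:
  fixes T :: "'a::chilbert_space \<rightharpoonup> 'a"
  assumes T: "selfadjoint T"
  shows "\<exists>E. spectral_measure_of T E"
proof -
  obtain U V R where U: "bounded_clinear U" and V: "bounded_clinear V"
    and UV: "\<And>x. U (V x) = x" and VU: "\<And>x. V (U x) = x"
    and iso: "\<And>x y. cinner (U x) (U y) = cinner x y" and UR: "\<And>y. U y = y - (2 * \<i>) *\<^sub>C R y"
    and R: "\<And>y. R y \<in> dom T" "\<And>y. op_app T (R y) = y - \<i> *\<^sub>C R y"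
      "\<And>f. f \<in> dom T \<Longrightarrow> R (op_app T f + \<i> *\<^sub>C f) = f"
    using cayley_transform[OF T] by blast
  have norm_U: "norm (U x) = norm x" for x
  proof -
    have "(norm (U x))\<^sup>2 = (norm x)\<^sup>2"
      unfolding Re_cinner_self[symmetric] iso ..
    then show ?thesis by (simp add: power2_eq_iff_nonneg)
  qed
  have erg: "(\<lambda>N. (1 / real N) *\<^sub>R (\<Sum>n<N. (U ^^ n) f)) \<longlonglongrightarrow> 0" for f
  proof (rule mean_ergodic_zero[OF U norm_U selfadjoint_dense[OF T]])
    fix f assume f: "f \<in> dom T"
    \<comment> \<open>This is (T + i) applied to f/(2i), so that R sends it to f/(2i), and U = 1 -
      2iR gives ?g - U ?g = f: every vector of the domain is a coboundary.\<close>
    let ?g = "op_app T ((1 / (2 * \<i>)) *\<^sub>C f) + \<i> *\<^sub>C ((1 / (2 * \<i>)) *\<^sub>C f)"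
    have "(1 / (2 * \<i>)) *\<^sub>C f \<in> dom T"
      using linear_operator_scaleC[OF selfadjoint_linear[OF T] f] by blast
    from R(3)[OF this] have "f = ?g - U ?g"
      by (simp add: UR scaleC_scaleC)
    then show "\<exists>g. f = g - U g" ..
  qed
  have "\<forall>f. \<exists>\<mu>. sets \<mu> = sets borel \<and> emeasure \<mu> UNIV = ennreal ((norm f)\<^sup>2) \<and>
    (\<forall>n. (LINT x|\<mu>. cayley x ^ n) = cinner f ((U ^^ n) f))"
    using cayley_moments[OF U iso erg] by blast
  from choice[OF this] obtain \<mu> where \<mu>: "\<And>f. sets (\<mu> f) = sets borel" "\<And>f. emeasure (\<mu> f) UNIV = ennreal ((norm f)\<^sup>2)"
    "\<And>f n. (LINT x|\<mu> f. cayley x ^ n) = cinner f ((U ^^ n) f)"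
    by blast
  have comm: "(V ^^ m) ((U ^^ n) x) = (U ^^ n) ((V ^^ m) x)" for m n x
  proof -
    have *: "V ((U ^^ n) x) = (U ^^ n) (V x)" for x
    proof (cases n)
      case (Suc k)
      have "(U ^^ Suc k) (V x) = (U ^^ k) x"
        by (simp only: funpow_Suc_right comp_apply UV)
      then show ?thesis
        by (simp add: Suc VU)
    qed simp
    show ?thesis
      by (induction m) (simp_all add: *)
  qed
  have UVn: "(U ^^ n) ((V ^^ n) x) = x" for n x
  proof (induction n)
    case (Suc n)
    have "(U ^^ Suc n) ((V ^^ Suc n) x) = (U ^^ n) (U (V ((V ^^ n) x)))"
      by (simp only: funpow_Suc_right[of n U] funpow.simps(2)[of n V] comp_apply)
    then show ?case
      by (simp only: UV Suc)
  qed simp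
  have iso_n: "cinner ((U ^^ n) x) ((U ^^ n) y) = cinner x y" for n x y
    by (induction n) (simp_all add: iso)
  \<comment> \<open>Since \<open>cayley\<close> is unimodular and \<open>V\<close> inverts
    \<open>U\<close>, equal powers cancel on both sides. For m \<le> n a nonnegative moment is left;
    otherwise its conjugate, matched by the isometry of \<open>U\<close>.\<close>
  have rep: "represents \<mu> (\<lambda>x. cayley x ^ n * cnj (cayley x) ^ m) (\<lambda>f. (U ^^ n) ((V ^^ m) f))" for n m
    unfolding represents_def
  proof (intro conjI allI)
    show "bounded_clinear (\<lambda>f. (U ^^ n) ((V ^^ m) f))"
      by (rule bounded_clinear_compose[OF bounded_clinear_funpow[OF U] bounded_clinear_funpow[OF V]])
    fix f
    have unit: "cayley x ^ k * cnj (cayley x) ^ k = 1" for x k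
      by (simp add: power_mult_distrib[symmetric] complex_norm_square[symmetric])
    show "cinner f ((U ^^ n) ((V ^^ m) f)) = (LINT x|\<mu> f. cayley x ^ n * cnj (cayley x) ^ m)"
    proof (cases "m \<le> n")
      case True
      define k where "k = n - m"
      have n: "n = k + m" using True by (simp add: k_def)
      have "cayley x ^ n * cnj (cayley x) ^ m = cayley x ^ k" for x
        using unit[of x m] by (simp add: n power_add mult.assoc)
      then show ?thesis
        by (simp add: \<mu>(3) n funpow_add UVn)
    next
      case False
      define k where "k = m - n"
      have m: "m = n + k" using False by (simp add: k_def)
      have "cayley x ^ n * cnj (cayley x) ^ m = cnj (cayley x ^ k)" for x
        using unit[of x n] by (simp add: m power_add mult.assoc[symmetric])
      then have "(LINT x|\<mu> f. cayley x ^ n * cnj (cayley x) ^ m) = cnj (cinner f ((U ^^ k) f))"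
        using Bochner_Integration.integral_cnj[of "\<mu> f" "\<lambda>x. cayley x ^ k"] by (simp add: \<mu>(3))
      also have "\<dots> = cinner ((U ^^ k) f) ((U ^^ k) ((V ^^ k) f))"
        by (simp only: UVn cinner_commute[of "(U ^^ k) f" f])
      also have "\<dots> = cinner f ((V ^^ k) f)"
        by (rule iso_n)
      also have "\<dots> = cinner f ((U ^^ n) ((V ^^ m) f))"
        by (simp add: m funpow_add UVn)
      finally show ?thesis by simp
    qed
  qed
  interpret spectral_family \<mu> cayley_monomials
  proof
    show "generating cayley_monomials"
      by (rule generating_cayley_monomials)
    show sub: "cayley_monomials \<subseteq> bounded_borel"
    proof
      fix u assume "u \<in> cayley_monomials"
      then obtain n m where u: "u = (\<lambda>x. cayley x ^ n * cnj (cayley x) ^ m)"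
        by (auto simp: cayley_monomials_def)
      show "u \<in> bounded_borel"
        unfolding u by (rule bounded_borelI[where C = 1]) (measurable, simp add: norm_mult norm_power)
    qed
    show "\<exists>B. represents \<mu> u B" if "u \<in> cayley_monomials" for u
      using that rep by (auto simp: cayley_monomials_def)
    show "represents \<mu> (\<lambda>x. u x * v x) (\<lambda>f. B (C f))"
      if uv: "u \<in> cayley_monomials" "v \<in> cayley_monomials" and BC: "represents \<mu> u B" "represents \<mu> v C" for u v B C
    proof -
      obtain n m n' m' where u: "u = (\<lambda>x. cayley x ^ n * cnj (cayley x) ^ m)"
          and v: "v = (\<lambda>x. cayley x ^ n' * cnj (cayley x) ^ m')"
        using uv by (auto simp: cayley_monomials_def)
      have B: "B = (\<lambda>f. (U ^^ n) ((V ^^ m) f))"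
        using BC(1) rep[of n m] unfolding u represents_def by (intro quadratic_form_eqD) simp_all
      have C: "C = (\<lambda>f. (U ^^ n') ((V ^^ m') f))"
        using BC(2) rep[of n' m'] unfolding v represents_def by (intro quadratic_form_eqD) simp_all
      have "(\<lambda>f. B (C f)) = (\<lambda>f. (U ^^ (n + n')) ((V ^^ (m + m')) f))"
        unfolding B C comm by (simp add: funpow_add)
      then show ?thesis
        using rep[of "n + n'" "m + m'"] by (simp add: u v power_add mult_ac)
    qed
  qed (rule \<mu>)+
  \<comment> \<open>The function of (T + i)^-1. As it equals (1 - cayley)/(2i), its operator is
    \<open>R\<close>.\<close>
  define \<rho> where "\<rho> x = 1 / (complex_of_real x + \<i>)" for x
  have \<rho>_abs: "(cmod (\<rho> x))\<^sup>2 = 1 / (x\<^sup>2 + 1)" for x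
    by (simp add: \<rho>_def norm_divide power_divide cmod_power2)
  have \<rho>_meas [measurable]: "\<rho> \<in> borel_measurable borel"
    unfolding \<rho>_def[abs_def] by measurable
  have \<rho>: "\<rho> \<in> bounded_borel"
  proof (rule bounded_borelI[OF \<rho>_meas])
    have "(cmod (\<rho> x))\<^sup>2 \<le> 1\<^sup>2" for x
      unfolding \<rho>_abs by (simp add: divide_le_eq_1 add_nonneg_pos)
    then show "cmod (\<rho> x) \<le> 1" for x
      by (rule power2_le_imp_le) simp
  qed
  have cay: "cayley \<in> bounded_borel"
    by (rule bounded_borelI[where C = 1]) auto
  have cU: "calculus cayley = U"
    using rep[of 1 0] by (intro calculus_eqI) simp
  have cR: "calculus \<rho> = R"
  proof
    fix f
    have "\<rho> = (\<lambda>x. (1 / (2 * \<i>)) * (1 - cayley x))"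
      by (simp add: fun_eq_iff \<rho>_def cayley_def divide_simps)
    then have "calculus \<rho> f = (1 / (2 * \<i>)) *\<^sub>C calculus (\<lambda>x. 1 - cayley x) f"
      using calculus_scale[OF bounded_borel_add[OF bounded_borel_const bounded_borel_scale[OF cay, of "-1"]], of "1 / (2 * \<i>)" 1]
      by simp
    also have "calculus (\<lambda>x. 1 - cayley x) f = f - U f"
      using calculus_diff[OF bounded_borel_const cay, of 1 f] by (simp add: calculus_one cU)
    finally show "calculus \<rho> f = R f"
      by (simp add: UR scaleC_scaleC)
  qed
  have \<mu>R: "\<mu> (R g) = density (\<mu> g) (\<lambda>x. ennreal (1 / (x\<^sup>2 + 1)))" for g
    using family_calculus[OF \<rho>, of g] unfolding cR \<rho>_abs .
  have pos: "0 < x\<^sup>2 + 1" for x :: real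
    by (simp add: add_nonneg_pos)
  \<comment> \<open>The domain is the range of \<open>R\<close>. The measure of R g has density
    1/(x^2 + 1), against which x^2 is integrable; conversely integrability of x^2 is that of
    1/|\<rho>|^2, and \<open>calculus_surjective\<close> provides a preimage under
    \<open>R\<close>.\<close>
  have dom: "f \<in> dom T \<longleftrightarrow> integrable (\<mu> f) (\<lambda>x. x\<^sup>2)" for f
  proof
    assume "f \<in> dom T"
    then obtain g where f: "f = R g"
      using R(3) by metis
    have "integrable (\<mu> g) (\<lambda>x. x\<^sup>2 / (x\<^sup>2 + 1))"
      by (rule integrable_const_bound[of _ 1]) (auto simp: divide_le_eq_1 pos)
    then show "integrable (\<mu> f) (\<lambda>x. x\<^sup>2)"
      unfolding f \<mu>R using pos by (subst integrable_density) (auto intro: less_imp_le)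
  next
    assume "integrable (\<mu> f) (\<lambda>x. x\<^sup>2)"
    then have "integrable (\<mu> f) (\<lambda>x. 1 / (cmod (\<rho> x))\<^sup>2)"
      unfolding \<rho>_abs by simp
    then obtain k where "calculus \<rho> k = f"
      using calculus_surjective[OF \<rho>, of f] by (auto simp: \<rho>_def)
    then show "f \<in> dom T"
      using R(1) unfolding cR by blast
  qed
  have form: "cinner f (op_app T f) = complex_of_real (LINT x|\<mu> f. x)" if fdom: "f \<in> dom T" for f
  proof -
    obtain g where f: "f = R g"
      using R(3)[OF fdom] by metis
    \<comment> \<open>This is x/(x + i), the bounded function belonging to T (T + i)^-1.\<close>
    define w where "w x = 1 - \<i> * \<rho> x" for x
    have w: "w \<in> bounded_borel"
      using bounded_borel_add[OF bounded_borel_const bounded_borel_scale[OF \<rho>, of "- \<i>"], of 1]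
      by (simp add: w_def[abs_def])
    have "op_app T f = calculus w g"
      unfolding w_def[abs_def] f R(2)
      by (simp add: cR calculus_diff[OF bounded_borel_const bounded_borel_scale[OF \<rho>]] calculus_one calculus_scale[OF \<rho>])
    then have "cinner f (op_app T f) = cinner g (calculus (\<lambda>x. cnj (\<rho> x)) (calculus w g))"
      by (simp add: f cR[symmetric] calculus_adjoint[OF \<rho>])
    also have "\<dots> = (LINT x|\<mu> g. cnj (\<rho> x) * w x)"
      unfolding calculus_mult[OF bounded_borel_cnj[OF \<rho>] w, symmetric]
      by (rule cinner_calculus[OF bounded_borel_mult[OF bounded_borel_cnj[OF \<rho>] w]])
    also have "\<dots> = (LINT x|\<mu> g. complex_of_real (1 / (x\<^sup>2 + 1) * x))"
    proof (rule Bochner_Integration.integral_cong[OF refl])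
      fix x
      have "w x = of_real x * \<rho> x"
        by (simp add: w_def \<rho>_def divide_simps)
      then have "cnj (\<rho> x) * w x = (\<rho> x * cnj (\<rho> x)) * of_real x"
        by simp
      then show "cnj (\<rho> x) * w x = complex_of_real (1 / (x\<^sup>2 + 1) * x)"
        unfolding complex_norm_square[symmetric] \<rho>_abs by simp
    qed
    also have "\<dots> = complex_of_real (LINT x|\<mu> g. 1 / (x\<^sup>2 + 1) * x)"
      by (rule integral_complex_of_real)
    also have "(LINT x|\<mu> g. 1 / (x\<^sup>2 + 1) * x) = (LINT x|\<mu> f. x)"
      unfolding f \<mu>R using pos by (subst integral_density) (auto intro: less_imp_le)
    finally show ?thesis .
  qed
  show ?thesis
    unfolding spectral_measure_of_def
    using projection_valued_measure_calculus dom form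
    by (intro exI[of _ "\<lambda>S. calculus (indicator S)"]) (auto simp: scalar_measure_calculus)
qed

section \<open>Functional calculus of a self-adjoint operator\<close>

lemma cinner_orthogonal_projection:
  assumes "orthogonal_projection P"
  shows "cinner f (P f) = complex_of_real ((norm (P f))\<^sup>2)"
proof -
  have "cinner f (P f) = cinner f (P (P f))"
    using assms by (simp add: orthogonal_projection_def fun_eq_iff)
  also have "\<dots> = cinner (P f) (P f)"
    using assms by (simp add: orthogonal_projection_def)
  finally show ?thesis
    by (simp add: cinner_self)
qed

text \<open>\<open>spectral_projection\<close> is an arbitrary choice and need not be the measure
  constructed above, so the calculus is rebuilt from the axioms of a projection-valued measure
  alone.\<close>

lemma spectral_family_projection_valued_measure:
  fixes E :: "real set \<Rightarrow> 'a::chilbert_space \<Rightarrow> 'a"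
  assumes E: "projection_valued_measure E"
  shows "spectral_family (scalar_measure E) ((\<lambda>S. indicator S) ` sets borel)"
    and "S \<in> sets borel \<Longrightarrow> represents (scalar_measure E) (indicator S) (E S)"
proof -
  have proj: "orthogonal_projection (E S)" if "S \<in> sets borel" for S
    using E that by (simp add: projection_valued_measure_def)
  have sets: "sets (scalar_measure E f) = sets borel" for f
    using sets.sigma_sets_eq[of "borel :: real measure"]
    by (simp add: scalar_measure_def)
  have em: "emeasure (scalar_measure E f) S = ennreal ((norm (E S f))\<^sup>2)" if S: "S \<in> sets borel" for S f
  proof -
    have "emeasure (scalar_measure E f) S = ennreal (Re (cinner f (E S f)))"
    proof (rule emeasure_measure_of[OF scalar_measure_def])
      show "positive (sets (scalar_measure E f)) (\<lambda>S. ennreal (Re (cinner f (E S f))))"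
        using E by (simp add: positive_def projection_valued_measure_def)
      show "countably_additive (sets (scalar_measure E f)) (\<lambda>S. ennreal (Re (cinner f (E S f))))"
        unfolding sets
      proof (rule countably_additiveI)
        fix A :: "nat \<Rightarrow> real set"
        assume A: "range A \<subseteq> sets borel" "disjoint_family A"
        have "(\<lambda>n. E (A n) f) sums E (\<Union>n. A n) f"
          using E A by (simp add: projection_valued_measure_def)
        then have "(\<lambda>n. Re (cinner f (E (A n) f))) sums Re (cinner f (E (\<Union>n. A n) f))"
          by (intro sums_Re bounded_linear.sums[OF cinner.bounded_linear_right])
        moreover have "0 \<le> Re (cinner f (E (A n) f))" for n
          using A(1) by (subst cinner_orthogonal_projection[OF proj]) auto
        ultimately show "(\<Sum>n. ennreal (Re (cinner f (E (A n) f)))) = ennreal (Re (cinner f (E (\<Union>n. A n) f)))"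
          by (intro suminf_ennreal_eq)
      qed
    qed (use S sets in auto)
    then show ?thesis
      by (simp add: cinner_orthogonal_projection[OF proj[OF S]])
  qed
  have rep: "represents (scalar_measure E) (indicator S) (E S)" if S: "S \<in> sets borel" for S
    unfolding represents_def
  proof (intro conjI allI)
    show "bounded_clinear (E S)"
      using proj[OF S] by (simp add: orthogonal_projection_def)
    fix f
    have "(LINT x|scalar_measure E f. indicator S x) = (LINT x|scalar_measure E f. complex_of_real (indicator S x))"
      by (simp add: of_real_indicator)
    also have "\<dots> = complex_of_real (measure (scalar_measure E f) S)"
      unfolding integral_complex_of_real using S
      by (simp add: sets sets_eq_imp_space_eq[OF sets])
    also have "\<dots> = cinner f (E S f)"
      by (simp add: measure_def em[OF S] cinner_orthogonal_projection[OF proj[OF S]])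
    finally show "cinner f (E S f) = (LINT x|scalar_measure E f. indicator S x)" ..
  qed
  show "S \<in> sets borel \<Longrightarrow> represents (scalar_measure E) (indicator S) (E S)"
    by (rule rep)
  show "spectral_family (scalar_measure E) ((\<lambda>S. indicator S) ` sets borel)"
  proof
    show "emeasure (scalar_measure E f) UNIV = ennreal ((norm f)\<^sup>2)" for f
      using em[of UNIV f] E by (simp add: projection_valued_measure_def)
    show "(\<lambda>S. indicator S) ` sets borel \<subseteq> bounded_borel"
      using bounded_borel_indicator by blast
    show "\<exists>B. represents (scalar_measure E) u B" if "u \<in> (\<lambda>S. indicator S) ` sets borel" for u
      using that rep by blast
    show "represents (scalar_measure E) (\<lambda>x. u x * v x) (\<lambda>f. B (C f))"
      if uv: "u \<in> (\<lambda>S. indicator S) ` sets borel" "v \<in> (\<lambda>S. indicator S) ` sets borel"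
        and BC: "represents (scalar_measure E) u B" "represents (scalar_measure E) v C" for u v B C
    proof -
      obtain S S' where S: "S \<in> sets borel" "u = indicator S" and S': "S' \<in> sets borel" "v = indicator S'"
        using uv by auto
      have B: "B = E S"
        using BC(1) rep[OF S(1)] unfolding S(2) represents_def by (intro quadratic_form_eqD) simp_all
      have C: "C = E S'"
        using BC(2) rep[OF S'(1)] unfolding S'(2) represents_def by (intro quadratic_form_eqD) simp_all
      have "(\<lambda>f. B (C f)) = E (S \<inter> S')"
        using E S(1) S'(1) by (simp add: B C projection_valued_measure_def comp_def)
      moreover have "(\<lambda>x. u x * v x) = indicator (S \<inter> S')"
        by (simp add: S(2) S'(2) fun_eq_iff indicator_inter_arith)
      ultimately show ?thesis
        using rep[of "S \<inter> S'"] S(1) S'(1) by simp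
    qed
  qed (rule sets generating_indicators)+
qed

lemma spectral_measure_of_spectral_projection:
  "selfadjoint T \<Longrightarrow> spectral_measure_of T (spectral_projection T)"
  unfolding spectral_projection_def by (rule someI_ex[OF spectral_theorem])

lemma resolvent_function_bound:
  assumes "Im z \<noteq> 0"
  shows "cmod (1 / (complex_of_real x - z)) \<le> 1 / \<bar>Im z\<bar>"
proof -
  have "\<bar>Im z\<bar> \<le> cmod (complex_of_real x - z)"
    using abs_Im_le_cmod[of "complex_of_real x - z"] by simp
  then show ?thesis
    using assms unfolding norm_divide by (auto intro!: frac_le)
qed

lemma resolvent_function_bounded_borel:
  assumes "Im z \<noteq> 0"
  shows "(\<lambda>x. 1 / (complex_of_real x - z)) \<in> bounded_borel"
  by (rule bounded_borelI[OF _ resolvent_function_bound[OF assms]]) measurable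

locale selfadjoint_operator =
  fixes T :: "'a::chilbert_space \<rightharpoonup> 'a"
  assumes selfadjoint: "selfadjoint T"
begin

abbreviation spectral_measure :: "'a \<Rightarrow> real measure" where
  "spectral_measure \<equiv> scalar_measure (spectral_projection T)"

lemma projection_valued_measure: "projection_valued_measure (spectral_projection T)"
  and dom_iff: "f \<in> dom T \<longleftrightarrow> integrable (spectral_measure f) (\<lambda>x. x\<^sup>2)"
  and cinner_op_app: "f \<in> dom T \<Longrightarrow> cinner f (op_app T f) = complex_of_real (LINT x|spectral_measure f. x)"
  using spectral_measure_of_spectral_projection[OF selfadjoint] by (auto simp: spectral_measure_of_def)

end

text \<open>The rewrite identifies the abstract calculus with \<open>borel_calculus\<close>; both
  unfold to the same description of an operator by its quadratic form.\<close>

sublocale selfadjoint_operator \<subseteq> spectral_family spectral_measure "(\<lambda>S. indicator S) ` sets borel"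
  rewrites "spectral_family.calculus (scalar_measure (spectral_projection T)) = borel_calculus T"
proof -
  show *: "spectral_family spectral_measure ((\<lambda>S. indicator S) ` sets borel)"
    by (rule spectral_family_projection_valued_measure(1)[OF projection_valued_measure])
  show "spectral_family.calculus (scalar_measure (spectral_projection T)) = borel_calculus T"
    by (simp add: fun_eq_iff spectral_family.calculus_def[OF *] borel_calculus_def represents_def)
qed

context selfadjoint_operator
begin

lemma spectral_projection_eq:
  "S \<in> sets borel \<Longrightarrow> spectral_projection T S = borel_calculus T (indicator S)"
  by (rule calculus_eqI[symmetric])
    (rule spectral_family_projection_valued_measure(2)[OF projection_valued_measure])

lemma integrable_id:
  assumes "f \<in> dom T"
  shows "integrable (spectral_measure f) (\<lambda>x. x)"
proof (rule Bochner_Integration.integrable_bound)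
  show "integrable (spectral_measure f) (\<lambda>x. 1 + x\<^sup>2)"
    using assms dom_iff by (intro Bochner_Integration.integrable_add) auto
  have "\<bar>x\<bar> \<le> 1 + x\<^sup>2" for x :: real
    using zero_le_power2[of "\<bar>x\<bar> - 1"] zero_le_power2[of x] unfolding power2_diff by (simp; linarith)
  then show "AE x in spectral_measure f. norm x \<le> norm (1 + x\<^sup>2)"
    by (intro AE_I2) simp
qed simp

section \<open>Recovering the unbounded operator from bounded truncations\<close>

definition truncated_id :: "nat \<Rightarrow> real \<Rightarrow> complex" where
  "truncated_id n x = complex_of_real (indicator {- real n..real n} x * x)"

lemma truncated_id_bounded_borel: "truncated_id n \<in> bounded_borel"
proof (rule bounded_borelI)
  show "truncated_id n \<in> borel_measurable borel"
    unfolding truncated_id_def[abs_def] by measurable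
  show "cmod (truncated_id n x) \<le> real n" for x
    by (auto simp: truncated_id_def indicator_def)
qed

lemma truncated_id_tendsto: "(\<lambda>n. truncated_id n x) \<longlonglongrightarrow> complex_of_real x"
proof (rule tendsto_eventually)
  obtain N where "\<bar>x\<bar> \<le> real N"
    using real_arch_simple by blast
  then have "truncated_id n x = complex_of_real x" if "n \<ge> N" for n
    using that by (auto simp: truncated_id_def indicator_def)
  then show "\<forall>\<^sub>F n in sequentially. truncated_id n x = complex_of_real x"
    by (auto simp: eventually_sequentially)
qed

text \<open>On the diagonal this is dominated convergence with majorant |x|, integrable for vectors
  of the domain; polarization inside the domain does the rest.\<close>

lemma cinner_truncated_tendsto:
  assumes "f \<in> dom T" "g \<in> dom T"
  shows "(\<lambda>n. cinner f (borel_calculus T (truncated_id n) g)) \<longlonglongrightarrow> cinner f (op_app T g)"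
proof -
  have lin: "linear_operator T"
    by (rule selfadjoint_linear[OF selfadjoint])
  then have D: "csubspace (dom T)"
    by (simp add: linear_operator_def)
  have quad: "(\<lambda>n. cinner h (borel_calculus T (truncated_id n) h)) \<longlonglongrightarrow> cinner h (op_app T h)"
    if h: "h \<in> dom T" for h
    unfolding cinner_calculus[OF truncated_id_bounded_borel] cinner_op_app[OF h] integral_complex_of_real[symmetric]
  proof (rule integral_dominated_convergence)
    show "integrable (spectral_measure h) (\<lambda>x. \<bar>x\<bar>)"
      using integrable_abs[OF integrable_id[OF h]] .
    show "AE x in spectral_measure h. cmod (truncated_id n x) \<le> \<bar>x\<bar>" for n
      by (intro AE_I2) (auto simp: truncated_id_def indicator_def)
  qed (use truncated_id_tendsto bounded_borel_measurable[OF truncated_id_bounded_borel] in auto)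
  have pol: "cinner f (op_app T g) = quadratic_polarization (\<lambda>f. cinner f (op_app T f)) f g"
    by (rule polarization_on[OF D assms]) (use linear_operator_add[OF lin] linear_operator_scaleC[OF lin] in auto)
  have dom: "f + g \<in> dom T" "f - g \<in> dom T" "f + \<i> *\<^sub>C g \<in> dom T" "f - \<i> *\<^sub>C g \<in> dom T"
    using linear_operator_add[OF lin] linear_operator_diff[OF lin] linear_operator_scaleC[OF lin] assms by auto
  show ?thesis
    unfolding pol polarization[OF bounded_clinear_calculus[OF truncated_id_bounded_borel], of f _ g]
      quadratic_polarization_def
    by (intro tendsto_intros quad dom) simp
qed

text \<open>Membership follows from the density |u|^2 of the measure of u(T) f. The value is
  identified by testing against the dense domain and replacing \<open>T\<close> by its
  truncations.\<close>

lemma calculus_in_dom: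
  assumes u: "u \<in> bounded_borel" and xu: "(\<lambda>x. complex_of_real x * u x) \<in> bounded_borel"
  shows "borel_calculus T u f \<in> dom T"
    and "op_app T (borel_calculus T u f) = borel_calculus T (\<lambda>x. complex_of_real x * u x) f"
proof -
  have um [measurable]: "u \<in> borel_measurable borel"
    using u by (rule bounded_borel_measurable)
  have "integrable (spectral_measure f) (\<lambda>x. cnj (complex_of_real x * u x) * (complex_of_real x * u x))"
    by (intro integrable_bounded_borel bounded_borel_mult[OF bounded_borel_cnj[OF xu] xu])
  then have "integrable (spectral_measure f) (\<lambda>x. Re (cnj (complex_of_real x * u x) * (complex_of_real x * u x)))"
    by (rule integrable_Re)
  also have "(\<lambda>x. Re (cnj (complex_of_real x * u x) * (complex_of_real x * u x))) = (\<lambda>x. (cmod (u x))\<^sup>2 * x\<^sup>2)"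
  proof
    fix x
    have "Re (cnj w * w) = (cmod w)\<^sup>2" for w
      unfolding cmod_power2 by (simp add: power2_eq_square)
    then show "Re (cnj (complex_of_real x * u x) * (complex_of_real x * u x)) = (cmod (u x))\<^sup>2 * x\<^sup>2"
      by (simp only: norm_mult power_mult_distrib norm_of_real power2_abs mult.commute)
  qed
  finally show dom: "borel_calculus T u f \<in> dom T"
    unfolding dom_iff family_calculus[OF u] by (subst integrable_density) auto
  show "op_app T (borel_calculus T u f) = borel_calculus T (\<lambda>x. complex_of_real x * u x) f"
  proof (rule cinner_ext_dense[OF selfadjoint_dense[OF selfadjoint]])
    fix h assume h: "h \<in> dom T"
    obtain C where C: "\<And>x. cmod (complex_of_real x * u x) \<le> C"
      using bounded_borelE[OF xu] by blast
    show "cinner h (op_app T (borel_calculus T u f)) = cinner h (borel_calculus T (\<lambda>x. complex_of_real x * u x) f)"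
    proof (rule LIMSEQ_unique)
      show "(\<lambda>n. cinner h (borel_calculus T (truncated_id n) (borel_calculus T u f)))
        \<longlonglongrightarrow> cinner h (op_app T (borel_calculus T u f))"
        by (rule cinner_truncated_tendsto[OF h dom])
      show "(\<lambda>n. cinner h (borel_calculus T (truncated_id n) (borel_calculus T u f)))
        \<longlonglongrightarrow> cinner h (borel_calculus T (\<lambda>x. complex_of_real x * u x) f)"
        unfolding calculus_mult[OF truncated_id_bounded_borel u, symmetric]
      proof (rule calculus_weak_tendsto)
        show "cmod (truncated_id n x * u x) \<le> C" for n x
          using C[of x] order_trans[OF norm_ge_zero C[of x]] by (auto simp: truncated_id_def indicator_def)
      qed (rule bounded_borel_mult[OF truncated_id_bounded_borel u] tendsto_mult_right[OF truncated_id_tendsto])+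
    qed
  qed
qed

lemma calculus_resolvent_function:
  fixes z f
  assumes z: "Im z \<noteq> 0"
  defines "g \<equiv> borel_calculus T (\<lambda>x. 1 / (complex_of_real x - z)) f"
  shows "g \<in> dom T" "op_app T g = f + z *\<^sub>C g"
proof -
  let ?r = "\<lambda>x. 1 / (complex_of_real x - z)"
  have r: "?r \<in> bounded_borel"
    by (rule resolvent_function_bounded_borel[OF z])
  have ne: "complex_of_real x - z \<noteq> 0" for x
    using z by (auto simp: complex_eq_iff)
  have eq: "(\<lambda>x. complex_of_real x * ?r x) = (\<lambda>x. 1 + z * ?r x)"
    using ne by (simp add: fun_eq_iff divide_simps)
  have xr: "(\<lambda>x. complex_of_real x * ?r x) \<in> bounded_borel"
    unfolding eq by (intro bounded_borel_add bounded_borel_const bounded_borel_scale r)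
  show "g \<in> dom T"
    unfolding g_def by (rule calculus_in_dom(1)[OF r xr])
  show "op_app T g = f + z *\<^sub>C g"
    unfolding g_def calculus_in_dom(2)[OF r xr] eq
    using calculus_add[OF bounded_borel_const[of 1] bounded_borel_scale[OF r, of z]]
    by (simp only: calculus_one calculus_scale[OF r])
qed

lemma resolvent_eq:
  assumes z: "Im z \<noteq> 0"
  shows "resolvent T z = borel_calculus T (\<lambda>x. 1 / (complex_of_real x - z))"
proof
  fix f
  define h where "h = borel_calculus T (\<lambda>x. 1 / (complex_of_real x - z)) f"
  have h: "h \<in> dom T" "op_app T h = f + z *\<^sub>C h"
    unfolding h_def by (rule calculus_resolvent_function[OF z])+
  have "resolvent T z f = h"
    unfolding resolvent_def
  proof (rule the_equality)
    show "h \<in> dom T \<and> op_app T h - z *\<^sub>C h = f"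
      using h by simp
    fix g assume g: "g \<in> dom T \<and> op_app T g - z *\<^sub>C g = f"
    define d where "d = g - h"
    have d: "d \<in> dom T" "op_app T d = z *\<^sub>C d"
      using linear_operator_diff[OF selfadjoint_linear[OF selfadjoint], of g h] g h
      by (auto simp: d_def scaleC.diff_right algebra_simps)
    \<comment> \<open>The difference of two solutions satisfies T d = z d; a real quadratic form and
      a nonreal \<open>z\<close> leave only d = 0.\<close>
    have "Im (cinner d (op_app T d)) = 0"
      unfolding cinner_op_app[OF d(1)] by simp
    then have "d = 0"
      using z by (simp add: d(2) cinner_self)
    then show "g = h"
      by (simp add: d_def)
  qed
  then show "resolvent T z f = borel_calculus T (\<lambda>x. 1 / (complex_of_real x - z)) f"
    by (simp only: h_def)
qed

lemma resolvent_in_dom: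
  assumes "Im z \<noteq> 0"
  shows "resolvent T z f \<in> dom T" "op_app T (resolvent T z f) = f + z *\<^sub>C resolvent T z f"
  unfolding resolvent_eq[OF assms] by (rule calculus_resolvent_function[OF assms])+

end

section \<open>Operators of class \<open>C\<^sup>1(A)\<close> and weighted spaces\<close>

text \<open>Baire: the closed sets on which the whole family is bounded by n cover the space, so one
  of them contains a ball.\<close>

lemma uniform_boundedness:
  fixes F :: "nat \<Rightarrow> 'a::banach \<Rightarrow> 'b::real_normed_vector"
  assumes F: "\<And>k. bounded_linear (F k)" and pointwise: "\<And>x. \<exists>C. \<forall>k. norm (F k x) \<le> C"
  shows "\<exists>C. \<forall>k x. norm (F k x) \<le> C * norm x"
proof -
  define S where "S n = {x. \<forall>k. norm (F k x) \<le> real n}" for n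
  have closed: "closed (S n)" for n
    unfolding S_def
    by (intro closed_Collect_all closed_Collect_le continuous_on_norm continuous_on_const
        linear_continuous_on F)
  have UN: "(\<Union>n. S n) = UNIV"
  proof -
    have "\<exists>n. x \<in> S n" for x
    proof -
      obtain C where C: "\<And>k. norm (F k x) \<le> C"
        using pointwise by blast
      obtain n where "C \<le> real n"
        using real_arch_simple by blast
      then have "norm (F k x) \<le> real n" for k
        by (rule order_trans[OF C])
      then show ?thesis
        by (auto simp: S_def)
    qed
    then show ?thesis by auto
  qed
  have "\<exists>n. interior (S n) \<noteq> {}"
  proof (rule ccontr)
    assume "\<nexists>n. interior (S n) \<noteq> {}"
    then have "euclidean interior_of \<Union>(range S) = {}"
      using closed by (intro Baire_category_alt disjI1 completely_metrizable_space_euclidean) auto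
    with UN show False by simp
  qed
  then obtain n x where "x \<in> interior (S n)"
    by blast
  then obtain e where e: "e > 0" "ball x e \<subseteq> S n"
    unfolding mem_interior by blast
  have "norm (F k y) \<le> 4 * real n / e * norm y" for k y
  proof (cases "y = 0")
    case True
    then show ?thesis
      by (simp add: linear_0 bounded_linear.linear[OF F])
  next
    case False
    interpret bounded_linear "F k" by (rule F)
    \<comment> \<open>Scales \<open>y\<close> to length e/2, inside the ball; the bound 2n on the
      scaled value then becomes 4n/e.\<close>
    define c where "c = e / (2 * norm y)"
    have c: "c > 0" "norm (c *\<^sub>R y) < e"
      using e(1) False by (simp_all add: c_def)
    have "x + c *\<^sub>R y \<in> S n" "x \<in> S n"
      using e c(2) by (auto simp: dist_norm)
    then have "norm (F k (x + c *\<^sub>R y)) \<le> real n" "norm (F k x) \<le> real n"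
      by (simp_all add: S_def)
    then have "norm (F k (x + c *\<^sub>R y) - F k x) \<le> 2 * real n"
      using norm_triangle_ineq4[of "F k (x + c *\<^sub>R y)" "F k x"] by linarith
    then have "c * norm (F k y) \<le> 2 * real n"
      using c(1) by (simp add: add scaleR)
    then show ?thesis
      using e(1) False by (simp add: c_def field_simps)
  qed
  then show ?thesis by blast
qed

section \<open>A dyadic description of the weight (1 + x^2)^s\<close>

lemma norm_iexp_minus_1_le: "(cmod (iexp t - 1))\<^sup>2 \<le> t\<^sup>2"
proof -
  have "cmod (iexp t - 1) \<le> \<bar>t\<bar>"
    using iexp_approx1[of t 0] by simp
  then show ?thesis
    using power_mono[of "cmod (iexp t - 1)" "\<bar>t\<bar>" 2] by simp
qed

lemma norm_iexp_minus_1_eq: "(cmod (iexp t - 1))\<^sup>2 = 2 - 2 * cos t"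
proof -
  have "(cmod (iexp t - 1))\<^sup>2 = (cos t - 1)\<^sup>2 + (sin t)\<^sup>2"
    unfolding cmod_power2 cis_conv_exp[symmetric] by simp
  then show ?thesis
    using sin_cos_squared_add[of t] by (simp add: power2_eq_square algebra_simps)
qed

text \<open>The integral of |exp(itx) - 1|^2 t^(-2s-1) dt, sampled at t = 2^-k. Values in
  \<open>ennreal\<close> allow sum and integral to be exchanged without summability
  conditions.\<close>

definition dyadic_weight :: "real \<Rightarrow> real \<Rightarrow> ennreal" where
  "dyadic_weight s x = (\<Sum>k. ennreal ((2 powr (2 * s)) ^ k * (cmod (iexp (x / 2 ^ k) - 1))\<^sup>2))"

lemma real_between_powers:
  fixes b y :: real
  assumes "1 < b" "1 \<le> y"
  obtains m where "b ^ m \<le> y" "y < b ^ Suc m"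
proof -
  obtain n where n: "y < b ^ n"
    using real_arch_pow[OF assms(1)] by blast
  define n0 where "n0 = (LEAST n. y < b ^ n)"
  have n0: "y < b ^ n0"
    unfolding n0_def using n by (rule LeastI)
  then obtain m where m: "n0 = Suc m"
    using assms by (cases n0) auto
  then have "\<not> y < b ^ m"
    unfolding n0_def by (intro not_less_Least) simp
  then show ?thesis
    using that n0 m by (simp add: not_less)
qed

lemma four_power_powr: "(4 ^ m) powr s = (2 powr (2 * s)) ^ m" for s :: real
proof -
  have "(2 powr 2) powr s = 2 powr (2 * s)"
    by (rule powr_powr)
  then have "4 powr s = 2 powr (2 * s)"
    by simp
  moreover have "(4 ^ m) powr s = (4 powr s) ^ m"
    by (simp add: powr_realpow[symmetric] powr_powr mult.commute del: powr_numeral)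
  ultimately show ?thesis by simp
qed

text \<open>The sum is split where 2^k passes the size of x. Low frequencies use |exp - 1|^2 \<le> 4
  and a geometric sum of ratio a > 1, high ones use |exp(it) - 1| \<le> |t| and ratio a/4, which is
  below 1 because s < 1. The two summands of \<open>C\<close> are these two sums.\<close>

lemma dyadic_weight_upper:
  assumes s: "0 < s" "s < 1"
  shows "\<exists>C>0. \<forall>x. dyadic_weight s x \<le> ennreal (C * (1 + x\<^sup>2) powr s)"
proof -
  define a where "a = 2 powr (2 * s)"
  have a: "1 < a" "a < 4"
    using s powr_less_mono[of 0 "2 * s" 2] powr_less_mono[of "2 * s" 2 2] by (simp_all add: a_def)
  define C where "C = a / (1 - a / 4) + 4 * a / (a - 1)"
  have bound: "dyadic_weight s x \<le> ennreal (C * (1 + x\<^sup>2) powr s)" for x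
  proof -
    obtain m where m: "4 ^ m \<le> 1 + x\<^sup>2" "1 + x\<^sup>2 < 4 ^ Suc m"
      using real_between_powers[of 4 "1 + x\<^sup>2"] by auto
    have am: "a ^ m \<le> (1 + x\<^sup>2) powr s"
      unfolding a_def four_power_powr[symmetric] using m(1) s by (intro powr_mono2) auto
    let ?w = "\<lambda>k. a ^ k * (cmod (iexp (x / 2 ^ k) - 1))\<^sup>2"
    have w0: "0 \<le> ?w k" for k
      using a by simp
    have small: "?w k \<le> a ^ k * 4" for k
    proof -
      have "(cmod (iexp (x / 2 ^ k) - 1))\<^sup>2 \<le> 4"
        unfolding norm_iexp_minus_1_eq using cos_ge_minus_one[of "x / 2 ^ k"] by linarith
      then show ?thesis
        using a by (intro mult_left_mono) auto
    qed
    have large: "?w (k + Suc m) \<le> a ^ Suc m * (a / 4) ^ k" for k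
    proof -
      have "(cmod (iexp (x / 2 ^ (k + Suc m)) - 1))\<^sup>2 \<le> (x / 2 ^ (k + Suc m))\<^sup>2"
        by (rule norm_iexp_minus_1_le)
      also have "\<dots> = x\<^sup>2 / 4 ^ (k + Suc m)"
        by (simp add: power_divide power_mult[symmetric] power_even_eq[symmetric] mult.commute
            power_mult_distrib[symmetric] power2_eq_square)
      also have "\<dots> \<le> 4 ^ Suc m / 4 ^ (k + Suc m)"
        using m(2) by (intro divide_right_mono) auto
      also have "\<dots> = 1 / 4 ^ k"
        by (simp add: power_add)
      finally have "?w (k + Suc m) \<le> a ^ (k + Suc m) * (1 / 4 ^ k)"
        using a by (intro mult_left_mono) auto
      then show ?thesis
        by (simp add: power_add power_divide mult_ac)
    qed
    have "(\<Sum>k. ennreal (?w (k + Suc m))) \<le> (\<Sum>k. ennreal (a ^ Suc m * (a / 4) ^ k))"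
      by (intro suminf_le ennreal_leI large summableI)
    also have "\<dots> = ennreal (a ^ Suc m * (1 / (1 - a / 4)))"
      using a by (intro suminf_ennreal_eq sums_mult geometric_sums) auto
    finally have tail: "(\<Sum>k. ennreal (?w (k + Suc m))) \<le> ennreal (a ^ Suc m * (1 / (1 - a / 4)))" .
    have "(\<Sum>k<Suc m. ?w k) \<le> (\<Sum>k<Suc m. a ^ k * 4)"
      by (intro sum_mono small)
    also have "\<dots> = 4 * (\<Sum>k<Suc m. a ^ k)"
      by (simp only: sum_distrib_left mult.commute)
    also have "\<dots> = 4 * ((a ^ Suc m - 1) / (a - 1))"
      using geometric_sum[of a "Suc m"] a by simp
    also have "\<dots> \<le> 4 * (a ^ Suc m / (a - 1))"
      using a by (intro mult_left_mono divide_right_mono) auto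
    finally have head: "(\<Sum>k<Suc m. ennreal (?w k)) \<le> ennreal (4 * (a ^ Suc m / (a - 1)))"
      unfolding sum_ennreal[of "{..<Suc m}" ?w, OF w0] by (rule ennreal_leI)
    have "dyadic_weight s x = (\<Sum>k. ennreal (?w (k + Suc m))) + (\<Sum>k<Suc m. ennreal (?w k))"
      unfolding dyadic_weight_def a_def[symmetric] by (rule suminf_offset[OF summableI])
    also have "\<dots> \<le> ennreal (a ^ Suc m * (1 / (1 - a / 4))) + ennreal (4 * (a ^ Suc m / (a - 1)))"
      by (rule add_mono[OF tail head])
    also have "\<dots> = ennreal (a ^ Suc m * (1 / (1 - a / 4)) + 4 * (a ^ Suc m / (a - 1)))"
      using a by (intro ennreal_plus[symmetric]) auto
    also have "a ^ Suc m * (1 / (1 - a / 4)) + 4 * (a ^ Suc m / (a - 1)) = C * a ^ m"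
      by (simp add: C_def distrib_left mult_ac)
    also have "ennreal (C * a ^ m) \<le> ennreal (C * (1 + x\<^sup>2) powr s)"
      using am a by (intro ennreal_leI mult_left_mono) (auto simp: C_def)
    finally show ?thesis .
  qed
  have "C > 0"
    using a by (simp add: C_def add_pos_pos)
  with bound show ?thesis by blast
qed

text \<open>One term suffices: for |x| \<ge> 1 some k puts |x|/2^k into [1, 2], where 2 - 2 cos
  stays above its value at 1. For |x| < 1 the added constant 1 does the work.\<close>

lemma dyadic_weight_lower:
  assumes s: "0 < s" "s < 1"
  shows "\<exists>C>0. \<forall>x. ennreal ((1 + x\<^sup>2) powr s) \<le> ennreal C * (1 + dyadic_weight s x)"
proof -
  define a where "a = 2 powr (2 * s)"
  have a: "1 < a"
    using s powr_less_mono[of 0 "2 * s" 2] by (simp add: a_def)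
  define \<delta> where "\<delta> = 2 - 2 * cos (1 :: real)"
  have \<delta>: "\<delta> > 0"
    using cos_monotone_0_pi[of 0 1] pi_gt3 by (simp add: \<delta>_def)
  \<comment> \<open>The square of \<open>a\<close> pays for 1 + x^2 \<le> 4^(k + 2); the summand 4
    covers |x| < 1.\<close>
  define C where "C = a ^ 2 / \<delta> + 4"
  have C: "C > 0"
    using a \<delta> by (simp add: C_def add_nonneg_pos)
  have bound: "ennreal ((1 + x\<^sup>2) powr s) \<le> ennreal C * (1 + dyadic_weight s x)" for x
  proof (cases "\<bar>x\<bar> < 1")
    case True
    then have "x\<^sup>2 \<le> 1"
      by (simp add: abs_square_le_1)
    then have "(1 + x\<^sup>2) powr s \<le> 4 powr 1"
      using s by (intro powr_mono_both) auto
    also have "\<dots> \<le> C"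
      using a \<delta> by (simp add: C_def)
    finally have "ennreal ((1 + x\<^sup>2) powr s) \<le> ennreal C * 1"
      by (simp add: ennreal_leI)
    also have "\<dots> \<le> ennreal C * (1 + dyadic_weight s x)"
      by (intro mult_left_mono) auto
    finally show ?thesis .
  next
    case False
    obtain k where k: "2 ^ k \<le> \<bar>x\<bar>" "\<bar>x\<bar> < 2 ^ Suc k"
      using real_between_powers[of 2 "\<bar>x\<bar>"] False by auto
    define \<theta> where "\<theta> = \<bar>x\<bar> / 2 ^ k"
    have \<theta>: "1 \<le> \<theta>" "\<theta> \<le> 2"
      using k by (simp_all add: \<theta>_def field_simps)
    have "cos \<theta> \<le> cos 1"
      using \<theta> pi_gt3 by (intro cos_monotone_0_pi_le) auto
    moreover have "cos (x / 2 ^ k) = cos \<theta>"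
      using cos_abs_real[of "x / 2 ^ k"] by (simp add: \<theta>_def abs_divide)
    ultimately have w: "\<delta> \<le> (cmod (iexp (x / 2 ^ k) - 1))\<^sup>2"
      unfolding norm_iexp_minus_1_eq \<delta>_def by simp
    have "1 + x\<^sup>2 \<le> 4 ^ (k + 2)"
    proof -
      have "x\<^sup>2 \<le> (2 ^ Suc k)\<^sup>2"
        using power_mono[OF less_imp_le[OF k(2)] abs_ge_zero, of 2] by (simp only: power2_abs)
      also have "((2 :: real) ^ Suc k)\<^sup>2 = 4 ^ Suc k"
        unfolding power2_eq_square power_mult_distrib[symmetric] by simp
      finally have "x\<^sup>2 \<le> 4 ^ Suc k" .
      moreover have "(1 :: real) \<le> 4 ^ Suc k" by (rule one_le_power) simp
      ultimately show ?thesis by simp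
    qed
    then have "(1 + x\<^sup>2) powr s \<le> (4 ^ (k + 2)) powr s"
      using s by (intro powr_mono2) auto
    also have "\<dots> = a ^ 2 / \<delta> * (a ^ k * \<delta>)"
      unfolding four_power_powr using \<delta> by (simp add: a_def[symmetric] power_add power2_eq_square)
    also have "\<dots> \<le> a ^ 2 / \<delta> * (a ^ k * (cmod (iexp (x / 2 ^ k) - 1))\<^sup>2)"
      using a \<delta> w by (intro mult_left_mono) auto
    also have "\<dots> \<le> C * (a ^ k * (cmod (iexp (x / 2 ^ k) - 1))\<^sup>2)"
      using a by (intro mult_right_mono) (auto simp: C_def)
    finally have "ennreal ((1 + x\<^sup>2) powr s) \<le> ennreal C * ennreal (a ^ k * (cmod (iexp (x / 2 ^ k) - 1))\<^sup>2)"
      using C a by (simp add: ennreal_leI ennreal_mult[symmetric])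
    also have "\<dots> \<le> ennreal C * dyadic_weight s x"
      unfolding dyadic_weight_def a_def[symmetric]
      using sum_le_suminf[of "\<lambda>k. ennreal (a ^ k * (cmod (iexp (x / 2 ^ k) - 1))\<^sup>2)" "{k}"]
      by (intro mult_left_mono) auto
    also have "\<dots> \<le> ennreal C * (1 + dyadic_weight s x)"
      by (intro mult_left_mono) auto
    finally show ?thesis .
  qed
  with C show ?thesis by blast
qed

lemma japanese_bracket_powr: "japanese_bracket x powr r = (1 + x\<^sup>2) powr (r / 2)"
  by (simp add: japanese_bracket_def powr_powr)

lemma one_plus_square_pos [simp]: "0 < 1 + x\<^sup>2" "1 + x\<^sup>2 \<noteq> 0" for x :: real
  using zero_le_power2[of x] by linarith+

lemma japanese_bracket_powr_le_1: "r \<le> 0 \<Longrightarrow> japanese_bracket x powr r \<le> 1"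
  using powr_mono[of "r / 2" 0 "1 + x\<^sup>2"] by (simp add: japanese_bracket_powr)

lemma japanese_bracket_power_bounded_borel:
  assumes "r \<le> 0"
  shows "(\<lambda>x. complex_of_real (japanese_bracket x powr r)) \<in> bounded_borel"
proof (rule bounded_borelI)
  show "(\<lambda>x. complex_of_real (japanese_bracket x powr r)) \<in> borel_measurable borel"
    unfolding japanese_bracket_def by measurable
  show "cmod (complex_of_real (japanese_bracket x powr r)) \<le> 1" for x
    using japanese_bracket_powr_le_1[OF assms] by simp
qed

lemma norm_japanese_bracket_power:
  "(cmod (complex_of_real (japanese_bracket x powr r)))\<^sup>2 = (1 + x\<^sup>2) powr r"
  by (simp add: japanese_bracket_powr powr_add[symmetric] power2_eq_square)

lemma japanese_bracket_ne_0: "complex_of_real (japanese_bracket x powr r) \<noteq> 0"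
  by (simp add: japanese_bracket_def)

context selfadjoint_operator
begin

lemma character_bounded_borel: "(\<lambda>x. exp (\<i> * complex_of_real (t * x))) \<in> bounded_borel"
  by (rule bounded_borelI[where C = 1]) auto

lemma bounded_clinear_unitary_group: "bounded_clinear (unitary_group T t)"
  unfolding unitary_group_def by (rule bounded_clinear_calculus[OF character_bounded_borel])

lemma norm_unitary_group_le: "norm (unitary_group T t f) \<le> norm f"
  unfolding unitary_group_def
  using norm_calculus_le[OF character_bounded_borel, of t 1] by simp

lemma unitary_group_zero: "unitary_group T 0 f = f"
  unfolding unitary_group_def by (simp add: calculus_one)

lemma unitary_group_inverse: "unitary_group T (- t) (unitary_group T t f) = f"
  unfolding unitary_group_def calculus_mult[OF character_bounded_borel character_bounded_borel, symmetric]
  by (simp add: exp_add[symmetric] calculus_one)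

text \<open>For each vector the difference quotients at t = 2^-k converge, hence are bounded;
  uniform boundedness upgrades this to a Lipschitz bound in operator norm along dyadic
  times.\<close>

lemma class_C1_dyadic_bound:
  assumes B: "B \<in> class_C1 T"
  shows "\<exists>C. \<forall>k f. norm (unitary_group T (1 / 2 ^ k) (B (unitary_group T (- (1 / 2 ^ k)) f)) - B f)
    \<le> C / 2 ^ k * norm f"
proof -
  let ?U = "unitary_group T"
  have Bb: "bounded_clinear B"
    using B by (simp add: class_C1_def)
  define F where "F k f = 2 ^ k *\<^sub>R (?U (1 / 2 ^ k) (B (?U (- (1 / 2 ^ k)) f)) - B f)" for k :: nat and f
  have "\<exists>C. \<forall>k f. norm (F k f) \<le> C * norm f"
  proof (rule uniform_boundedness)
    show "bounded_linear (F k)" for k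
      unfolding F_def[abs_def]
      by (intro bounded_linear_compose[OF bounded_linear_scaleR_right] bounded_linear_sub
          bounded_clinear_bounded_linear[OF Bb]
          bounded_clinear_bounded_linear[OF bounded_clinear_compose[OF bounded_clinear_unitary_group
            bounded_clinear_compose[OF Bb bounded_clinear_unitary_group]]])
    show "\<exists>C. \<forall>k. norm (F k f) \<le> C" for f
    proof -
      let ?g = "\<lambda>t. ?U t (B (?U (- t) f))"
      obtain D where D: "(?g has_vector_derivative D) (at 0)"
        using B unfolding class_C1_def C1_differentiable_on_def by blast
      have lim: "((\<lambda>h. norm (?g (0 + h) - ?g 0 - h *\<^sub>R D) / norm h) \<longlongrightarrow> 0) (at 0)"
        using D unfolding has_vector_derivative_def has_derivative_at by blast
      have "(\<lambda>k. 1 / 2 ^ k :: real) \<longlonglongrightarrow> 0"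
        by real_asymp
      then have "filterlim (\<lambda>k. 1 / 2 ^ k :: real) (at 0) sequentially"
        by (simp add: filterlim_at)
      from filterlim_compose[OF lim this]
      have "(\<lambda>k. norm (?g (1 / 2 ^ k) - ?g 0 - (1 / 2 ^ k) *\<^sub>R D) / norm (1 / 2 ^ k :: real)) \<longlonglongrightarrow> 0"
        by simp
      moreover have "norm (?g (1 / 2 ^ k) - ?g 0 - (1 / 2 ^ k) *\<^sub>R D) / norm (1 / 2 ^ k :: real) = norm (F k f - D)" for k
      proof -
        have "F k f - D = 2 ^ k *\<^sub>R (?g (1 / 2 ^ k) - ?g 0 - (1 / 2 ^ k) *\<^sub>R D)"
          by (simp add: F_def unitary_group_zero scaleR_diff_right)
        then show ?thesis
          by simp
      qed
      ultimately have "(\<lambda>k. F k f - D) \<longlonglongrightarrow> 0"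
        by (simp add: tendsto_norm_zero_iff)
      then have "(\<lambda>k. F k f) \<longlonglongrightarrow> D"
        by (rule LIM_zero_cancel)
      then have "Bseq (\<lambda>k. F k f)"
        by (rule convergentI[THEN convergent_imp_Bseq])
      then show ?thesis
        unfolding Bseq_def by blast
    qed
  qed
  then obtain C where C: "\<And>k f. norm (F k f) \<le> C * norm f"
    by blast
  have "norm (?U (1 / 2 ^ k) (B (?U (- (1 / 2 ^ k)) f)) - B f) \<le> C / 2 ^ k * norm f" for k f
    using C[of k f] unfolding F_def norm_scaleR by (simp add: field_simps)
  then show ?thesis by blast
qed

text \<open>The integral of |exp(itx) - 1|^2 against the measure of \<open>f\<close> is the squared
  norm of U_t f - f.\<close>

lemma nn_integral_dyadic_weight:
  "(\<integral>\<^sup>+x. dyadic_weight s x \<partial>spectral_measure f)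
    = (\<Sum>k. ennreal ((2 powr (2 * s)) ^ k * (norm (unitary_group T (1 / 2 ^ k) f - f))\<^sup>2))"
proof -
  let ?w = "\<lambda>k x. iexp (x / 2 ^ k) - 1"
  have iexp: "(\<lambda>x. iexp (x / 2 ^ k)) = (\<lambda>x. exp (\<i> * complex_of_real (1 / 2 ^ k * x)))" for k
    by simp
  have b: "(\<lambda>x. iexp (x / 2 ^ k)) \<in> bounded_borel" for k
    unfolding iexp by (rule character_bounded_borel)
  have w: "?w k \<in> bounded_borel" for k
    using bounded_borel_add[OF b bounded_borel_const[of "-1"], of k] by simp
  have calc: "borel_calculus T (?w k) f = unitary_group T (1 / 2 ^ k) f - f" for k
    unfolding calculus_diff[OF b bounded_borel_const] calculus_one unitary_group_def iexp ..
  have "(\<integral>\<^sup>+x. dyadic_weight s x \<partial>spectral_measure f)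
    = (\<Sum>k. \<integral>\<^sup>+x. ennreal ((2 powr (2 * s)) ^ k * (cmod (?w k x))\<^sup>2) \<partial>spectral_measure f)"
    unfolding dyadic_weight_def by (rule nn_integral_suminf) simp
  moreover have "(\<integral>\<^sup>+x. ennreal ((2 powr (2 * s)) ^ k * (cmod (?w k x))\<^sup>2) \<partial>spectral_measure f)
    = ennreal ((2 powr (2 * s)) ^ k * (norm (unitary_group T (1 / 2 ^ k) f - f))\<^sup>2)" for k
  proof -
    have "integrable (spectral_measure f) (\<lambda>x. (cmod (?w k x))\<^sup>2)"
    proof (rule integrable_const_bound[of _ 4])
      show "AE x in spectral_measure f. norm ((cmod (?w k x))\<^sup>2) \<le> 4"
      proof (rule AE_I2)
        fix x
        show "norm ((cmod (?w k x))\<^sup>2) \<le> 4"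
          unfolding norm_iexp_minus_1_eq using cos_ge_minus_one[of "x / 2 ^ k"] cos_le_one[of "x / 2 ^ k"]
          unfolding real_norm_def by linarith
      qed
    qed simp
    then show ?thesis
      unfolding calc[symmetric] norm_calculus[OF w]
      by (subst nn_integral_eq_integral) auto
  qed
  ultimately show ?thesis
    by simp
qed

lemma measurable_dyadic_weight [measurable]: "dyadic_weight s \<in> borel_measurable borel"
  unfolding dyadic_weight_def[abs_def] by measurable

text \<open>Since \<open>(1 + x\<^sup>2)\<^sup>s\<close> is comparable to \<open>1 + \<Sum>k. 4 powr (k s) * \<bar>exp (i x / 2 ^ k) - 1\<bar>\<^sup>2\<close>, the norm of
  \<open>\<langle>T\<rangle>\<^sup>s g\<close> is controlled by the increments of the unitary group along dyadic times, to which the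
  Lipschitz bound on \<open>t \<mapsto> exp (i t T) B exp (-i t T)\<close> applies.\<close>

lemma class_C1_weighted_bounded:
  assumes B: "B \<in> class_C1 T" and s: "0 < s" "s < 1"
  shows "\<exists>C. \<forall>h. \<exists>k. B (bracket_power T (- s) h) = bracket_power T (- s) k \<and> norm k \<le> C * norm h"
proof -
  let ?U = "unitary_group T" and ?\<mu> = "spectral_measure"
  let ?J = "\<lambda>x. complex_of_real (japanese_bracket x powr (- s))"
  have J: "?J \<in> bounded_borel"
    using s by (intro japanese_bracket_power_bounded_borel) simp
  have Bb: "bounded_clinear B"
    using B by (simp add: class_C1_def)
  obtain M where M: "M > 0" "\<And>f. norm (B f) \<le> norm f * M"
    using bounded_linear.pos_bounded[OF bounded_clinear_bounded_linear[OF Bb]] by blast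
  obtain K where K: "\<And>k f. norm (?U (1 / 2 ^ k) (B (?U (- (1 / 2 ^ k)) f)) - B f) \<le> K / 2 ^ k * norm f"
    using class_C1_dyadic_bound[OF B] by blast
  obtain Cu where Cu: "Cu > 0" "\<And>x. dyadic_weight s x \<le> ennreal (Cu * (1 + x\<^sup>2) powr s)"
    using dyadic_weight_upper[OF s] by blast
  obtain Cl where Cl: "Cl > 0" "\<And>x. ennreal ((1 + x\<^sup>2) powr s) \<le> ennreal Cl * (1 + dyadic_weight s x)"
    using dyadic_weight_lower[OF s] by blast
  define a where "a = 2 powr (2 * s)"
  have a: "1 < a" "a < 4"
    using s powr_less_mono[of 0 "2 * s" 2] powr_less_mono[of "2 * s" 2 2] by (simp_all add: a_def)
  define W where "W k f = ?U (1 / 2 ^ k) f - f" for k :: nat and f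
  have increment: "(norm (W k (B f)))\<^sup>2 \<le> 2 * K\<^sup>2 * (1 / 4) ^ k * (norm f)\<^sup>2 + 2 * M\<^sup>2 * (norm (W k f))\<^sup>2" for k f
  proof -
    let ?t = "1 / 2 ^ k :: real"
    \<comment> \<open>Inserting B U_t f splits the increment into (U_t B U_-t - B) U_t f, small of
      order 2^-k, and \<open>B\<close> applied to the increment of \<open>f\<close>.\<close>
    have "W k (B f) = (?U ?t (B (?U (- ?t) (?U ?t f))) - B (?U ?t f)) + B (W k f)"
      unfolding W_def unitary_group_inverse by (simp add: bounded_clinear_diff[OF Bb])
    then have "norm (W k (B f)) \<le> norm (?U ?t (B (?U (- ?t) (?U ?t f))) - B (?U ?t f)) + norm (B (W k f))"
      by (metis norm_triangle_ineq)
    also have "\<dots> \<le> \<bar>K\<bar> / 2 ^ k * norm f + M * norm (W k f)"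
    proof (rule add_mono)
      have "norm (?U ?t (B (?U (- ?t) (?U ?t f))) - B (?U ?t f)) \<le> K / 2 ^ k * norm (?U ?t f)"
        by (rule K)
      also have "\<dots> \<le> \<bar>K\<bar> / 2 ^ k * norm f"
        by (intro mult_mono divide_right_mono norm_unitary_group_le) auto
      finally show "norm (?U ?t (B (?U (- ?t) (?U ?t f))) - B (?U ?t f)) \<le> \<bar>K\<bar> / 2 ^ k * norm f" .
      show "norm (B (W k f)) \<le> M * norm (W k f)"
        using M(2)[of "W k f"] by (simp add: mult.commute)
    qed
    finally have "(norm (W k (B f)))\<^sup>2 \<le> (\<bar>K\<bar> / 2 ^ k * norm f + M * norm (W k f))\<^sup>2"
      by (intro power_mono) auto
    also have "\<dots> \<le> 2 * (\<bar>K\<bar> / 2 ^ k * norm f)\<^sup>2 + 2 * (M * norm (W k f))\<^sup>2"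
      using sum_squares_bound[of "\<bar>K\<bar> / 2 ^ k * norm f" "M * norm (W k f)"] by (simp add: power2_sum)
    also have "(\<bar>K\<bar> / 2 ^ k * norm f)\<^sup>2 = K\<^sup>2 * (1 / 4) ^ k * (norm f)\<^sup>2"
    proof -
      have "((2 :: real) ^ k)\<^sup>2 = 4 ^ k"
        unfolding power2_eq_square power_mult_distrib[symmetric] by simp
      then show ?thesis
        by (simp add: power_mult_distrib power_divide)
    qed
    finally show ?thesis
      by (simp add: power_mult_distrib mult.assoc)
  qed
  \<comment> \<open>The decay (1/4)^k of the squared Lipschitz term against the weight a^k gives a
    geometric series of ratio a/4, convergent because s < 1.\<close>
  define L where "L = 2 * K\<^sup>2 / (1 - a / 4)"
  define C2 where "C2 = Cl * (M\<^sup>2 + (L + 2 * M\<^sup>2 * Cu))"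
  have L: "L \<ge> 0"
    using a by (simp add: L_def)
  have weighted: "(\<integral>\<^sup>+x. ennreal ((1 + x\<^sup>2) powr s) \<partial>?\<mu> (B (bracket_power T (- s) h))) \<le> ennreal (C2 * (norm h)\<^sup>2)" for h
  proof -
    define f where "f = bracket_power T (- s) h"
    have nf: "norm f \<le> norm h"
      unfolding f_def bracket_power_def
      using norm_calculus_le[OF J, of 1 h] japanese_bracket_powr_le_1[of "- s"] s by simp
    then have nf2: "(norm f)\<^sup>2 \<le> (norm h)\<^sup>2"
      by (intro power_mono) auto
    have "(\<integral>\<^sup>+x. ennreal ((1 + x\<^sup>2) powr s) \<partial>?\<mu> f)
      = (\<integral>\<^sup>+x. ennreal ((1 + x\<^sup>2) powr (- s)) * ennreal ((1 + x\<^sup>2) powr s) \<partial>?\<mu> h)"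
      unfolding f_def bracket_power_def family_calculus[OF J] norm_japanese_bracket_power
      by (subst nn_integral_density) auto
    also have "\<dots> = (\<integral>\<^sup>+x. 1 \<partial>?\<mu> h)"
    proof (rule nn_integral_cong)
      fix x :: real
      have "(1 + x\<^sup>2) powr (- s) * (1 + x\<^sup>2) powr s = 1"
        by (simp add: powr_add[symmetric])
      then show "ennreal ((1 + x\<^sup>2) powr (- s)) * ennreal ((1 + x\<^sup>2) powr s) = 1"
        by (simp add: ennreal_mult[symmetric])
    qed
    also have "\<dots> = ennreal ((norm h)\<^sup>2)"
      by (simp add: mass)
    finally have wf: "(\<integral>\<^sup>+x. ennreal ((1 + x\<^sup>2) powr s) \<partial>?\<mu> f) = ennreal ((norm h)\<^sup>2)" .
    have "(\<integral>\<^sup>+x. dyadic_weight s x \<partial>?\<mu> f) \<le> (\<integral>\<^sup>+x. ennreal Cu * ennreal ((1 + x\<^sup>2) powr s) \<partial>?\<mu> f)"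
      using Cu by (intro nn_integral_mono) (simp add: ennreal_mult[symmetric])
    also have "\<dots> = ennreal Cu * ennreal ((norm h)\<^sup>2)"
      by (subst nn_integral_cmult) (auto simp: wf)
    finally have df: "(\<integral>\<^sup>+x. dyadic_weight s x \<partial>?\<mu> f) \<le> ennreal (Cu * (norm h)\<^sup>2)"
      using Cu(1) by (simp add: ennreal_mult)
    have "(\<integral>\<^sup>+x. dyadic_weight s x \<partial>?\<mu> (B f)) = (\<Sum>k. ennreal (a ^ k * (norm (W k (B f)))\<^sup>2))"
      unfolding nn_integral_dyadic_weight W_def a_def ..
    also have "\<dots> \<le> (\<Sum>k. ennreal (2 * K\<^sup>2 * (norm f)\<^sup>2 * (a / 4) ^ k) + ennreal (2 * M\<^sup>2) * ennreal (a ^ k * (norm (W k f))\<^sup>2))"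
    proof (intro suminf_le summableI)
      fix k
      have "a ^ k * (norm (W k (B f)))\<^sup>2 \<le> a ^ k * (2 * K\<^sup>2 * (1 / 4) ^ k * (norm f)\<^sup>2 + 2 * M\<^sup>2 * (norm (W k f))\<^sup>2)"
        using a increment by (intro mult_left_mono) auto
      also have "\<dots> = 2 * K\<^sup>2 * (norm f)\<^sup>2 * (a / 4) ^ k + 2 * M\<^sup>2 * (a ^ k * (norm (W k f))\<^sup>2)"
        by (simp add: power_divide distrib_left mult_ac)
      finally have "ennreal (a ^ k * (norm (W k (B f)))\<^sup>2)
        \<le> ennreal (2 * K\<^sup>2 * (norm f)\<^sup>2 * (a / 4) ^ k + 2 * M\<^sup>2 * (a ^ k * (norm (W k f))\<^sup>2))"
        by (rule ennreal_leI)
      also have "\<dots> = ennreal (2 * K\<^sup>2 * (norm f)\<^sup>2 * (a / 4) ^ k) + ennreal (2 * M\<^sup>2 * (a ^ k * (norm (W k f))\<^sup>2))"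
        by (rule ennreal_plus) (use a in auto)
      also have "ennreal (2 * M\<^sup>2 * (a ^ k * (norm (W k f))\<^sup>2)) = ennreal (2 * M\<^sup>2) * ennreal (a ^ k * (norm (W k f))\<^sup>2)"
        by (rule ennreal_mult) (use a in auto)
      finally show "ennreal (a ^ k * (norm (W k (B f)))\<^sup>2)
        \<le> ennreal (2 * K\<^sup>2 * (norm f)\<^sup>2 * (a / 4) ^ k) + ennreal (2 * M\<^sup>2) * ennreal (a ^ k * (norm (W k f))\<^sup>2)" .
    qed
    also have "\<dots> = (\<Sum>k. ennreal (2 * K\<^sup>2 * (norm f)\<^sup>2 * (a / 4) ^ k)) + ennreal (2 * M\<^sup>2) * (\<Sum>k. ennreal (a ^ k * (norm (W k f))\<^sup>2))"
      by (simp add: suminf_add[symmetric])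
    also have "(\<Sum>k. ennreal (2 * K\<^sup>2 * (norm f)\<^sup>2 * (a / 4) ^ k)) = ennreal (2 * K\<^sup>2 * (norm f)\<^sup>2 * (1 / (1 - a / 4)))"
      using a by (intro suminf_ennreal_eq sums_mult geometric_sums) auto
    also have "(\<Sum>k. ennreal (a ^ k * (norm (W k f))\<^sup>2)) = (\<integral>\<^sup>+x. dyadic_weight s x \<partial>?\<mu> f)"
      unfolding nn_integral_dyadic_weight W_def a_def ..
    also have "ennreal (2 * K\<^sup>2 * (norm f)\<^sup>2 * (1 / (1 - a / 4))) + ennreal (2 * M\<^sup>2) * (\<integral>\<^sup>+x. dyadic_weight s x \<partial>?\<mu> f)
      \<le> ennreal (L * (norm h)\<^sup>2) + ennreal (2 * M\<^sup>2) * ennreal (Cu * (norm h)\<^sup>2)"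
    proof (intro add_mono mult_left_mono df ennreal_leI)
      have "2 * K\<^sup>2 * (norm f)\<^sup>2 * (1 / (1 - a / 4)) = L * (norm f)\<^sup>2"
        by (simp add: L_def)
      also have "\<dots> \<le> L * (norm h)\<^sup>2"
        by (intro mult_left_mono nf2 L)
      finally show "2 * K\<^sup>2 * (norm f)\<^sup>2 * (1 / (1 - a / 4)) \<le> L * (norm h)\<^sup>2" .
    qed simp
    also have "\<dots> = ennreal ((L + 2 * M\<^sup>2 * Cu) * (norm h)\<^sup>2)"
      using L Cu(1) by (simp add: ennreal_mult[symmetric] ennreal_plus[symmetric] algebra_simps del: ennreal_plus)
    finally have dBf: "(\<integral>\<^sup>+x. dyadic_weight s x \<partial>?\<mu> (B f)) \<le> ennreal ((L + 2 * M\<^sup>2 * Cu) * (norm h)\<^sup>2)" .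
    have nBf: "(norm (B f))\<^sup>2 \<le> M\<^sup>2 * (norm h)\<^sup>2"
    proof -
      have "norm (B f) \<le> M * norm h"
        using order_trans[OF M(2)[of f] mult_right_mono[OF nf, of M]] M(1) by (simp add: mult.commute)
      then have "(norm (B f))\<^sup>2 \<le> (M * norm h)\<^sup>2"
        by (intro power_mono) auto
      then show ?thesis
        by (simp add: power_mult_distrib)
    qed
    have "(\<integral>\<^sup>+x. ennreal ((1 + x\<^sup>2) powr s) \<partial>?\<mu> (B f)) \<le> (\<integral>\<^sup>+x. ennreal Cl * (1 + dyadic_weight s x) \<partial>?\<mu> (B f))"
      by (intro nn_integral_mono Cl(2))
    also have "\<dots> = ennreal Cl * (ennreal ((norm (B f))\<^sup>2) + (\<integral>\<^sup>+x. dyadic_weight s x \<partial>?\<mu> (B f)))"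
      by (subst nn_integral_cmult) (auto simp: nn_integral_add mass)
    also have "\<dots> \<le> ennreal Cl * (ennreal (M\<^sup>2 * (norm h)\<^sup>2) + ennreal ((L + 2 * M\<^sup>2 * Cu) * (norm h)\<^sup>2))"
      by (intro mult_left_mono add_mono dBf ennreal_leI nBf) simp
    also have "\<dots> = ennreal (C2 * (norm h)\<^sup>2)"
      using L Cu(1) Cl(1)
      by (simp add: C2_def ennreal_mult[symmetric] ennreal_plus[symmetric] algebra_simps del: ennreal_plus)
    finally show ?thesis
      unfolding f_def .
  qed
  have C2: "C2 \<ge> 0"
    using L Cu(1) Cl(1) by (simp add: C2_def)
  \<comment> \<open>A finite weighted integral places the vector in the range of <T>^-s, and the
    squared norm of the preimage is that integral.\<close>
  have "\<exists>k. B (bracket_power T (- s) h) = bracket_power T (- s) k \<and> norm k \<le> sqrt C2 * norm h" for h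
  proof -
    let ?g = "B (bracket_power T (- s) h)"
    have inv: "1 / (cmod (?J x))\<^sup>2 = (1 + x\<^sup>2) powr s" for x
      unfolding norm_japanese_bracket_power by (simp add: powr_minus divide_inverse)
    have "(\<integral>\<^sup>+x. ennreal (norm ((1 + x\<^sup>2) powr s)) \<partial>?\<mu> ?g) < \<infinity>"
      using weighted[of h] by (simp add: le_less_trans)
    then have int: "integrable (?\<mu> ?g) (\<lambda>x. (1 + x\<^sup>2) powr s)"
      by (intro integrableI_bounded) auto
    then obtain k where k: "borel_calculus T ?J k = ?g" "(norm k)\<^sup>2 = (LINT x|?\<mu> ?g. (1 + x\<^sup>2) powr s)"
      using calculus_surjective[OF J japanese_bracket_ne_0, of ?g] unfolding inv by blast
    have "ennreal ((norm k)\<^sup>2) \<le> ennreal (C2 * (norm h)\<^sup>2)"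
      using weighted[of h] unfolding k(2) by (subst nn_integral_eq_integral[OF int, symmetric]) auto
    then have "(norm k)\<^sup>2 \<le> C2 * (norm h)\<^sup>2"
      using C2 by (simp add: ennreal_le_iff)
    then have "(norm k)\<^sup>2 \<le> (sqrt C2 * norm h)\<^sup>2"
      using C2 by (simp add: power_mult_distrib)
    then have "norm k \<le> sqrt C2 * norm h"
      by (rule power2_le_imp_le) (simp add: C2)
    then show ?thesis
      using k(1) unfolding bracket_power_def by metis
  qed
  then show ?thesis by blast
qed

end

section \<open>Bump functions\<close>

definition bump_quadratic :: "real \<Rightarrow> real \<Rightarrow> real poly" where
  "bump_quadratic c d = [:- (c * d), c + d, -1:]"

text \<open>A family closed under differentiation: with q = (x - c)(d - x), the derivative of p q^-k
  exp(-1/q) has the same form with k + 2 and the numerator \<open>bump_pderiv\<close>. Smoothness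
  becomes an induction on the order.\<close>

definition bump :: "real \<Rightarrow> real \<Rightarrow> real poly \<Rightarrow> nat \<Rightarrow> real \<Rightarrow> real" where
  "bump c d p k x = (if c < x \<and> x < d
     then poly p x / poly (bump_quadratic c d) x ^ k * exp (- 1 / poly (bump_quadratic c d) x) else 0)"

definition bump_pderiv :: "real \<Rightarrow> real \<Rightarrow> real poly \<Rightarrow> nat \<Rightarrow> real poly" where
  "bump_pderiv c d p k = (let q = bump_quadratic c d in
     pderiv p * q ^ 2 - smult (real k) (p * pderiv q * q) + p * pderiv q)"

lemma poly_bump_quadratic: "poly (bump_quadratic c d) x = (x - c) * (d - x)"
  by (simp add: bump_quadratic_def algebra_simps)

lemma power_le_exp: "t ^ n \<le> real n ^ n * exp t" if "0 \<le> t" "0 < n" for t :: real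
proof -
  have "(t / real n) ^ n \<le> (1 + t / real n) ^ n"
    using that by (intro power_mono) auto
  also have "\<dots> \<le> exp t"
    using that by (intro exp_ge_one_plus_x_over_n_power_n) auto
  finally show ?thesis
    using that by (simp add: power_divide field_simps)
qed

text \<open>The factor exp(-1/q) beats every power of q. The power k + 2 is used: k cancels the
  denominator, and the remaining 2 makes the function flat at the endpoints.\<close>

lemma bump_quadratic_bound:
  "\<exists>C. \<forall>x. c < x \<longrightarrow> x < d \<longrightarrow> \<bar>bump c d p k x\<bar> \<le> C * (poly (bump_quadratic c d) x)\<^sup>2"
proof -
  have "compact (poly p ` {c..d})"
    by (intro compact_continuous_image continuous_intros) auto
  from compact_imp_bounded[OF this]
  obtain P where "\<forall>y\<in>poly p ` {c..d}. norm y \<le> P"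
    unfolding bounded_iff by blast
  then have P: "\<bar>poly p x\<bar> \<le> P" if "x \<in> {c..d}" for x
    using that by auto
  let ?n = "k + 2"
  have "\<bar>bump c d p k x\<bar> \<le> (P * real ?n ^ ?n) * (poly (bump_quadratic c d) x)\<^sup>2" if x: "c < x" "x < d" for x
  proof -
    define q where "q = poly (bump_quadratic c d) x"
    have q: "q > 0"
      using x by (simp add: q_def poly_bump_quadratic)
    have "(1 / q) ^ ?n \<le> real ?n ^ ?n * exp (1 / q)"
      using q by (intro power_le_exp) auto
    then have "1 \<le> real ?n ^ ?n * exp (1 / q) * q ^ ?n"
      using q by (simp add: power_divide divide_le_eq)
    moreover have "exp (- 1 / q) = 1 / exp (1 / q)"
      by (simp add: exp_minus divide_inverse)
    moreover have "1 / E \<le> N * Q" if "1 \<le> N * E * Q" "E > 0" for E N Q :: real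
      using that by (simp add: divide_le_eq mult_ac)
    ultimately have "exp (- 1 / q) \<le> real ?n ^ ?n * q ^ ?n"
      by (metis exp_gt_zero)
    moreover have "0 \<le> P"
      using order_trans[OF abs_ge_zero P[of x]] x by simp
    ultimately have "\<bar>poly p x\<bar> / q ^ k * exp (- 1 / q) \<le> P / q ^ k * (real ?n ^ ?n * q ^ ?n)"
      using q P[of x] x by (intro mult_mono divide_right_mono) auto
    also have "\<dots> = P * real ?n ^ ?n * q\<^sup>2"
    proof -
      have "P / G * (N * (G * Q)) = P * N * Q" if "G \<noteq> 0" for G N Q :: real
        using that by simp
      from this[of "q ^ k" "real ?n ^ ?n" "q\<^sup>2"] show ?thesis
        using q by (simp only: power_add) simp
    qed
    finally show ?thesis
      using x q by (simp add: bump_def q_def[symmetric] abs_mult)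
  qed
  then show ?thesis by blast
qed

lemma bump_derivative_identity:
  fixes g g' p p' e :: real
  assumes g: "g \<noteq> 0"
  shows "(p' * g ^ k - p * (real k * (g' * g ^ (k - Suc 0)))) / (g ^ k * g ^ k) * e + e * (g' / g\<^sup>2) * (p / g ^ k)
    = (p' * g\<^sup>2 - real k * (p * g' * g) + p * g') / g ^ (k + 2) * e"
proof (cases k)
  case 0
  then show ?thesis
    using g by (simp add: field_simps power2_eq_square)
next
  case (Suc j)
  define G where "G = g ^ j"
  have "G \<noteq> 0"
    using g by (simp add: G_def)
  moreover have "g ^ k = g * G" "g ^ (k - Suc 0) = G" "g ^ (k + 2) = g * g * g * G"
    by (simp_all add: Suc G_def power2_eq_square mult_ac)
  ultimately show ?thesis
    using g by (simp add: field_simps power2_eq_square)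
qed

lemma bump_has_real_derivative:
  assumes cd: "c < d"
  shows "(bump c d p k has_real_derivative bump c d (bump_pderiv c d p k) (k + 2) x) (at x)"
proof -
  consider "c < x" "x < d" | "x < c \<or> d < x" | "x = c \<or> x = d"
    by linarith
  then show ?thesis
  proof cases
    case 1
    define Q where "Q = bump_quadratic c d"
    have Q: "poly Q y > 0" if "y \<in> {c<..<d}" for y
      using that by (simp add: Q_def poly_bump_quadratic)
    have ne: "poly Q x \<noteq> 0"
      using Q[of x] 1 by auto
    have "((\<lambda>y. exp (- 1 / poly Q y)) has_real_derivative
        exp (- 1 / poly Q x) * (poly (pderiv Q) x / (poly Q x)\<^sup>2)) (at x)"
    proof -
      have "((\<lambda>y. - 1 / poly Q y) has_real_derivative (0 * poly Q x - (- 1) * poly (pderiv Q) x) / (poly Q x * poly Q x)) (at x)"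
        by (rule DERIV_divide[OF DERIV_const poly_DERIV ne])
      from DERIV_chain2[OF DERIV_exp this] show ?thesis
        by (simp add: power2_eq_square)
    qed
    from DERIV_mult[OF DERIV_divide[OF poly_DERIV[of p x] DERIV_power[OF poly_DERIV[of Q x], of k]] this]
    have "((\<lambda>y. poly p y / poly Q y ^ k * exp (- 1 / poly Q y)) has_real_derivative
      bump c d (bump_pderiv c d p k) (k + 2) x) (at x)"
      using bump_derivative_identity[OF ne, of "poly (pderiv p) x" k "poly p x" "poly (pderiv Q) x" "exp (- 1 / poly Q x)"] ne 1
      by (simp add: bump_def bump_pderiv_def Q_def[symmetric] Let_def)
    then show ?thesis
      by (rule has_field_derivative_transform_within_open[where S = "{c<..<d}"])
        (use 1 in \<open>auto simp: bump_def Q_def\<close>)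
  next
    case 2
    have "((\<lambda>_. 0) has_real_derivative 0) (at x)"
      by simp
    then have "(bump c d p k has_real_derivative 0) (at x)"
      by (rule has_field_derivative_transform_within_open[where S = "{..<c} \<union> {d<..}"])
        (use 2 cd in \<open>auto simp: bump_def\<close>)
    then show ?thesis
      using 2 by (auto simp: bump_def)
  next
    case 3
    obtain C where C: "\<And>y. c < y \<Longrightarrow> y < d \<Longrightarrow> \<bar>bump c d p k y\<bar> \<le> C * (poly (bump_quadratic c d) y)\<^sup>2"
      using bump_quadratic_bound by blast
    \<comment> \<open>At either endpoint x one has |q(y)| \<le> (d - c) |y - x|, so the function is
      at most K (y - x)^2 and its difference quotient tends to 0.\<close>
    define K where "K = \<bar>C\<bar> * (d - c)\<^sup>2"
    have bound: "\<bar>bump c d p k y\<bar> \<le> K * (y - x)\<^sup>2" for y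
    proof (cases "c < y \<and> y < d")
      case True
      have "\<bar>poly (bump_quadratic c d) y\<bar> \<le> (d - c) * \<bar>y - x\<bar>"
        unfolding poly_bump_quadratic using 3
      proof
        assume "x = c"
        then have "\<bar>(y - c) * (d - y)\<bar> = (d - y) * \<bar>y - x\<bar>"
          using True by (simp add: abs_mult)
        also have "\<dots> \<le> (d - c) * \<bar>y - x\<bar>"
          using True by (intro mult_right_mono) auto
        finally show "\<bar>(y - c) * (d - y)\<bar> \<le> (d - c) * \<bar>y - x\<bar>" .
      next
        assume "x = d"
        then have "\<bar>(y - c) * (d - y)\<bar> = (y - c) * \<bar>y - x\<bar>"
          using True by (simp add: abs_mult)
        also have "\<dots> \<le> (d - c) * \<bar>y - x\<bar>"
          using True by (intro mult_right_mono) auto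
        finally show "\<bar>(y - c) * (d - y)\<bar> \<le> (d - c) * \<bar>y - x\<bar>" .
      qed
      then have "\<bar>poly (bump_quadratic c d) y\<bar>\<^sup>2 \<le> ((d - c) * \<bar>y - x\<bar>)\<^sup>2"
        by (intro power_mono) auto
      then have sq: "(poly (bump_quadratic c d) y)\<^sup>2 \<le> (d - c)\<^sup>2 * (y - x)\<^sup>2"
        by (simp add: power_mult_distrib)
      have "\<bar>bump c d p k y\<bar> \<le> C * (poly (bump_quadratic c d) y)\<^sup>2"
        using C True by blast
      also have "\<dots> \<le> \<bar>C\<bar> * (poly (bump_quadratic c d) y)\<^sup>2"
        by (intro mult_right_mono) auto
      also have "\<dots> \<le> \<bar>C\<bar> * ((d - c)\<^sup>2 * (y - x)\<^sup>2)"
        by (intro mult_left_mono sq) auto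
      finally show ?thesis
        by (simp add: K_def mult.assoc)
    qed (auto simp: bump_def K_def)
    have zero: "bump c d q j x = 0" for q j
      using 3 by (auto simp: bump_def)
    have "((\<lambda>y. (bump c d p k y - bump c d p k x) / (y - x)) \<longlongrightarrow> 0) (at x)"
    proof (rule Lim_null_comparison)
      have "norm ((bump c d p k y - bump c d p k x) / (y - x)) \<le> K * \<bar>y - x\<bar>" for y
      proof (cases "y = x")
        case False
        have "\<bar>bump c d p k y\<bar> \<le> (K * \<bar>y - x\<bar>) * \<bar>y - x\<bar>"
          using bound[of y] by (simp add: power2_eq_square mult.assoc)
        then show ?thesis
          using False by (simp add: zero divide_le_eq)
      qed simp
      then show "\<forall>\<^sub>F y in at x. norm ((bump c d p k y - bump c d p k x) / (y - x)) \<le> K * \<bar>y - x\<bar>"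
        by simp
      have "((\<lambda>y. K * \<bar>y - x\<bar>) \<longlongrightarrow> K * \<bar>x - x\<bar>) (at x)"
        by (intro tendsto_intros)
      then show "((\<lambda>y. K * \<bar>y - x\<bar>) \<longlongrightarrow> 0) (at x)"
        by simp
    qed
    then show ?thesis
      by (simp add: has_field_derivative_iff zero)
  qed
qed

lemma smooth_bump:
  assumes "c < d"
  shows "smooth (\<lambda>x. complex_of_real (bump c d p k x))"
proof -
  have deriv: "((\<lambda>x. complex_of_real (bump c d p k x)) has_vector_derivative
      complex_of_real (bump c d (bump_pderiv c d p k) (k + 2) x)) (at x)" for p k x
    using bump_has_real_derivative[OF assms] by (rule has_vector_derivative_of_real)
  have iterate: "\<exists>p' k'. ((\<lambda>v t. vector_derivative v (at t)) ^^ n) (\<lambda>x. complex_of_real (bump c d p k x))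
      = (\<lambda>x. complex_of_real (bump c d p' k' x))" for n
  proof (induction n)
    case (Suc n)
    then obtain p' k' where "((\<lambda>v t. vector_derivative v (at t)) ^^ n) (\<lambda>x. complex_of_real (bump c d p k x))
      = (\<lambda>x. complex_of_real (bump c d p' k' x))"
      by blast
    then show ?case
      using vector_derivative_at[OF deriv[of p' k']] by auto
  qed auto
  have "((\<lambda>v t. vector_derivative v (at t)) ^^ n) (\<lambda>x. complex_of_real (bump c d p k x)) differentiable (at x)" for n x
  proof -
    obtain p' k' where eq: "((\<lambda>v t. vector_derivative v (at t)) ^^ n) (\<lambda>x. complex_of_real (bump c d p k x))
      = (\<lambda>x. complex_of_real (bump c d p' k' x))"
      using iterate by blast
    show ?thesis
      unfolding eq by (rule differentiableI_vector[OF deriv])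
  qed
  then show ?thesis
    unfolding smooth_def by blast
qed

lemma cutoff_function:
  assumes I: "is_interval I" "open I" and I': "closed I'" "bounded I'" "I' \<subseteq> I" "I' \<noteq> {}"
  obtains \<psi> :: "real \<Rightarrow> real" and L \<delta> where "(\<lambda>x. complex_of_real (\<psi> x)) \<in> test_functions I"
    "\<And>x. 0 \<le> \<psi> x" "\<And>x. \<psi> x \<le> 1" "\<And>x. x \<notin> I \<Longrightarrow> \<psi> x = 0" "\<psi> \<in> borel_measurable borel"
    "\<And>x y. \<bar>\<psi> x - \<psi> y\<bar> \<le> L * \<bar>x - y\<bar>" "0 < \<delta>" "\<And>x. x \<in> I' \<Longrightarrow> \<delta> \<le> \<psi> x"
proof -
  have comp: "compact I'"
    using I' by (simp add: compact_eq_bounded_closed)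
  obtain a b where a: "a \<in> I'" "\<And>x. x \<in> I' \<Longrightarrow> a \<le> x" and b: "b \<in> I'" "\<And>x. x \<in> I' \<Longrightarrow> x \<le> b"
    using compact_attains_inf[OF comp I'(4)] compact_attains_sup[OF comp I'(4)] by blast
  obtain e1 where e1: "e1 > 0" "ball a e1 \<subseteq> I"
    using I(2) a(1) I'(3) open_contains_ball by blast
  obtain e2 where e2: "e2 > 0" "ball b e2 \<subseteq> I"
    using I(2) b(1) I'(3) open_contains_ball by blast
  \<comment> \<open>The hull [a, b] of \<open>I'\<close> is enlarged by half the radii, so the bump
    is positive on all of \<open>I'\<close> while its support stays in \<open>I\<close>.\<close>
  define c d where "c = a - e1 / 2" and "d = b + e2 / 2"
  have "c \<in> ball a e1" "d \<in> ball b e2"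
    using e1(1) e2(1) by (simp_all add: c_def d_def dist_real_def)
  then have cI: "c \<in> I" and dI: "d \<in> I"
    using e1(2) e2(2) by blast+
  have c: "c < a" and d: "b < d"
    using e1(1) e2(1) by (simp_all add: c_def d_def)
  have cd: "c < d"
    using c d a(2)[OF b(1)] by linarith
  have sub: "{c..d} \<subseteq> I"
    using mem_is_interval_1_I[OF I(1) cI dI] by auto
  define \<psi> where "\<psi> = bump c d [:1:] 0"
  have \<psi>: "\<psi> x = (if c < x \<and> x < d then exp (- 1 / ((x - c) * (d - x))) else 0)" for x
    by (simp add: \<psi>_def bump_def poly_bump_quadratic)
  have deriv: "(\<psi> has_real_derivative bump c d (bump_pderiv c d [:1:] 0) 2 x) (at x)" for x
    using bump_has_real_derivative[OF cd, of "[:1:]" 0 x] unfolding \<psi>_def add_0 .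
  have cont: "continuous_on A \<psi>" for A
    by (intro continuous_at_imp_continuous_on ballI DERIV_isCont[OF deriv])
  have cont': "continuous_on A (bump c d q j)" for A q j
    by (intro continuous_at_imp_continuous_on ballI DERIV_isCont[OF bump_has_real_derivative[OF cd]])
  from compact_imp_bounded[OF compact_continuous_image[OF cont' compact_Icc]]
  obtain L where L0: "L > 0" "\<forall>y\<in>bump c d (bump_pderiv c d [:1:] 0) 2 ` {c..d}. norm y \<le> L"
    unfolding bounded_pos by blast
  then have L: "L > 0" "\<And>x. x \<in> {c..d} \<Longrightarrow> \<bar>bump c d (bump_pderiv c d [:1:] 0) 2 x\<bar> \<le> L"
    by auto
  have L': "norm (bump c d (bump_pderiv c d [:1:] 0) 2 x) \<le> L" for x
    using L(1) L(2)[of x] by (cases "x \<in> {c..d}") (auto simp: bump_def)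
  have lip: "\<bar>\<psi> x - \<psi> y\<bar> \<le> L * \<bar>x - y\<bar>" for x y
    using field_differentiable_bound[of UNIV \<psi> "bump c d (bump_pderiv c d [:1:] 0) 2" L x y] deriv L' by simp
  have "\<exists>\<delta>>0. \<forall>x\<in>I'. \<delta> \<le> \<psi> x"
  proof -
    obtain x0 where x0: "x0 \<in> I'" "\<And>x. x \<in> I' \<Longrightarrow> \<psi> x0 \<le> \<psi> x"
      using continuous_attains_inf[OF comp I'(4) cont] by blast
    have "\<psi> x0 > 0"
      using a(2)[OF x0(1)] b(2)[OF x0(1)] c d by (simp add: \<psi>)
    with x0 show ?thesis by blast
  qed
  then obtain \<delta> where \<delta>: "\<delta> > 0" "\<And>x. x \<in> I' \<Longrightarrow> \<delta> \<le> \<psi> x"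
    by blast
  show ?thesis
  proof (rule that)
    have supp: "closure {x. complex_of_real (\<psi> x) \<noteq> 0} \<subseteq> {c..d}"
      by (rule closure_minimal) (auto simp: \<psi> split: if_splits)
    then have "compact (closure {x. complex_of_real (\<psi> x) \<noteq> 0})"
      using compact_Int_closed[OF compact_Icc closed_closure, of c d "{x. complex_of_real (\<psi> x) \<noteq> 0}"]
      by (simp add: Int_absorb1)
    moreover have "smooth (\<lambda>x. complex_of_real (\<psi> x))"
      unfolding \<psi>_def by (rule smooth_bump[OF cd])
    ultimately show "(\<lambda>x. complex_of_real (\<psi> x)) \<in> test_functions I"
      using supp sub by (auto simp: test_functions_def)
    show "0 \<le> \<psi> x" for x
      by (simp add: \<psi>)
    show "\<psi> x \<le> 1" for x
      by (simp add: \<psi>)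
    show "\<psi> x = 0" if "x \<notin> I" for x
      using subsetD[OF sub, of x] that by (auto simp: \<psi>)
    show "\<psi> \<in> borel_measurable borel"
      by (rule borel_measurable_continuous_onI[OF cont])
  qed (rule lip \<delta>; assumption)+
qed

section \<open>The limiting absorption principle\<close>

context selfadjoint_operator
begin

lemma calculus_real_symmetric:
  assumes "(\<lambda>x. complex_of_real (u x)) \<in> bounded_borel"
  shows "cinner (borel_calculus T (\<lambda>x. complex_of_real (u x)) f) g = cinner f (borel_calculus T (\<lambda>x. complex_of_real (u x)) g)"
  using calculus_adjoint[OF assms] by simp

lemma bracket_power_symmetric:
  "r \<le> 0 \<Longrightarrow> cinner (bracket_power T r f) g = cinner f (bracket_power T r g)"
  unfolding bracket_power_def by (rule calculus_real_symmetric[OF japanese_bracket_power_bounded_borel])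

lemma bounded_clinear_bracket_power: "r \<le> 0 \<Longrightarrow> bounded_clinear (bracket_power T r)"
  unfolding bracket_power_def by (intro bounded_clinear_calculus japanese_bracket_power_bounded_borel)

lemma norm_bracket_power_le: "r \<le> 0 \<Longrightarrow> norm (bracket_power T r f) \<le> norm f"
  unfolding bracket_power_def
  using norm_calculus_le[OF japanese_bracket_power_bounded_borel, of r 1 f] japanese_bracket_powr_le_1[of r]
  by simp

lemma bracket_power_add:
  assumes "r \<le> 0" "r' \<le> 0"
  shows "bracket_power T (r + r') f = bracket_power T r (bracket_power T r' f)"
  unfolding bracket_power_def
    calculus_mult[OF japanese_bracket_power_bounded_borel[OF assms(1)] japanese_bracket_power_bounded_borel[OF assms(2)], symmetric]
  by (simp add: powr_add)

lemma bounded_clinear_resolvent: "Im z \<noteq> 0 \<Longrightarrow> bounded_clinear (resolvent T z)"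
  unfolding resolvent_eq by (intro bounded_clinear_calculus resolvent_function_bounded_borel)

lemma Im_times_norm_resolvent:
  assumes z: "Im z \<noteq> 0"
  shows "\<bar>Im z\<bar> * (norm (resolvent T z g))\<^sup>2 \<le> cmod (cinner (resolvent T z g) g)"
proof -
  let ?f = "resolvent T z g"
  have "cinner ?f (op_app T ?f) = cinner ?f g + z * complex_of_real ((norm ?f)\<^sup>2)"
    by (simp add: resolvent_in_dom(2)[OF z] cinner_add_right cinner_self)
  moreover have "Im (cinner ?f (op_app T ?f)) = 0"
    by (simp add: cinner_op_app[OF resolvent_in_dom(1)[OF z]])
  ultimately have "Im z * (norm ?f)\<^sup>2 = - Im (cinner ?f g)"
    by simp
  then have "\<bar>Im z * (norm ?f)\<^sup>2\<bar> = \<bar>Im (cinner ?f g)\<bar>"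
    by (simp only: abs_minus_cancel)
  then show ?thesis
    using abs_Im_le_cmod[of "cinner ?f g"] by (simp add: abs_mult)
qed

end

text \<open>The virial identity; in the application \<open>\<bar>Im z\<bar> \<parallel>f\<parallel>\<^sup>2\<close> is itself bounded by \<open>\<bar>\<langle>f, g\<rangle>\<bar>\<close>, so both
  terms stay bounded as \<open>Im z\<close> tends to \<open>0\<close>.\<close>

lemma Re_commutator_form:
  assumes Hf: "op_app H f = g + z *\<^sub>C f" and B: "cinner (B f) f = cinner f (B f)" "cinner (B f) g = cnj (cinner g (B f))"
  shows "Re (commutator_form H B f f) = 2 * Im z * Re (cinner f (B f)) - 2 * Im (cinner g (B f))"
proof -
  define w where "w = cinner g (B f)"
  define \<beta> where "\<beta> = cinner f (B f)"
  have "cnj \<beta> = \<beta>"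
    unfolding \<beta>_def using B(1) cinner_commute[of "B f" f] by simp
  then have \<beta>: "Im \<beta> = 0"
    by (simp add: complex_eq_iff)
  have "commutator_form H B f f = \<i> * (w + cnj z * \<beta>) - \<i> * (cnj w + z * \<beta>)"
    by (simp add: commutator_form_def Hf cinner_add_left cinner_add_right B w_def \<beta>_def)
  then show ?thesis
    using \<beta> by (simp add: w_def[symmetric] \<beta>_def[symmetric])
qed

text \<open>The bound involves only the constants of the Mourre estimate, of the cut-off and of its
  commutation with the weight, none of which depends on \<open>z\<close>.\<close>

lemma weighted_resolvent_bound:
  fixes H A :: "'a::chilbert_space \<rightharpoonup> 'a" and \<phi> :: "real \<Rightarrow> real"
  assumes "selfadjoint H" "selfadjoint A"
    and I: "is_interval I" "open I" and H: "H \<in> class_C1_loc A I"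
    and \<phi>: "\<phi> \<in> borel_measurable borel" "bounded (range \<phi>)"
    and mourre: "c > 0" "weighted_mourre_estimate H A I \<phi> c (2 * s - 1)"
    and s: "0 < s" "s < 1"
    and I': "closed I'" "bounded I'" "I' \<subseteq> I"
  shows "\<exists>K\<ge>0. \<forall>z h. Re z \<in> I' \<longrightarrow> Im z \<noteq> 0 \<longrightarrow>
    norm (bracket_power A (-s) (resolvent H z (bracket_power A (-s) h))) \<le> K * norm h"
proof (cases "I' = {}")
  case False
  interpret H: selfadjoint_operator H by standard fact
  interpret A: selfadjoint_operator A by standard fact
  obtain \<psi> :: "real \<Rightarrow> real" and L \<delta> where \<psi>: "(\<lambda>x. complex_of_real (\<psi> x)) \<in> test_functions I"
      "\<And>x. 0 \<le> \<psi> x" "\<And>x. \<psi> x \<le> 1" "\<And>x. x \<notin> I \<Longrightarrow> \<psi> x = 0" "\<psi> \<in> borel_measurable borel"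
      "\<And>x y. \<bar>\<psi> x - \<psi> y\<bar> \<le> L * \<bar>x - y\<bar>" and \<delta>: "0 < \<delta>" "\<And>x. x \<in> I' \<Longrightarrow> \<delta> \<le> \<psi> x"
    by (rule cutoff_function[OF I I' False]) (rule that)
  let ?\<psi> = "\<lambda>x. complex_of_real (\<psi> x)"
  have \<psi>b: "?\<psi> \<in> bounded_borel"
    using \<psi>(2,3,5) by (intro bounded_borelI[where C = 1]) auto
  let ?P = "bracket_power A (-s)"
  define \<Psi> where "\<Psi> = borel_calculus H ?\<psi>"
  have "\<Psi> \<in> class_C1 A"
    using H \<psi>(1) by (simp add: class_C1_loc_def \<Psi>_def)
  then obtain C where C: "\<And>h. \<exists>k. \<Psi> (?P h) = ?P k \<and> norm k \<le> C * norm h"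
    using A.class_C1_weighted_bounded[OF _ s] by blast
  define B where "B = borel_calculus A (\<lambda>x. complex_of_real (\<phi> x))"
  obtain b where b: "b > 0" "\<And>x. \<bar>\<phi> x\<bar> \<le> b"
    using \<phi>(2) unfolding bounded_pos by auto
  have \<phi>b: "(\<lambda>x. complex_of_real (\<phi> x)) \<in> bounded_borel"
    using \<phi>(1) b(2) by (intro bounded_borelI[where C = b]) auto
  have B_le: "norm (B f) \<le> b * norm f" for f
    unfolding B_def using b(2) by (intro A.norm_calculus_le[OF \<phi>b]) simp
  have B_sym: "cinner (B f) g = cinner f (B g)" for f g
    unfolding B_def by (rule A.calculus_real_symmetric[OF \<phi>b])
  have PB: "?P (B f) = B (?P f)" for f
    unfolding B_def bracket_power_def
    using s by (intro A.calculus_commute japanese_bracket_power_bounded_borel \<phi>b) simp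
  have E: "spectral_projection H I = borel_calculus H (indicator I)"
    using I(2) by (intro H.spectral_projection_eq) simp
  have Ib: "indicator I \<in> bounded_borel"
    using I(2) by (intro bounded_borel_indicator) simp
  \<comment> \<open>The first summand bounds the part through \<open>f\<close>, the second the
    remainder \<open>v\<close>; \<delta> comes from dividing by \<psi>(\<kappa>).\<close>
  define K where "K = (4 * b / c * \<bar>C\<bar> + \<bar>L\<bar>) / \<delta>"
  have K: "K \<ge> 0"
    using b(1) mourre(1) \<delta>(1) by (simp add: K_def)
  have "norm (?P (resolvent H z (?P h))) \<le> K * norm h" if z: "Re z \<in> I'" "Im z \<noteq> 0" for z h
  proof -
    let ?r = "\<lambda>x. 1 / (complex_of_real x - z)"
    have r: "?r \<in> bounded_borel"
      by (rule resolvent_function_bounded_borel[OF z(2)])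
    define g where "g = \<Psi> (?P h)"
    obtain k where k: "g = ?P k" "norm k \<le> C * norm h"
      using C[of h] by (auto simp: g_def)
    define f where "f = resolvent H z g"
    define n where "n = norm (?P f)"
    have f: "f = borel_calculus H ?r (\<Psi> (?P h))"
      by (simp add: f_def g_def H.resolvent_eq[OF z(2)])
    have "(\<lambda>x. indicator I x * ?\<psi> x) = ?\<psi>"
      using \<psi>(4) by (auto simp: fun_eq_iff indicator_def)
    then have "borel_calculus H (indicator I) (\<Psi> y) = \<Psi> y" for y
      unfolding \<Psi>_def H.calculus_mult[OF Ib \<psi>b, symmetric] by simp
    \<comment> \<open>As \<psi> vanishes off \<open>I\<close>, the vector \<open>f\<close> lies in
      the range of E_I(H), and the Mourre estimate can be read at \<open>f\<close> without
      projections.\<close>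
    then have Ef: "spectral_projection H I f = f"
      unfolding E f H.calculus_commute[OF Ib r] by simp
    \<comment> \<open>The weight contained in g = <A>^-s k is moved through \<open>B\<close> onto
      \<open>f\<close>; the bound then involves <A>^-s f and not \<open>f\<close>, whose norm may
      blow up.\<close>
    have wg: "cmod (cinner g (B f)) \<le> norm k * (b * n)"
    proof -
      have "cinner g (B f) = cinner k (B (?P f))"
        using s by (simp add: k(1) A.bracket_power_symmetric PB)
      also have "cmod \<dots> \<le> norm k * norm (B (?P f))"
        by (rule cinner_Cauchy_Schwarz)
      also have "\<dots> \<le> norm k * (b * n)"
        unfolding n_def by (intro mult_left_mono B_le) simp
      finally show ?thesis .
    qed
    have fB: "\<bar>Im z\<bar> * \<bar>Re (cinner f (B f))\<bar> \<le> norm k * (b * n)"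
    proof -
      have "\<bar>Re (cinner f (B f))\<bar> \<le> norm f * norm (B f)"
        by (rule order_trans[OF abs_Re_le_cmod cinner_Cauchy_Schwarz])
      also have "\<dots> \<le> norm f * (b * norm f)"
        by (intro mult_left_mono B_le) simp
      finally have "\<bar>Im z\<bar> * \<bar>Re (cinner f (B f))\<bar> \<le> \<bar>Im z\<bar> * (norm f * (b * norm f))"
        by (intro mult_left_mono) auto
      also have "\<dots> = b * (\<bar>Im z\<bar> * (norm f)\<^sup>2)"
        by (simp add: power2_eq_square)
      also have "\<dots> \<le> b * cmod (cinner f g)"
        unfolding f_def using b(1) by (intro mult_left_mono H.Im_times_norm_resolvent z) simp
      also have "cinner f g = cinner (?P f) k"
        using s by (simp add: k(1) A.bracket_power_symmetric)
      also have "b * cmod (cinner (?P f) k) \<le> b * (n * norm k)"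
        unfolding n_def using b(1) by (intro mult_left_mono cinner_Cauchy_Schwarz) simp
      finally show ?thesis
        by (simp add: mult_ac)
    qed
    have "commutator_form H B f f - complex_of_real c * cinner f (bracket_power A (-1 - (2 * s - 1)) f) \<in> \<real>\<^sub>\<ge>\<^sub>0"
    proof -
      have "commutator_form H B (spectral_projection H I f) (spectral_projection H I f)
        - complex_of_real c * cinner (spectral_projection H I f)
            (bracket_power A (-1 - (2 * s - 1)) (spectral_projection H I f)) \<in> \<real>\<^sub>\<ge>\<^sub>0"
        using mourre(2)
        unfolding weighted_mourre_estimate_def form_le_def sandwich_form_def operator_form_def B_def
        by (rule spec)
      then show ?thesis
        by (simp only: Ef)
    qed
    moreover have "cinner f (bracket_power A (-1 - (2 * s - 1)) f) = complex_of_real (n\<^sup>2)"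
    proof -
      have "bracket_power A (-1 - (2 * s - 1)) f = ?P (?P f)"
        using A.bracket_power_add[of "-s" "-s" f] s by simp
      then have "cinner f (bracket_power A (-1 - (2 * s - 1)) f) = cinner (?P f) (?P f)"
        using s by (simp add: A.bracket_power_symmetric)
      then show ?thesis
        by (simp add: cinner_self n_def)
    qed
    ultimately have "commutator_form H B f f - complex_of_real (c * n\<^sup>2) \<in> \<real>\<^sub>\<ge>\<^sub>0"
      by simp
    then have "c * n\<^sup>2 \<le> Re (commutator_form H B f f)"
      by (simp add: complex_nonneg_Reals_iff)
    also have "\<dots> = 2 * Im z * Re (cinner f (B f)) - 2 * Im (cinner g (B f))"
    proof (rule Re_commutator_form)
      show "op_app H f = g + z *\<^sub>C f"
        unfolding f_def by (rule H.resolvent_in_dom(2)[OF z(2)])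
      show "cinner (B f) f = cinner f (B f)"
        by (rule B_sym)
      show "cinner (B f) g = cnj (cinner g (B f))"
        by (rule cinner_commute)
    qed
    also have "\<dots> \<le> 2 * (\<bar>Im z\<bar> * \<bar>Re (cinner f (B f))\<bar>) + 2 * cmod (cinner g (B f))"
      using abs_Im_le_cmod[of "cinner g (B f)"] abs_ge_self[of "Im z * Re (cinner f (B f))"]
      by (simp add: abs_mult[symmetric])
    also have "\<dots> \<le> 4 * b * norm k * n"
      using wg fB by (simp add: mult_ac)
    finally have "c * n\<^sup>2 \<le> 4 * b * norm k * n" .
    then have "c * n \<le> 4 * b * norm k"
      using b(1) by (cases "n = 0") (auto simp: power2_eq_square n_def mult.assoc[symmetric])
    also have "\<dots> \<le> 4 * b * (\<bar>C\<bar> * norm h)"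
      using b(1) k(2) mult_right_mono[OF abs_ge_self[of C] norm_ge_zero[of h]]
      by (intro mult_left_mono) auto
    finally have n: "n \<le> 4 * b / c * \<bar>C\<bar> * norm h"
      using mourre(1) by (simp add: field_simps)
    define \<kappa> where "\<kappa> = Re z"
    have \<kappa>: "\<psi> \<kappa> \<ge> \<delta>"
      using \<delta>(2) z(1) by (simp add: \<kappa>_def)
    \<comment> \<open>The numerator vanishes at \<kappa> = Re z, and |x - \<kappa>| \<le> |x - z|,
      so the Lipschitz constant of \<psi> bounds the quotient uniformly in Im z.\<close>
    define v where "v x = (1 - ?\<psi> x / ?\<psi> \<kappa>) * ?r x" for x
    have v_le: "cmod (v x) \<le> \<bar>L\<bar> / \<delta>" for x
    proof -
      have pos: "\<psi> \<kappa> > 0"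
        using \<kappa> \<delta>(1) by linarith
      have ne: "cmod (complex_of_real x - z) > 0"
        using z(2) by (auto simp: complex_eq_iff)
      have "\<bar>\<psi> \<kappa> - \<psi> x\<bar> \<le> \<bar>L\<bar> * \<bar>\<kappa> - x\<bar>"
        using \<psi>(6)[of \<kappa> x] mult_right_mono[OF abs_ge_self[of L] abs_ge_zero[of "\<kappa> - x"]] by linarith
      also have "\<dots> \<le> \<bar>L\<bar> * cmod (complex_of_real x - z)"
        using abs_Re_le_cmod[of "complex_of_real x - z"]
        by (intro mult_left_mono) (auto simp: \<kappa>_def abs_minus_commute)
      finally have 1: "\<bar>\<psi> \<kappa> - \<psi> x\<bar> / cmod (complex_of_real x - z) \<le> \<bar>L\<bar>"
        using ne by (simp add: divide_le_eq)
      have "v x = of_real (\<psi> \<kappa> - \<psi> x) / (of_real (\<psi> \<kappa>) * (complex_of_real x - z))"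
        using pos by (simp add: v_def field_simps)
      then have "cmod (v x) = \<bar>\<psi> \<kappa> - \<psi> x\<bar> / cmod (complex_of_real x - z) / \<psi> \<kappa>"
        using pos by (simp add: norm_divide norm_mult del: of_real_diff)
      also have "\<dots> \<le> \<bar>L\<bar> / \<delta>"
        using 1 \<kappa> \<delta>(1) by (intro frac_le) auto
      finally show ?thesis .
    qed
    have vb: "v \<in> bounded_borel"
    proof (rule bounded_borelI[OF _ v_le])
      show "v \<in> borel_measurable borel"
        unfolding v_def[abs_def] using \<psi>(5) by measurable
    qed
    have rb: "(\<lambda>x. (1 / ?\<psi> \<kappa>) * (?r x * ?\<psi> x)) \<in> bounded_borel"
      by (intro bounded_borel_scale bounded_borel_mult[OF r \<psi>b])
    \<comment> \<open>The first term sends <A>^-s h to f/\<psi>(\<kappa>), which is already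
      controlled; the second is bounded in operator norm, so the weights around it only
      contract.\<close>
    have "?r = (\<lambda>x. (1 / ?\<psi> \<kappa>) * (?r x * ?\<psi> x) + v x)"
      by (simp add: fun_eq_iff v_def diff_divide_distrib)
    then have "resolvent H z (?P h) = borel_calculus H (\<lambda>x. (1 / ?\<psi> \<kappa>) * (?r x * ?\<psi> x) + v x) (?P h)"
      by (simp only: H.resolvent_eq[OF z(2)])
    also have "\<dots> = (1 / ?\<psi> \<kappa>) *\<^sub>C f + borel_calculus H v (?P h)"
      unfolding H.calculus_add[OF rb vb] H.calculus_scale[OF bounded_borel_mult[OF r \<psi>b]] f \<Psi>_def
        H.calculus_mult[OF r \<psi>b] ..
    finally have "?P (resolvent H z (?P h)) = (1 / ?\<psi> \<kappa>) *\<^sub>C ?P f + ?P (borel_calculus H v (?P h))"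
      using A.bounded_clinear_bracket_power[of "-s"] s
      by (simp add: bounded_clinear_add bounded_clinear_scaleC)
    then have tri: "norm (?P (resolvent H z (?P h))) \<le> norm ((1 / ?\<psi> \<kappa>) *\<^sub>C ?P f) + norm (?P (borel_calculus H v (?P h)))"
      by (simp only: norm_triangle_ineq)
    have "norm ((1 / ?\<psi> \<kappa>) *\<^sub>C ?P f) = n / \<psi> \<kappa>"
      using \<kappa> \<delta>(1) by (simp add: n_def norm_divide)
    also have "\<dots> \<le> (4 * b / c * \<bar>C\<bar> * norm h) / \<delta>"
      using n \<kappa> \<delta>(1) b(1) mourre(1) by (intro frac_le) (auto simp: n_def)
    finally have main: "norm ((1 / ?\<psi> \<kappa>) *\<^sub>C ?P f) \<le> (4 * b / c * \<bar>C\<bar> * norm h) / \<delta>" .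
    have "norm (?P (borel_calculus H v (?P h))) \<le> \<bar>L\<bar> / \<delta> * norm h"
    proof -
      have "norm (?P (borel_calculus H v (?P h))) \<le> norm (borel_calculus H v (?P h))"
        using s by (intro A.norm_bracket_power_le) simp
      also have "\<dots> \<le> \<bar>L\<bar> / \<delta> * norm (?P h)"
        by (rule H.norm_calculus_le[OF vb v_le])
      also have "\<dots> \<le> \<bar>L\<bar> / \<delta> * norm h"
        using s \<delta>(1) by (intro mult_left_mono A.norm_bracket_power_le) auto
      finally show ?thesis .
    qed
    with tri main have "norm (?P (resolvent H z (?P h))) \<le> (4 * b / c * \<bar>C\<bar> * norm h) / \<delta> + \<bar>L\<bar> / \<delta> * norm h"
      by linarith
    then show ?thesis
      by (simp add: K_def add_divide_distrib distrib_right)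
  qed
  with K show ?thesis by blast
qed auto

theorem theorem1p1:
  fixes H A :: "'a::chilbert_space \<rightharpoonup> 'a"
    and I :: "real set"
  assumes "selfadjoint H" and "selfadjoint A"
    and "is_interval I" and "open I" and "bounded I"
    and "H \<in> class_C1_loc A I"
    and "\<exists>\<epsilon>\<^sub>0>0. \<forall>\<epsilon>\<in>{0<..\<epsilon>\<^sub>0}. \<exists>(\<phi> :: real \<Rightarrow> real) c\<^sub>1.
           \<phi> \<in> borel_measurable borel \<and> bounded (range \<phi>) \<and> c\<^sub>1 > 0 \<and>
           weighted_mourre_estimate H A I \<phi> c\<^sub>1 \<epsilon>"
  shows "\<forall>s>1/2. \<forall>I'. is_interval I' \<and> closed I' \<and> I' \<subseteq> I \<longrightarrow>
           (let Z = {z. Re z \<in> I' \<and> Im z \<noteq> 0};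
                R = (\<lambda>z. bracket_power A (-s) \<circ> resolvent H z \<circ> bracket_power A (-s))
            in (\<forall>z\<in>Z. bounded_clinear (R z)) \<and> bdd_above ((\<lambda>z. onorm (R z)) ` Z))"
proof (intro allI impI, elim conjE)
  fix s :: real and I' :: "real set"
  assume s: "s > 1/2" and I': "is_interval I'" "closed I'" "I' \<subseteq> I"
  interpret H: selfadjoint_operator H by standard fact
  interpret A: selfadjoint_operator A by standard fact
  obtain \<epsilon>\<^sub>0 where \<epsilon>\<^sub>0: "\<epsilon>\<^sub>0 > 0" "\<And>\<epsilon>. \<epsilon> \<in> {0<..\<epsilon>\<^sub>0} \<Longrightarrow> \<exists>(\<phi> :: real \<Rightarrow> real) c\<^sub>1.
      \<phi> \<in> borel_measurable borel \<and> bounded (range \<phi>) \<and> c\<^sub>1 > 0 \<and> weighted_mourre_estimate H A I \<phi> c\<^sub>1 \<epsilon>"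
    using assms(7) by blast
  \<comment> \<open>Three demands on the working exponent: t \<le> s, t < 1 for the commutation with
    the cut-off, and 2t - 1 \<le> \<epsilon>0 so that the hypothesis applies.\<close>
  define t where "t = min s (min (3/4) ((1 + \<epsilon>\<^sub>0) / 2))"
  have t: "1/2 < t" "t < 1" "t \<le> s" "2 * t - 1 \<in> {0<..\<epsilon>\<^sub>0}"
    using s \<epsilon>\<^sub>0(1) by (auto simp: t_def min_def field_simps)
  obtain \<phi> :: "real \<Rightarrow> real" and c where \<phi>: "\<phi> \<in> borel_measurable borel" "bounded (range \<phi>)" "c > 0"
      "weighted_mourre_estimate H A I \<phi> c (2 * t - 1)"
    using \<epsilon>\<^sub>0(2)[OF t(4)] by blast
  obtain K where K: "K \<ge> 0" "\<And>z h. Re z \<in> I' \<Longrightarrow> Im z \<noteq> 0 \<Longrightarrow>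
      norm (bracket_power A (-t) (resolvent H z (bracket_power A (-t) h))) \<le> K * norm h"
    using weighted_resolvent_bound[OF assms(1-4,6) \<phi> _ t(2) I'(2) bounded_subset[OF assms(5) I'(3)] I'(3)] t(1)
    by auto
  define R where "R z = bracket_power A (-s) \<circ> resolvent H z \<circ> bracket_power A (-s)" for z
  have lin: "bounded_clinear (R z)" if "Im z \<noteq> 0" for z
    unfolding R_def comp_def using s that
    by (intro bounded_clinear_compose[OF A.bounded_clinear_bracket_power
        bounded_clinear_compose[OF H.bounded_clinear_resolvent A.bounded_clinear_bracket_power]]) auto
  have bound: "onorm (R z) \<le> K" if z: "Re z \<in> I'" "Im z \<noteq> 0" for z
  proof (rule onorm_bound[OF K(1)])
    fix h
    \<comment> \<open>The exponent -s is split as (t - s) + (-t); the factor with t - s \<le> 0 is a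
      contraction on both sides of the resolvent.\<close>
    let ?P = "bracket_power A (-t)" and ?Q = "bracket_power A (t - s)"
    have left: "bracket_power A (-s) f = ?Q (?P f)" for f
      using A.bracket_power_add[of "t - s" "-t" f] t by simp
    have right: "bracket_power A (-s) f = ?P (?Q f)" for f
      using A.bracket_power_add[of "-t" "t - s" f] t by simp
    have "norm (R z h) = norm (?Q (?P (resolvent H z (?P (?Q h)))))"
      unfolding R_def comp_def left[of "resolvent H z _"] right[of h] ..
    also have "\<dots> \<le> norm (?P (resolvent H z (?P (?Q h))))"
      using t(3) by (intro A.norm_bracket_power_le) simp
    also have "\<dots> \<le> K * norm (?Q h)"
      by (rule K(2)[OF z])
    also have "\<dots> \<le> K * norm h"
      using t(3) by (intro mult_left_mono A.norm_bracket_power_le K(1)) simp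
    finally show "norm (R z h) \<le> K * norm h" .
  qed
  show "let Z = {z. Re z \<in> I' \<and> Im z \<noteq> 0};
      R = (\<lambda>z. bracket_power A (-s) \<circ> resolvent H z \<circ> bracket_power A (-s))
    in (\<forall>z\<in>Z. bounded_clinear (R z)) \<and> bdd_above ((\<lambda>z. onorm (R z)) ` Z)"
    using lin bound unfolding Let_def R_def[symmetric] by (auto intro!: bdd_aboveI[where M = K])
qed

end
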